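(* Let $n \ge 2$ be an integer and let $M$ be a Hopf manifold of complex dimension $n$, i.e. a compact complex manifold whose universal covering is (biholomorphic to) $\mathbb{C}^n \setminus \{0\}$. Then $M$ admits a locally conformally Kähler structure compatible with its complex structure; that is, if $J$ denotes the complex structure of $M$, there exist a Hermitian metric $h$ on $(M,J)$, with associated fundamental $2$-form $\Omega$, and a closed real $1$-form $\theta$ on $M$ such that $d\Omega = \theta \wedge \Omega$.
   Context: A (generalized) Hopf manifold of complex dimension $n$ ($n \ge 2$) is a compact complex manifold whose universal covering is $W = \mathbb{C}^n \setminus \{0\}$. Equivalently, $M = W/G$, where the covering transformation group $G$ acts on $W$ by holomorphic automorphisms, properly discontinuously and without fixed points, with compact quotient. The group $G$ is not assumed to be infinite cyclic, nor to act by linear maps. A locally conformally Kähler (lcK) structure on a differentiable manifold $M$ is a Hermitian structure $(h,J)$ on $M$ ($J$ an integrable complex structure, $h$ a $J$-Hermitian Riemannian metric) whose associated fundamental form $\Omega$ (the real $(1,1)$-form given, up to a sign convention, by $\Omega(X,Y) = h(JX,Y)$) satisfies $d\Omega = \theta \wedge \Omega$ for some closed $1$-form $\theta$ (called the Lee form). The form $\theta$ is allowed to be exact or zero in this definition. *)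

theory Defs
  imports "HOL-Analysis.Analysis"
begin

section \<open>Smooth and holomorphic maps on open sets\<close>

text \<open>On an open subset of a finite-dimensional space, being \<open>C\<^sup>k\<close> is expressed by iterated
  directional derivatives.\<close>

primrec Ck_on :: "nat \<Rightarrow> ('a::euclidean_space \<Rightarrow> 'b::real_normed_vector) \<Rightarrow> 'a set \<Rightarrow> bool" where
  "Ck_on 0 f S \<longleftrightarrow> continuous_on S f"
| "Ck_on (Suc k) f S \<longleftrightarrow> (\<forall>x\<in>S. f differentiable (at x)) \<and>
     (\<forall>v. Ck_on k (\<lambda>x. frechet_derivative f (at x) v) S)"

definition smooth_on :: "('a::euclidean_space \<Rightarrow> 'b::real_normed_vector) \<Rightarrow> 'a set \<Rightarrow> bool" where
  "smooth_on f S \<longleftrightarrow> open S \<and> (\<forall>k. Ck_on k f S)"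

definition holomorphic_map_on :: "(complex^'n::finite \<Rightarrow> complex^'m::finite) \<Rightarrow> (complex^'n) set \<Rightarrow> bool" where
  "holomorphic_map_on f S \<longleftrightarrow> open S \<and>
     (\<forall>x\<in>S. \<exists>D. (f has_derivative D) (at x) \<and> (\<forall>c v. D (c *s v) = c *s D v))"

definition biholomorphic_map_on :: "(complex^'n::finite \<Rightarrow> complex^'n) \<Rightarrow> (complex^'n) set \<Rightarrow> bool" where
  "biholomorphic_map_on f S \<longleftrightarrow> holomorphic_map_on f S \<and>
     (\<exists>g. holomorphic_map_on g (f ` S) \<and> (\<forall>x\<in>S. g (f x) = x))"

section \<open>Complex manifolds\<close>

text \<open>A chart \<open>(U, \<phi>)\<close> consists of its domain and its coordinate map; \<open>\<phi>\<close> is only relevant on \<open>U\<close>.\<close>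

type_synonym ('a, 'n) chart = "'a set \<times> ('a \<Rightarrow> complex^'n)"

definition chart_image :: "('a, 'n::finite) chart \<Rightarrow> (complex^'n) set" where
  "chart_image c = snd c ` fst c"

definition transition :: "('a, 'n::finite) chart \<Rightarrow> ('a, 'n::finite) chart \<Rightarrow> complex^'n \<Rightarrow> complex^'n" where
  "transition c d = snd d \<circ> inv_into (fst c) (snd c)"

definition is_chart :: "'a::topological_space set \<Rightarrow> ('a, 'n::finite) chart \<Rightarrow> bool" where
  "is_chart M c \<longleftrightarrow> openin (top_of_set M) (fst c) \<and> open (chart_image c) \<and>
     (\<exists>\<psi>. homeomorphism (fst c) (chart_image c) (snd c) \<psi>)"

text \<open>The atlas is not required to be maximal: any holomorphic atlas determines the complex
  structure.\<close>

definition complex_manifold ::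
    "'a::topological_space set \<Rightarrow> ('a, 'n::finite) chart set \<Rightarrow> bool" where
  "complex_manifold M A \<longleftrightarrow>
     Hausdorff_space (top_of_set M) \<and>
     second_countable (top_of_set M) \<and>
     (\<forall>c\<in>A. is_chart M c) \<and> \<Union>(fst ` A) = M \<and>
     (\<forall>c\<in>A. \<forall>d\<in>A. holomorphic_map_on (transition c d) (snd c ` (fst c \<inter> fst d)))"

text \<open>\<open>p\<close> exhibits the open set \<open>W\<close>, with its standard complex structure, as the universal covering
  of \<open>(M, A)\<close>: the complex structure of the covering space is the one for which \<open>p\<close> is locally
  biholomorphic.\<close>

definition holomorphic_universal_covering ::
    "(complex^'n) set \<Rightarrow> (complex^'n \<Rightarrow> 'a) \<Rightarrow> 'a::topological_space set \<Rightarrow>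
     ('a, 'n::finite) chart set \<Rightarrow> bool" where
  "holomorphic_universal_covering W p M A \<longleftrightarrow>
     open W \<and> simply_connected W \<and> covering_space W p M \<and>
     (\<forall>c\<in>A. \<forall>z\<in>W. p z \<in> fst c \<longrightarrow>
        (\<exists>V. open V \<and> z \<in> V \<and> V \<subseteq> W \<and> p ` V \<subseteq> fst c \<and> biholomorphic_map_on (snd c \<circ> p) V))"

definition hopf_manifold :: "'a::topological_space set \<Rightarrow> ('a, 'n::finite) chart set \<Rightarrow> bool" where
  "hopf_manifold M A \<longleftrightarrow> complex_manifold M A \<and> compact M \<and>
     (\<exists>p. holomorphic_universal_covering (- {0}) p M A)"

section \<open>Tensor fields and forms on a complex manifold\<close>

text \<open>A covariant tensor field is given by its coordinate expressions, one for every chart of the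
  atlas, related by pullback along the transition maps. Coordinate expressions take a point of the
  chart image followed by real tangent vectors, which are elements of \<open>complex^'n\<close>; only their
  values on the chart images matter.\<close>

type_synonym ('a, 'n) field1 =
  "('a, 'n) chart \<Rightarrow> complex^'n \<Rightarrow> complex^'n \<Rightarrow> real"

type_synonym ('a, 'n) field2 =
  "('a, 'n) chart \<Rightarrow> complex^'n \<Rightarrow> complex^'n \<Rightarrow> complex^'n \<Rightarrow> real"

definition smooth_one_form :: "('a, 'n::finite) chart set \<Rightarrow> ('a, 'n::finite) field1 \<Rightarrow> bool" where
  "smooth_one_form A \<theta> \<longleftrightarrow>
     (\<forall>c\<in>A. (\<forall>z\<in>chart_image c. linear (\<theta> c z)) \<and>
            (\<forall>v. smooth_on (\<lambda>z. \<theta> c z v) (chart_image c))) \<and>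
     (\<forall>c\<in>A. \<forall>d\<in>A. \<forall>x\<in>fst c \<inter> fst d. \<forall>v.
        \<theta> c (snd c x) v =
        \<theta> d (snd d x) (frechet_derivative (transition c d) (at (snd c x)) v))"

definition smooth_bilinear_field :: "('a, 'n::finite) chart set \<Rightarrow> ('a, 'n::finite) field2 \<Rightarrow> bool" where
  "smooth_bilinear_field A h \<longleftrightarrow>
     (\<forall>c\<in>A. (\<forall>z\<in>chart_image c. bilinear (h c z)) \<and>
            (\<forall>v w. smooth_on (\<lambda>z. h c z v w) (chart_image c))) \<and>
     (\<forall>c\<in>A. \<forall>d\<in>A. \<forall>x\<in>fst c \<inter> fst d. \<forall>v w.
        h c (snd c x) v w =
        h d (snd d x) (frechet_derivative (transition c d) (at (snd c x)) v)
                      (frechet_derivative (transition c d) (at (snd c x)) w))"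

text \<open>The almost complex structure \<open>J\<close> of the manifold. Since the transition maps are holomorphic, it is
  multiplication by the imaginary unit in every chart of the atlas.\<close>

definition Jc :: "complex^'n \<Rightarrow> complex^'n" where
  "Jc v = \<i> *s v"

definition hermitian_metric :: "('a, 'n::finite) chart set \<Rightarrow> ('a, 'n::finite) field2 \<Rightarrow> bool" where
  "hermitian_metric A h \<longleftrightarrow> smooth_bilinear_field A h \<and>
     (\<forall>c\<in>A. \<forall>z\<in>chart_image c.
        (\<forall>v w. h c z v w = h c z w v) \<and>
        (\<forall>v. v \<noteq> 0 \<longrightarrow> h c z v v > 0) \<and>
        (\<forall>v w. h c z (Jc v) (Jc w) = h c z v w))"

definition fundamental_form :: "('a, 'n::finite) field2 \<Rightarrow> ('a, 'n::finite) field2" where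
  "fundamental_form h c z v w = h c z (Jc v) w"

text \<open>Exterior derivatives and the wedge product are those of coordinate expressions, evaluated on
  constant vector fields, with the convention without factorial factors.\<close>

definition ext_deriv1 :: "(complex^'n \<Rightarrow> complex^'n \<Rightarrow> real) \<Rightarrow>
    complex^'n \<Rightarrow> complex^'n \<Rightarrow> complex^'n \<Rightarrow> real" where
  "ext_deriv1 \<alpha> z u v =
     frechet_derivative (\<lambda>y. \<alpha> y v) (at z) u - frechet_derivative (\<lambda>y. \<alpha> y u) (at z) v"

definition ext_deriv2 :: "(complex^'n \<Rightarrow> complex^'n \<Rightarrow> complex^'n \<Rightarrow> real) \<Rightarrow>
    complex^'n \<Rightarrow> complex^'n \<Rightarrow> complex^'n \<Rightarrow> complex^'n \<Rightarrow> real" where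
  "ext_deriv2 \<omega> z u v w =
     frechet_derivative (\<lambda>y. \<omega> y v w) (at z) u - frechet_derivative (\<lambda>y. \<omega> y u w) (at z) v
     + frechet_derivative (\<lambda>y. \<omega> y u v) (at z) w"

definition wedge12 :: "('v \<Rightarrow> real) \<Rightarrow> ('v \<Rightarrow> 'v \<Rightarrow> real) \<Rightarrow> 'v \<Rightarrow> 'v \<Rightarrow> 'v \<Rightarrow> real" where
  "wedge12 \<alpha> \<omega> u v w = \<alpha> u * \<omega> v w - \<alpha> v * \<omega> u w + \<alpha> w * \<omega> u v"

definition closed_one_form :: "('a, 'n::finite) chart set \<Rightarrow> ('a, 'n::finite) field1 \<Rightarrow> bool" where
  "closed_one_form A \<theta> \<longleftrightarrow> smooth_one_form A \<theta> \<and>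
     (\<forall>c\<in>A. \<forall>z\<in>chart_image c. \<forall>u v. ext_deriv1 (\<theta> c) z u v = 0)"

definition lck_structure ::
    "('a, 'n::finite) chart set \<Rightarrow> ('a, 'n::finite) field2 \<Rightarrow> ('a, 'n::finite) field1 \<Rightarrow> bool" where
  "lck_structure A h \<theta> \<longleftrightarrow> hermitian_metric A h \<and> closed_one_form A \<theta> \<and>
     (\<forall>c\<in>A. \<forall>z\<in>chart_image c. \<forall>u v w.
        ext_deriv2 (fundamental_form h c) z u v w =
        wedge12 (\<theta> c z) (fundamental_form h c z) u v w)"

end

(*
  Write M = W/G with W = C^n - {0}. If a positive smooth function Phi on W is strictly
  plurisubharmonic and every g in G multiplies it by a positive constant, then the complex Hessian
  of Phi divided by Phi is a Hermitian metric that descends to M, and it is locally conformally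
  Kaehler with Lee form -d log Phi.

  Phi is the sum over all g in G of T^(n(g)) psi(g z). Here psi is a radial bump function on W that is
  plurisubharmonic except in a thin outer shell, and n : G -> Z is the homomorphism counting with sign
  the points of an orbit that g moves across the unit sphere. Compactness of M and proper
  discontinuity give an element gamma of G that contracts a large shell around the origin deeply into
  the unit ball, so n(gamma) > 0. If g z lies in the bad outer shell, then gamma g z lies in the
  region where psi is strictly plurisubharmonic, and for large T the term of gamma g outweighs the
  term of g. The maximum principle on complex discs avoiding the origin (n >= 2) shows that elements
  of G are bounded near 0, which makes n well defined.

  The covering theory of the library requires a normed base space, so M is first embedded into one.
*)
theory Submission
  imports Defs "HOL-Complex_Analysis.Conformal_Mappings"
begin

section \<open>Calculus of smooth maps\<close>

text \<open>Nothing is known about the elements of G beyond the covering, so everything has to be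
  extracted from the action on W. An invariant strictly plurisubharmonic function would descend to
  the compact M and violate the maximum principle; a nontrivial character of G is therefore forced,
  and orbit counting supplies one. For the same reason a bump function cannot be plurisubharmonic
  everywhere: at its outer edge it has to come down from its maximum. At the inner edge no such loss
  occurs, because exp(-1/t) is convex and increasing for small t > 0, so the defect is confined to
  one compact shell. The constant T is fixed last. The bump \<psi> depends on a lower bound of
  |\<gamma>| on the bad shell, and T only has to make the Hessian of \<psi> o \<gamma> dominate that
  of \<psi> there; pulling back by h turns this into the inequality needed at z, with the same T for
  all h. On M only the ratios of the Hessian and of the differential of \<Phi> to \<Phi> itself
  appear. They ignore constant factors, so any local section of the covering computes them.\<close>

abbreviation ddir :: "('a::real_normed_vector \<Rightarrow> 'b::real_normed_vector) \<Rightarrow> 'a \<Rightarrow> 'a \<Rightarrow> 'b" where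
  "ddir f v \<equiv> \<lambda>x. frechet_derivative f (at x) v"

lemma ddir_eq: "(f has_derivative f') (at x) \<Longrightarrow> ddir f v x = f' v"
  by (metis frechet_derivative_at)

lemma has_derivative_cong_open:
  assumes "open S" "x \<in> S" "\<And>y. y \<in> S \<Longrightarrow> f y = g y"
  shows "(f has_derivative D) (at x) \<longleftrightarrow> (g has_derivative D) (at x)"
  using has_derivative_transform_within_open[OF _ assms(1,2), of f D UNIV g]
    has_derivative_transform_within_open[OF _ assms(1,2), of g D UNIV f] assms(3) by metis

lemma frechet_derivative_cong_open:
  assumes "open S" "x \<in> S" "\<And>y. y \<in> S \<Longrightarrow> f y = g y"
  shows "frechet_derivative f (at x) = frechet_derivative g (at x)"
proof -
  have "(f has_derivative D) (at x) \<longleftrightarrow> (g has_derivative D) (at x)" for D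
    by (rule has_derivative_cong_open[OF assms(1,2)]) (rule assms(3))
  then show ?thesis by (simp add: frechet_derivative_def)
qed

lemma differentiable_cong_open:
  assumes "open S" "x \<in> S" "\<And>y. y \<in> S \<Longrightarrow> f y = g y"
  shows "f differentiable at x \<longleftrightarrow> g differentiable at x"
proof -
  have "(f has_derivative D) (at x) \<longleftrightarrow> (g has_derivative D) (at x)" for D
    by (rule has_derivative_cong_open[OF assms(1,2)]) (rule assms(3))
  then show ?thesis by (simp add: differentiable_def)
qed

lemma Ck_on_cong:
  assumes "open S" "\<And>y. y \<in> S \<Longrightarrow> f y = g y"
  shows "Ck_on k f S \<longleftrightarrow> Ck_on k g S"
  using assms(2)
proof (induction k arbitrary: f g)
  case 0 then show ?case by (simp cong: continuous_on_cong)
next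
  case (Suc k)
  have "Ck_on k (ddir f v) S \<longleftrightarrow> Ck_on k (ddir g v) S" for v
  proof (rule Suc.IH)
    fix y assume "y \<in> S"
    then show "ddir f v y = ddir g v y"
      by (subst frechet_derivative_cong_open[of S y f g]) (use assms(1) Suc.prems in auto)
  qed
  moreover have "f differentiable at x \<longleftrightarrow> g differentiable at x" if "x \<in> S" for x
    by (rule differentiable_cong_open[OF assms(1) that]) (rule Suc.prems)
  ultimately show ?case by simp
qed

lemma Ck_on_subset: "Ck_on k f T \<Longrightarrow> S \<subseteq> T \<Longrightarrow> Ck_on k f S"
  by (induction k arbitrary: f) (auto intro: continuous_on_subset)

lemma Ck_on_locally:
  assumes "\<And>x. x \<in> S \<Longrightarrow> \<exists>T. open T \<and> x \<in> T \<and> Ck_on k f (T \<inter> S)"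
  shows "Ck_on k f S"
  using assms
proof (induction k arbitrary: f)
  case 0
  show ?case unfolding Ck_on.simps continuous_on_eq_continuous_within
  proof
    fix x assume x: "x \<in> S"
    then obtain T where T: "open T" "x \<in> T" "continuous_on (T \<inter> S) f" using 0 by auto
    then have "continuous (at x within T \<inter> S) f" using x by (auto simp: continuous_on_eq_continuous_within)
    moreover have "at x within T \<inter> S = at x within S"
      using T by (intro at_within_nhd[of x T]) auto
    ultimately show "continuous (at x within S) f" by (simp add: continuous_within)
  qed
next
  case (Suc k)
  have "f differentiable at x" if x: "x \<in> S" for x
    using Suc.prems[OF x] x by auto
  moreover have "Ck_on k (ddir f v) S" for v
  proof (rule Suc.IH)
    fix x assume "x \<in> S"
    from Suc.prems[OF this] obtain T where "open T" "x \<in> T" "Ck_on (Suc k) f (T \<inter> S)" by blast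
    then show "\<exists>T. open T \<and> x \<in> T \<and> Ck_on k (ddir f v) (T \<inter> S)" by (intro exI[of _ T]) simp
  qed
  ultimately show ?case by simp
qed

lemma Ck_on_imp_continuous: "Ck_on k f S \<Longrightarrow> continuous_on S f"
proof (cases k)
  case (Suc m)
  assume "Ck_on k f S"
  then show ?thesis
    by (auto simp: Suc intro!: continuous_at_imp_continuous_on differentiable_imp_continuous_within)
qed auto

lemma Ck_on_Suc_has_derivative:
  "Ck_on (Suc k) f S \<Longrightarrow> x \<in> S \<Longrightarrow> (f has_derivative frechet_derivative f (at x)) (at x)"
  using frechet_derivative_works by auto

lemma Ck_on_Suc_imp: "Ck_on (Suc k) f S \<Longrightarrow> Ck_on k f S"
proof (induction k arbitrary: f)
  case 0 then show ?case using Ck_on_imp_continuous Ck_on.simps(1) by blast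
next
  case (Suc k)
  then have "Ck_on (Suc k) (ddir f v) S" for v by simp
  then have "Ck_on k (ddir f v) S" for v by (rule Suc.IH)
  with Suc.prems show ?case by simp
qed

lemma Ck_on_SucI:
  assumes "open S" "\<And>x. x \<in> S \<Longrightarrow> (f has_derivative f' x) (at x)" "\<And>v. Ck_on k (\<lambda>x. f' x v) S"
  shows "Ck_on (Suc k) f S"
proof -
  have "Ck_on k (ddir f v) S" for v
    using assms(3)[of v] Ck_on_cong[OF assms(1), of "ddir f v" "\<lambda>x. f' x v"] ddir_eq[OF assms(2)] by auto
  then show ?thesis using assms(2) by (auto simp: differentiable_def)
qed

lemma Ck_on_const: "Ck_on k (\<lambda>x. c) S"
  by (induction k arbitrary: c) auto

lemma Ck_on_bounded_linear:
  assumes "open S" "Ck_on k f S" "bounded_linear h"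
  shows "Ck_on k (\<lambda>x. h (f x)) S"
  using assms(2)
proof (induction k arbitrary: f)
  case 0 then show ?case using assms(3) by (simp add: bounded_linear.continuous_on)
next
  case (Suc k)
  show ?case
  proof (rule Ck_on_SucI[OF assms(1)])
    fix x assume "x \<in> S"
    then have "(f has_derivative frechet_derivative f (at x)) (at x)"
      using Suc.prems Ck_on_Suc_has_derivative by blast
    then show "((\<lambda>x. h (f x)) has_derivative (\<lambda>v. h (ddir f v x))) (at x)"
      using bounded_linear.has_derivative[OF assms(3)] by blast
  next
    fix v show "Ck_on k (\<lambda>x. h (ddir f v x)) S" using Suc by auto
  qed
qed

lemma Ck_on_ident: "open S \<Longrightarrow> Ck_on k (\<lambda>x. x) S"
  by (cases k) (auto simp: Ck_on_const)

lemma Ck_on_add: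
  assumes "open S" "Ck_on k f S" "Ck_on k g S"
  shows "Ck_on k (\<lambda>x. f x + g x) S"
  using assms(2,3)
proof (induction k arbitrary: f g)
  case 0 then show ?case by (simp add: continuous_on_add)
next
  case (Suc k)
  show ?case
  proof (rule Ck_on_SucI[OF assms(1)])
    fix x assume "x \<in> S"
    then show "((\<lambda>x. f x + g x) has_derivative (\<lambda>v. ddir f v x + ddir g v x)) (at x)"
      using Suc.prems by (intro has_derivative_add Ck_on_Suc_has_derivative)
  next
    fix v show "Ck_on k (\<lambda>x. ddir f v x + ddir g v x) S" using Suc by auto
  qed
qed

lemma Ck_on_sum:
  assumes "open S" "\<And>i. i \<in> I \<Longrightarrow> Ck_on k (f i) S"
  shows "Ck_on k (\<lambda>x. \<Sum>i\<in>I. f i x) S"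
  using assms(2)
  by (induction I rule: infinite_finite_induct) (auto simp: Ck_on_const intro!: Ck_on_add[OF assms(1)])

lemma Ck_on_bilinear:
  assumes "open S" "Ck_on k f S" "Ck_on k g S" "bounded_bilinear h"
  shows "Ck_on k (\<lambda>x. h (f x) (g x)) S"
  using assms(2,3)
proof (induction k arbitrary: f g)
  case 0 then show ?case using assms(4) by (simp add: bounded_bilinear.continuous_on)
next
  case (Suc k)
  show ?case
  proof (rule Ck_on_SucI[OF assms(1)])
    fix x assume "x \<in> S"
    then show "((\<lambda>x. h (f x) (g x)) has_derivative (\<lambda>v. h (f x) (ddir g v x) + h (ddir f v x) (g x))) (at x)"
      using Suc.prems by (intro bounded_bilinear.FDERIV[OF assms(4)] Ck_on_Suc_has_derivative)
  next
    fix v show "Ck_on k (\<lambda>x. h (f x) (ddir g v x) + h (ddir f v x) (g x)) S"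
      using Suc Ck_on_Suc_imp[OF Suc.prems(1)] Ck_on_Suc_imp[OF Suc.prems(2)]
      by (intro Ck_on_add[OF assms(1)]) auto
  qed
qed

lemmas Ck_on_mult = Ck_on_bilinear[OF _ _ _ bounded_bilinear_mult]
lemmas Ck_on_scaleR = Ck_on_bilinear[OF _ _ _ bounded_bilinear_scaleR]

text \<open>The chain rule differentiates \<open>g\<close> in the direction
  \<open>ddir f v x\<close>, which moves with \<open>x\<close>, while \<open>Ck_on\<close> controls
  fixed directions. Expanding that direction in \<open>Basis\<close> leaves a finite sum of products
  covered by the induction hypothesis.\<close>

lemma Ck_on_compose:
  fixes f :: "'a::euclidean_space \<Rightarrow> 'b::euclidean_space" and g :: "'b \<Rightarrow> 'c::real_normed_vector"
  assumes "open S" "Ck_on k f S" "Ck_on k g T" "f ` S \<subseteq> T"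
  shows "Ck_on k (\<lambda>x. g (f x)) S"
  using assms(2,3)
proof (induction k arbitrary: g)
  case 0 then show ?case using assms(4) by (auto intro: continuous_on_compose2)
next
  case (Suc k)
  show ?case
  proof (rule Ck_on_SucI[OF assms(1)])
    fix x assume x: "x \<in> S"
    then have df: "(f has_derivative frechet_derivative f (at x)) (at x)"
      using Suc.prems Ck_on_Suc_has_derivative by blast
    have dg: "(g has_derivative frechet_derivative g (at (f x))) (at (f x))"
      using Suc.prems Ck_on_Suc_has_derivative x assms(4) by blast
    have lin: "linear (frechet_derivative g (at (f x)))"
      using dg has_derivative_linear by blast
    have rep: "frechet_derivative g (at (f x)) u = (\<Sum>b\<in>Basis. (u \<bullet> b) *\<^sub>R ddir g b (f x))" for u
      using lin by (subst euclidean_representation[of u, symmetric])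
        (simp add: linear_sum linear_scale del: euclidean_representation)
    show "((\<lambda>x. g (f x)) has_derivative
        (\<lambda>v. \<Sum>b\<in>Basis. (ddir f v x \<bullet> b) *\<^sub>R ddir g b (f x))) (at x)"
      using diff_chain_at[OF df dg] unfolding o_def rep[of "frechet_derivative f (at x) _"] .
  next
    fix v
    have "Ck_on k (\<lambda>x. ddir g b (f x)) S" for b
      using Suc.IH[of "ddir g b"] Suc.prems Ck_on_Suc_imp[OF Suc.prems(1)] by simp
    moreover have "Ck_on k (\<lambda>x. ddir f v x \<bullet> b) S" for b
      using Suc.prems(1) by (intro Ck_on_bounded_linear[OF assms(1) _ bounded_linear_inner_left]) simp
    ultimately show "Ck_on k (\<lambda>x. \<Sum>b\<in>Basis. (ddir f v x \<bullet> b) *\<^sub>R ddir g b (f x)) S"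
      by (intro Ck_on_sum Ck_on_scaleR assms(1))
  qed
qed

lemma Ck_on_inverse:
  fixes f :: "'a::euclidean_space \<Rightarrow> real"
  assumes "open S" "Ck_on k f S" "\<And>x. x \<in> S \<Longrightarrow> f x \<noteq> 0"
  shows "Ck_on k (\<lambda>x. inverse (f x)) S"
  using assms(2)
proof (induction k)
  case 0 then show ?case using assms(3) by (auto intro: continuous_on_inverse)
next
  case (Suc k)
  show ?case
  proof (rule Ck_on_SucI[OF assms(1)])
    fix x assume "x \<in> S"
    then show "((\<lambda>x. inverse (f x)) has_derivative (\<lambda>v. - (inverse (f x) * ddir f v x * inverse (f x)))) (at x)"
      using Suc.prems assms(3) by (intro Deriv.has_derivative_inverse Ck_on_Suc_has_derivative) auto
  next
    fix v
    have "Ck_on k (\<lambda>x. inverse (f x)) S" "Ck_on k (ddir f v) S" 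
      using Suc Ck_on_Suc_imp[OF Suc.prems] by auto
    then show "Ck_on k (\<lambda>x. - (inverse (f x) * ddir f v x * inverse (f x))) S"
      by (intro Ck_on_bounded_linear[OF assms(1) _ bounded_linear_minus[OF bounded_linear_ident]] Ck_on_mult assms(1))
  qed
qed

subsection \<open>Smooth functions\<close>

lemma smooth_on_open: "smooth_on f S \<Longrightarrow> open S"
  by (simp add: smooth_on_def)

lemma smooth_on_cong:
  assumes "\<And>y. y \<in> S \<Longrightarrow> f y = g y" shows "smooth_on f S \<longleftrightarrow> smooth_on g S"
  unfolding smooth_on_def by (metis Ck_on_cong assms)

lemma smooth_on_subset: "smooth_on f T \<Longrightarrow> S \<subseteq> T \<Longrightarrow> open S \<Longrightarrow> smooth_on f S"
  unfolding smooth_on_def by (metis Ck_on_subset)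

lemma smooth_on_locally:
  assumes "open S" "\<And>x. x \<in> S \<Longrightarrow> \<exists>T. open T \<and> x \<in> T \<and> T \<subseteq> S \<and> smooth_on f T"
  shows "smooth_on f S"
proof -
  have "Ck_on k f S" for k
  proof (rule Ck_on_locally)
    fix x assume "x \<in> S"
    then obtain T where "open T" "x \<in> T" "T \<subseteq> S" "smooth_on f T" using assms(2) by blast
    then show "\<exists>T. open T \<and> x \<in> T \<and> Ck_on k f (T \<inter> S)"
      by (intro exI[of _ T]) (auto simp: smooth_on_def Int_absorb2)
  qed
  with assms(1) show ?thesis by (simp add: smooth_on_def)
qed

lemma smooth_on_differentiable: "smooth_on f S \<Longrightarrow> x \<in> S \<Longrightarrow> f differentiable at x"
  unfolding smooth_on_def by (elim conjE allE[of _ "Suc 0"]) simp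

lemma smooth_on_has_derivative:
  "smooth_on f S \<Longrightarrow> x \<in> S \<Longrightarrow> (f has_derivative frechet_derivative f (at x)) (at x)"
  using smooth_on_differentiable frechet_derivative_works by blast

lemma smooth_on_linear: "smooth_on f S \<Longrightarrow> x \<in> S \<Longrightarrow> linear (frechet_derivative f (at x))"
  using smooth_on_differentiable linear_frechet_derivative by blast

lemma smooth_on_continuous: "smooth_on f S \<Longrightarrow> continuous_on S f"
  unfolding smooth_on_def by (elim conjE allE[of _ 0]) simp

lemma smooth_on_ddir:
  assumes "smooth_on f S" shows "smooth_on (ddir f v) S"
proof -
  have "Ck_on (Suc k) f S" for k using assms unfolding smooth_on_def by blast
  then show ?thesis using assms unfolding smooth_on_def Ck_on.simps(2) by blast
qed

lemma smooth_on_const: "open S \<Longrightarrow> smooth_on (\<lambda>x. c) S"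
  by (simp add: smooth_on_def Ck_on_const)

lemma smooth_on_ident: "open S \<Longrightarrow> smooth_on (\<lambda>x. x) S"
  by (simp add: smooth_on_def Ck_on_ident)

lemma smooth_on_bounded_linear: "smooth_on f S \<Longrightarrow> bounded_linear h \<Longrightarrow> smooth_on (\<lambda>x. h (f x)) S"
  by (simp add: smooth_on_def Ck_on_bounded_linear)

lemma smooth_on_add: "smooth_on f S \<Longrightarrow> smooth_on g S \<Longrightarrow> smooth_on (\<lambda>x. f x + g x) S"
  by (simp add: smooth_on_def Ck_on_add)

lemma smooth_on_sum: "open S \<Longrightarrow> (\<And>i. i \<in> I \<Longrightarrow> smooth_on (f i) S) \<Longrightarrow> smooth_on (\<lambda>x. \<Sum>i\<in>I. f i x) S"
  by (simp add: smooth_on_def Ck_on_sum)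

lemma smooth_on_mult:
  fixes f g :: "'a::euclidean_space \<Rightarrow> real"
  shows "smooth_on f S \<Longrightarrow> smooth_on g S \<Longrightarrow> smooth_on (\<lambda>x. f x * g x) S"
  by (simp add: smooth_on_def Ck_on_mult)

lemma smooth_on_minus: "smooth_on f S \<Longrightarrow> smooth_on (\<lambda>x. - f x) S"
  by (rule smooth_on_bounded_linear[OF _ bounded_linear_minus[OF bounded_linear_ident]])

lemma smooth_on_compose:
  fixes f :: "'a::euclidean_space \<Rightarrow> 'b::euclidean_space"
  shows "smooth_on f S \<Longrightarrow> smooth_on g T \<Longrightarrow> f ` S \<subseteq> T \<Longrightarrow> smooth_on (\<lambda>x. g (f x)) S"
  unfolding smooth_on_def by (intro conjI allI Ck_on_compose[of S _ f g T]) auto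

lemma smooth_on_inverse:
  fixes f :: "'a::euclidean_space \<Rightarrow> real"
  shows "smooth_on f S \<Longrightarrow> (\<And>x. x \<in> S \<Longrightarrow> f x \<noteq> 0) \<Longrightarrow> smooth_on (\<lambda>x. inverse (f x)) S"
  by (simp add: smooth_on_def Ck_on_inverse)

lemma smooth_on_divide:
  fixes f g :: "'a::euclidean_space \<Rightarrow> real"
  shows "smooth_on f S \<Longrightarrow> smooth_on g S \<Longrightarrow> (\<And>x. x \<in> S \<Longrightarrow> g x \<noteq> 0) \<Longrightarrow> smooth_on (\<lambda>x. f x / g x) S"
  unfolding divide_inverse by (intro smooth_on_mult smooth_on_inverse)

subsection \<open>Symmetry of second derivatives\<close>

text \<open>The mean value theorem is applied along \<open>v\<close> to the increment of
  \<open>f\<close> by \<open>h *\<^sub>R w\<close>, then along \<open>w\<close> to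
  \<open>ddir f v\<close>. The second difference is symmetric in \<open>v\<close> and
  \<open>w\<close>, so it can be used to compare the two orders of differentiation.\<close>

lemma second_difference_mean_value:
  fixes f :: "'a::euclidean_space \<Rightarrow> real"
  assumes f: "smooth_on f S" and e: "h > 0"
    and S: "\<And>s t. s \<in> {0..h} \<Longrightarrow> t \<in> {0..h} \<Longrightarrow> z + s *\<^sub>R v + t *\<^sub>R w \<in> S"
  shows "\<exists>s\<in>{0..h}. \<exists>t\<in>{0..h}. f (z + h *\<^sub>R v + h *\<^sub>R w) - f (z + h *\<^sub>R v) - f (z + h *\<^sub>R w) + f z
           = h * h * ddir (ddir f v) w (z + s *\<^sub>R v + t *\<^sub>R w)"
proof -
  have der: "((\<lambda>r. g (a + r *\<^sub>R u)) has_real_derivative ddir g u (a + r *\<^sub>R u)) (at r)"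
    if g: "smooth_on g S" and a: "a + r *\<^sub>R u \<in> S" for g :: "'a \<Rightarrow> real" and a u r
  proof -
    have "((\<lambda>r. a + r *\<^sub>R u) has_derivative (\<lambda>x. x *\<^sub>R u)) (at r)"
      by (auto intro!: derivative_eq_intros)
    from diff_chain_at[OF this smooth_on_has_derivative[OF g a]]
    show ?thesis
      using linear_scale[OF smooth_on_linear[OF g a]]
      by (simp add: o_def has_field_derivative_def mult.commute[of _ "frechet_derivative _ _ _"])
  qed
  have "\<exists>s>0. s < h \<and> (\<lambda>s. f ((z + h *\<^sub>R w) + s *\<^sub>R v) - f (z + s *\<^sub>R v)) h - (\<lambda>s. f ((z + h *\<^sub>R w) + s *\<^sub>R v) - f (z + s *\<^sub>R v)) 0
     = (h - 0) * (ddir f v ((z + h *\<^sub>R w) + s *\<^sub>R v) - ddir f v (z + s *\<^sub>R v))"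
  proof (rule MVT2[OF e])
    fix x assume x: "0 \<le> x" "x \<le> h"
    show "((\<lambda>s. f ((z + h *\<^sub>R w) + s *\<^sub>R v) - f (z + s *\<^sub>R v)) has_real_derivative
       ddir f v ((z + h *\<^sub>R w) + x *\<^sub>R v) - ddir f v (z + x *\<^sub>R v)) (at x)"
      by (intro DERIV_diff der f) (use S[of x h] S[of x 0] x e in \<open>auto simp: algebra_simps\<close>)
  qed
  then obtain s where s: "0 < s" "s < h" and s2: "f (z + h *\<^sub>R v + h *\<^sub>R w) - f (z + h *\<^sub>R v) - f (z + h *\<^sub>R w) + f z
     = h * (ddir f v ((z + s *\<^sub>R v) + h *\<^sub>R w) - ddir f v (z + s *\<^sub>R v))"
    by (auto simp: algebra_simps)
  have "\<exists>t>0. t < h \<and> ddir f v ((z + s *\<^sub>R v) + h *\<^sub>R w) - ddir f v ((z + s *\<^sub>R v) + 0 *\<^sub>R w)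
     = (h - 0) * (ddir (ddir f v) w ((z + s *\<^sub>R v) + t *\<^sub>R w))"
    by (rule MVT2[OF e]) (use S[of s] s e in \<open>auto intro!: der smooth_on_ddir f\<close>)
  then obtain t where "0 < t" "t < h" "ddir f v ((z + s *\<^sub>R v) + h *\<^sub>R w) - ddir f v (z + s *\<^sub>R v)
     = h * (ddir (ddir f v) w ((z + s *\<^sub>R v) + t *\<^sub>R w))"
    by auto
  with s s2 show ?thesis
    by (intro bexI[of _ s] bexI[of _ t]) (auto simp: algebra_simps)
qed

text \<open>Each mixed derivative, at some point of the same small parallelogram, equals one second
  difference divided by \<open>h * h\<close>. Continuity at \<open>z\<close> turns a gap between the
  two into a contradiction.\<close>

lemma ddir_commute:
  fixes f :: "'a::euclidean_space \<Rightarrow> real"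
  assumes f: "smooth_on f S" and z: "z \<in> S"
  shows "ddir (ddir f v) w z = ddir (ddir f w) v z"
proof (rule ccontr)
  assume ne: "ddir (ddir f v) w z \<noteq> ddir (ddir f w) v z"
  define e where "e = \<bar>ddir (ddir f v) w z - ddir (ddir f w) v z\<bar> / 2"
  have e: "e > 0" using ne by (simp add: e_def)
  have c: "continuous_on S (ddir (ddir f v) w)" "continuous_on S (ddir (ddir f w) v)"
    using smooth_on_continuous[OF smooth_on_ddir[OF smooth_on_ddir[OF f]]] by auto
  have oS: "open S" using f smooth_on_open by blast
  obtain d1 where d1: "d1 > 0" "ball z d1 \<subseteq> S" using oS z open_contains_ball by blast
  obtain d2 where d2: "d2 > 0" "\<And>y. y \<in> S \<Longrightarrow> dist y z < d2 \<Longrightarrow> dist (ddir (ddir f v) w y) (ddir (ddir f v) w z) < e"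
    using c(1) z e unfolding continuous_on_iff by blast
  obtain d3 where d3: "d3 > 0" "\<And>y. y \<in> S \<Longrightarrow> dist y z < d3 \<Longrightarrow> dist (ddir (ddir f w) v y) (ddir (ddir f w) v z) < e"
    using c(2) z e unfolding continuous_on_iff by blast
  define d where "d = min d1 (min d2 d3)"
  define N where "N = norm v + norm w + 1"
  define h where "h = d / (2 * N)"
  have d: "d > 0" using d1 d2 d3 by (simp add: d_def)
  have N: "N > 0" by (simp add: add_nonneg_pos N_def)
  then have h: "h > 0" using d by (simp add: h_def)
  have near: "norm (s *\<^sub>R v + t *\<^sub>R w) < d" if "s \<in> {0..h}" "t \<in> {0..h}" for s t
  proof -
    have "norm (s *\<^sub>R v + t *\<^sub>R w) \<le> s * norm v + t * norm w"
      using that norm_triangle_ineq[of "s *\<^sub>R v" "t *\<^sub>R w"] by simp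
    also have "\<dots> \<le> h * norm v + h * norm w" using that by (intro add_mono mult_right_mono) auto
    also have "\<dots> \<le> h * N" using h by (simp add: algebra_simps N_def)
    also have "\<dots> = d / 2" using N by (simp add: h_def)
    also have "\<dots> < d" using d by simp
    finally show ?thesis .
  qed
  have S: "z + s *\<^sub>R v + t *\<^sub>R w \<in> S \<and> dist (z + s *\<^sub>R v + t *\<^sub>R w) z < d" if "s \<in> {0..h}" "t \<in> {0..h}" for s t
  proof -
    have "dist (z + s *\<^sub>R v + t *\<^sub>R w) z < d" using near[OF that] by (simp add: dist_norm algebra_simps)
    moreover from this have "z + s *\<^sub>R v + t *\<^sub>R w \<in> ball z d1" by (simp add: d_def dist_commute)
    ultimately show ?thesis using d1 by blast
  qed
  obtain s t where st: "s \<in> {0..h}" "t \<in> {0..h}" "f (z + h *\<^sub>R v + h *\<^sub>R w) - f (z + h *\<^sub>R v) - f (z + h *\<^sub>R w) + f z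
           = h * h * ddir (ddir f v) w (z + s *\<^sub>R v + t *\<^sub>R w)"
    using second_difference_mean_value[OF f h, of z v w] S by blast
  have S': "z + s *\<^sub>R w + t *\<^sub>R v \<in> S" if "s \<in> {0..h}" "t \<in> {0..h}" for s t
    using S[OF that(2,1)] by (simp add: algebra_simps)
  obtain s' t' where st': "s' \<in> {0..h}" "t' \<in> {0..h}" "f (z + h *\<^sub>R w + h *\<^sub>R v) - f (z + h *\<^sub>R w) - f (z + h *\<^sub>R v) + f z
           = h * h * ddir (ddir f w) v (z + s' *\<^sub>R w + t' *\<^sub>R v)"
    using second_difference_mean_value[OF f h, of z w v] S' by blast
  let ?p = "z + s *\<^sub>R v + t *\<^sub>R w" and ?q = "z + t' *\<^sub>R v + s' *\<^sub>R w"
  have "h * h * ddir (ddir f v) w ?p = h * h * ddir (ddir f w) v ?q"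
    using st(3) st'(3) by (simp add: algebra_simps)
  then have eq: "ddir (ddir f v) w ?p = ddir (ddir f w) v ?q" using h by simp
  have "dist (ddir (ddir f v) w ?p) (ddir (ddir f v) w z) < e"
    using d2(2) S[OF st(1,2)] by (auto simp: d_def)
  moreover have "dist (ddir (ddir f w) v ?q) (ddir (ddir f w) v z) < e"
    using d3(2) S[OF st'(2,1)] by (auto simp: d_def)
  ultimately show False using eq by (auto simp: dist_real_def e_def abs_if split: if_splits)
qed

section \<open>Holomorphic maps in several variables\<close>

lemma norm_vector_scalar_mult: "norm (c *s v) = cmod c * norm (v :: complex^'n)"
  by (simp add: norm_vec_def vector_scalar_mult_def norm_mult L2_set_right_distrib)

lemma bounded_linear_vector_scalar_mult_left: "bounded_linear (\<lambda>c. c *s (v :: complex^'n))"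
  by (rule bounded_linear_intro[of _ "norm v"])
    (auto simp: vec_eq_iff algebra_simps norm_vector_scalar_mult)

lemma bounded_linear_vector_scalar_mult_right: "bounded_linear (\<lambda>v. c *s (v :: complex^'n))"
  by (rule bounded_linear_intro[of _ "cmod c"])
    (auto simp: vec_eq_iff algebra_simps norm_vector_scalar_mult)

lemma continuous_on_vector_scalar_mult [continuous_intros]:
  fixes f :: "'a::topological_space \<Rightarrow> complex" and v :: "complex^'n"
  shows "continuous_on S f \<Longrightarrow> continuous_on S (\<lambda>x. f x *s v)"
  using bounded_linear.continuous_on[OF bounded_linear_vector_scalar_mult_left] .

definition holomorphic_fun_on :: "(complex^'n::finite \<Rightarrow> complex) \<Rightarrow> (complex^'n) set \<Rightarrow> bool" where
  "holomorphic_fun_on f S \<longleftrightarrow> open S \<and>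
     (\<forall>x\<in>S. \<exists>D. (f has_derivative D) (at x) \<and> (\<forall>c v. D (c *s v) = c * D v))"

lemma holomorphic_fun_on_has_derivative:
  assumes "holomorphic_fun_on f S" "x \<in> S"
  shows "(f has_derivative frechet_derivative f (at x)) (at x)" "ddir f (c *s v) x = c * ddir f v x"
proof -
  obtain D where D: "(f has_derivative D) (at x)" "\<And>c v. D (c *s v) = c * D v"
    using assms unfolding holomorphic_fun_on_def by blast
  then have "frechet_derivative f (at x) = D" by (metis frechet_derivative_at)
  with D show "(f has_derivative frechet_derivative f (at x)) (at x)" "ddir f (c *s v) x = c * ddir f v x"
    by auto
qed

lemma holomorphic_fun_on_continuous: "holomorphic_fun_on f S \<Longrightarrow> continuous_on S f"
  by (intro continuous_at_imp_continuous_on ballI has_derivative_continuous[OF holomorphic_fun_on_has_derivative(1)])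

lemma holomorphic_fun_on_slice:
  assumes f: "holomorphic_fun_on f S" and S: "z + \<zeta> *s v \<in> S"
  shows "((\<lambda>\<zeta>. f (z + \<zeta> *s v)) has_field_derivative ddir f v (z + \<zeta> *s v)) (at \<zeta>)"
proof -
  have 1: "((\<lambda>\<zeta>. z + \<zeta> *s v) has_derivative (\<lambda>h. h *s v)) (at \<zeta>)"
    using has_derivative_add[OF has_derivative_const[of z]
        bounded_linear_imp_has_derivative[OF bounded_linear_vector_scalar_mult_left]] by simp
  show ?thesis
    using diff_chain_at[OF 1 holomorphic_fun_on_has_derivative(1)[OF f S]]
      holomorphic_fun_on_has_derivative(2)[OF f S]
    by (simp add: has_field_derivative_def o_def mult.commute[of _ "frechet_derivative _ _ _"])
qed

text \<open>Cauchy's formula for the derivative at 0 of the slice in direction \<open>v\<close>. On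
  the circle u = r exp(2 pi i t) the form du / (2 pi i u^2) becomes dt / u. No derivative of
  \<open>f\<close> occurs on the right, so the integral can be studied as a function of
  \<open>z\<close>.\<close>

lemma Cauchy_ddir:
  assumes f: "holomorphic_fun_on f S" and r: "r > 0" and S: "\<And>\<zeta>. \<zeta> \<in> cball 0 r \<Longrightarrow> z + \<zeta> *s v \<in> S"
  shows "ddir f v z = integral {0..1}
           (\<lambda>t. f (z + (of_real r * exp (2 * of_real pi * \<i> * of_real t)) *s v)
                  / (of_real r * exp (2 * of_real pi * \<i> * of_real t)))"
proof -
  let ?g = "\<lambda>\<zeta>. f (z + \<zeta> *s v)"
  have der: "(?g has_field_derivative ddir f v (z + \<zeta> *s v)) (at \<zeta>)" if "\<zeta> \<in> cball 0 r" for \<zeta>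
    using holomorphic_fun_on_slice[OF f S[OF that]] .
  have c: "continuous_on (cball 0 r) ?g"
    by (intro continuous_at_imp_continuous_on ballI DERIV_isCont[OF der])
  have h: "?g holomorphic_on ball 0 r"
    unfolding holomorphic_on_open[OF open_ball]
    by (intro ballI exI, rule der) simp
  have d0: "(?g has_field_derivative (1 / (2 * of_real pi * \<i>) * contour_integral (circlepath 0 r) (\<lambda>u. ?g u / (u-0)^2))) (at 0)"
    by (rule Cauchy_derivative_integral_circlepath[OF c h]) (use r in auto)
  have "ddir f v z = 1 / (2 * of_real pi * \<i>) * contour_integral (circlepath 0 r) (\<lambda>u. ?g u / (u-0)^2)"
    using DERIV_unique[OF der[of 0] d0] r by simp
  also have "\<dots> = integral {0..1} (\<lambda>t. 1 / (2 * of_real pi * \<i>) * (?g (circlepath 0 r t) / (circlepath 0 r t - 0)^2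
      * vector_derivative (circlepath 0 r) (at t)))"
    unfolding contour_integral_integral integral_mult_right ..
  also have "(\<lambda>t. 1 / (2 * of_real pi * \<i>) * (?g (circlepath 0 r t) / (circlepath 0 r t - 0)^2
      * vector_derivative (circlepath 0 r) (at t))) = 
      (\<lambda>t. f (z + (of_real r * exp (2 * of_real pi * \<i> * of_real t)) *s v)
                  / (of_real r * exp (2 * of_real pi * \<i> * of_real t)))"
    using r unfolding vector_derivative_circlepath unfolding circlepath by (auto simp: field_simps power2_eq_square)
  finally show ?thesis .
qed

text \<open>Only complex differentiability of \<open>f\<close> is given, not continuity of its
  derivative, so the integral formula is used twice: continuity of \<open>f\<close> under the
  integral makes every \<open>ddir f v\<close> continuous, and this continuity justifies
  differentiating under the integral.\<close>

lemma holomorphic_fun_on_ddir: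
  fixes f :: "complex^'n::finite \<Rightarrow> complex"
  assumes f: "holomorphic_fun_on f S"
  shows "holomorphic_fun_on (ddir f v) S"
proof -
  have oS: "open S" using f by (simp add: holomorphic_fun_on_def)
  have contf: "continuous_on S f"
    by (rule holomorphic_fun_on_continuous[OF f])
  have loc: "\<exists>e>0. \<exists>r>0. ball x0 e \<subseteq> S \<and> (\<forall>z\<in>ball x0 e. \<forall>\<zeta>\<in>cball 0 r. z + \<zeta> *s v \<in> S)"
    if x0: "x0 \<in> S" for x0 v
  proof -
    obtain e where e: "e > 0" "ball x0 e \<subseteq> S" using openE[OF oS x0] by metis
    \<comment> \<open>On the closed disc of this radius the displacement has norm at most e / 2; the
      summand 1 covers \<open>v = 0\<close>.\<close>
    define r where "r = e / (2 * (norm v + 1))"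
    have N: "norm v + 1 > 0" by (simp add: add_nonneg_pos)
    have r: "r > 0" using e N by (simp add: r_def)
    have "z + \<zeta> *s v \<in> S" if z: "z \<in> ball x0 (e/2)" and zeta: "\<zeta> \<in> cball 0 r" for z \<zeta>
    proof -
      have "norm (\<zeta> *s v) \<le> r * (norm v + 1)"
        using zeta r by (auto simp: norm_vector_scalar_mult intro!: mult_mono)
      also have "\<dots> = e / 2" using N by (simp add: r_def divide_simps)
      finally have "dist (z + \<zeta> *s v) z \<le> e / 2" by (simp add: dist_norm)
      then have "z + \<zeta> *s v \<in> ball x0 e"
        using z dist_triangle[of x0 "z + \<zeta> *s v" z] by (simp add: dist_commute)
      then show ?thesis using e by blast
    qed
    moreover have "ball x0 (e/2) \<subseteq> S" using e subset_ball[of "e/2" e x0] by auto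
    ultimately show ?thesis using e r by (intro exI[of _ "e/2"] conjI exI[of _ r]) auto
  qed
  define u where "u = (\<lambda>(r::real) (t::real). of_real r * exp (2 * of_real pi * \<i> * of_real t) :: complex)"
  have u0: "u r t \<noteq> 0" "u r t \<in> cball 0 r" if "r > 0" for r t
    using that by (auto simp: u_def norm_mult)
  have contu: "continuous_on T (\<lambda>(x::complex^'n, t). u r t)" for r T
    unfolding u_def case_prod_unfold by (intro continuous_intros)
  have contg: "continuous_on (U \<times> {0..1}) (\<lambda>(x, t). g (x + u r t *s v) / u r t)"
    if g: "continuous_on S g" and r: "r > 0" and U: "\<forall>z\<in>U. \<forall>\<zeta>\<in>cball 0 r. z + \<zeta> *s v \<in> S"
    for g :: "complex^'n \<Rightarrow> complex" and U r v
    unfolding case_prod_unfold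
    using u0[OF r] U contu[of _ r, unfolded case_prod_unfold]
    by (intro continuous_on_divide continuous_on_compose2[OF g] continuous_on_add continuous_on_fst
        continuous_on_id continuous_on_vector_scalar_mult) auto
  have cont1: "continuous_on {0..1} (\<lambda>t. g (x + u r t *s v) / u r t)"
    if "continuous_on S g" "r > 0" "\<forall>\<zeta>\<in>cball 0 r. x + \<zeta> *s v \<in> S"
    for g :: "complex^'n \<Rightarrow> complex" and x r v
  proof -
    have "continuous_on ({x} \<times> {0..1}) (\<lambda>(x, t). g (x + u r t *s v) / u r t)"
      using contg[OF that(1,2), of "{x}" v] that(3) by auto
    moreover have "continuous_on {0..1} (\<lambda>t::real. (x, t))" by (intro continuous_intros)
    ultimately have "continuous_on {0..1} (\<lambda>t. case (x, t) of (x, t) \<Rightarrow> g (x + u r t *s v) / u r t)"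
      by (rule continuous_on_compose2) auto
    then show ?thesis by simp
  qed
  have formula: "ddir f v z = integral {0..1} (\<lambda>t. f (z + u r t *s v) / u r t)"
    if "r > 0" "\<forall>\<zeta>\<in>cball 0 r. z + \<zeta> *s v \<in> S" for z r v
    unfolding u_def using Cauchy_ddir[OF f that(1), of z v] that(2) by blast
  have contd: "continuous_on S (ddir f v)" for v
  proof (rule continuous_at_imp_continuous_on, rule ballI)
    fix x0 assume "x0 \<in> S"
    then obtain e r where er: "e > 0" "r > 0" "ball x0 e \<subseteq> S"
      "\<forall>z\<in>ball x0 e. \<forall>\<zeta>\<in>cball 0 r. z + \<zeta> *s v \<in> S" using loc by blast
    have "continuous_on (ball x0 e) (\<lambda>x. integral (cbox 0 1) (\<lambda>t. f (x + u r t *s v) / u r t))"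
      by (rule integral_continuous_on_param) (use contg[OF contf er(2,4)] in simp)
    then have "continuous_on (ball x0 e) (ddir f v)"
      by (rule continuous_on_eq) (use formula[OF er(2)] er(4) in simp)
    then show "isCont (ddir f v) x0"
      using er(1) by (simp add: continuous_on_eq_continuous_at)
  qed
  show ?thesis unfolding holomorphic_fun_on_def
  proof (intro conjI ballI oS)
    fix x0 assume "x0 \<in> S"
    then obtain e r where er: "e > 0" "r > 0" "ball x0 e \<subseteq> S"
      "\<forall>z\<in>ball x0 e. \<forall>\<zeta>\<in>cball 0 r. z + \<zeta> *s v \<in> S" using loc by blast
    \<comment> \<open>The derivative of the integrand in \<open>x\<close>, packaged as a bounded
      operator. The Leibniz rule needs its joint continuity, which comes from
      \<open>contd\<close>.\<close>
    define fx where "fx = (\<lambda>x t. Blinfun (\<lambda>w. ddir f w (x + u r t *s v) / u r t))"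
    have S: "x + u r t *s v \<in> S" if "x \<in> ball x0 e" for x t using er(4) that u0[OF er(2)] by blast
    have bl: "bounded_linear (\<lambda>w. ddir f w (x + u r t *s v) / u r t)" if "x \<in> ball x0 e" for x t
      using bounded_linear_compose[OF bounded_linear_divide
          has_derivative_bounded_linear[OF holomorphic_fun_on_has_derivative(1)[OF f S[OF that]]]] .
    have fx: "blinfun_apply (fx x t) w = ddir f w (x + u r t *s v) / u r t" if "x \<in> ball x0 e" for x t w
      unfolding fx_def by (simp add: bounded_linear_Blinfun_apply[OF bl[OF that]])
    have der: "((\<lambda>x. integral (cbox 0 1) (\<lambda>t. f (x + u r t *s v) / u r t)) has_derivative
        blinfun_apply (integral (cbox 0 1) (fx x0))) (at x0 within ball x0 e)"
    proof (rule leibniz_rule)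
      fix x t assume x: "x \<in> ball x0 e"
      have "((\<lambda>x. x + u r t *s v) has_derivative (\<lambda>h. h)) (at x)" by (auto intro!: derivative_eq_intros)
      from diff_chain_at[OF this holomorphic_fun_on_has_derivative(1)[OF f S[OF x]]]
      have "((\<lambda>x. f (x + u r t *s v)) has_derivative (\<lambda>w. ddir f w (x + u r t *s v))) (at x)"
        by (simp add: o_def)
      from bounded_linear.has_derivative[OF bounded_linear_divide this]
      have "((\<lambda>x. f (x + u r t *s v) / u r t) has_derivative blinfun_apply (fx x t)) (at x)"
        unfolding fx[OF x, abs_def] .
      then show "((\<lambda>x. f (x + u r t *s v) / u r t) has_derivative blinfun_apply (fx x t)) (at x within ball x0 e)"
        by (rule has_derivative_at_withinI)
    next
      fix x assume x: "x \<in> ball x0 e"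
      then have "continuous_on {0..1} (\<lambda>t. f (x + u r t *s v) / u r t)"
        using cont1[OF contf er(2)] er(4) by blast
      then show "(\<lambda>t. f (x + u r t *s v) / u r t) integrable_on cbox 0 1"
        by (simp add: integrable_continuous_real)
    next
      have "continuous_on (ball x0 e \<times> {0..1}) (\<lambda>p. fx (fst p) (snd p))"
      proof (rule continuous_on_blinfun_componentwise)
        fix w :: "complex^'n"
        have "continuous_on (ball x0 e \<times> {0..1}) (\<lambda>p. ddir f w (fst p + u r (snd p) *s v) / u r (snd p))"
          using contg[OF contd er(2,4)] by (simp add: case_prod_unfold)
        then show "continuous_on (ball x0 e \<times> {0..1}) (\<lambda>p. blinfun_apply (fx (fst p) (snd p)) w)"
          by (rule continuous_on_eq) (auto simp: fx)
      qed
      then show "continuous_on (ball x0 e \<times> cbox 0 1) (\<lambda>(x, t). fx x t)"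
        by (simp add: case_prod_unfold)
    qed (use er in auto)
    have "integral (cbox 0 1) (\<lambda>t. f (x + u r t *s v) / u r t) = ddir f v x" if "x \<in> ball x0 e" for x
      using formula[OF er(2)] er(4) that by simp
    from has_derivative_transform_within_open[OF der[unfolded at_within_open[OF centre_in_ball[THEN iffD2, OF er(1)] open_ball]]
         open_ball centre_in_ball[THEN iffD2, OF er(1)] this]
    have d: "(ddir f v has_derivative blinfun_apply (integral (cbox 0 1) (fx x0))) (at x0)" .
    have x0: "x0 \<in> ball x0 e" using er by simp
    have int: "fx x0 integrable_on cbox 0 1"
    proof -
      have "continuous_on {0..1} (fx x0)"
      proof (rule continuous_on_blinfun_componentwise)
        fix w :: "complex^'n"
        show "continuous_on {0..1} (\<lambda>t. blinfun_apply (fx x0 t) w)"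
          unfolding fx[OF x0] using cont1[OF contd er(2)] er(4) x0 by blast
      qed
      then show ?thesis by (simp add: integrable_continuous_real)
    qed
    have "blinfun_apply (integral (cbox 0 1) (fx x0)) (c *s w) = c * blinfun_apply (integral (cbox 0 1) (fx x0)) w" for c w
      unfolding blinfun_apply_integral[OF int] fx[OF x0]
        holomorphic_fun_on_has_derivative(2)[OF f S[OF x0]] times_divide_eq_right[symmetric]
      by (rule integral_mult_right)
    with d show "\<exists>D. (ddir f v has_derivative D) (at x0) \<and> (\<forall>c w. D (c *s w) = c * D w)" by blast
  qed
qed

lemma holomorphic_fun_on_imp_smooth_on:
  assumes "holomorphic_fun_on f S" shows "smooth_on f S"
proof -
  have "Ck_on k f S" for k
    using assms
  proof (induction k arbitrary: f)
    case 0
    then have "continuous_on S f" by (rule holomorphic_fun_on_continuous)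
    then show ?case by simp
  next
    case (Suc k)
    have "f differentiable at x" if "x \<in> S" for x
      using holomorphic_fun_on_has_derivative(1)[OF Suc.prems that] by (auto simp: differentiable_def)
    with Suc.IH[OF holomorphic_fun_on_ddir[OF Suc.prems]] show ?case by simp
  qed
  with assms show ?thesis by (simp add: smooth_on_def holomorphic_fun_on_def)
qed

section \<open>Holomorphic maps and their components\<close>

lemma holomorphic_map_on_open: "holomorphic_map_on f S \<Longrightarrow> open S"
  by (simp add: holomorphic_map_on_def)

lemma holomorphic_map_on_has_derivative:
  assumes "holomorphic_map_on f S" "x \<in> S"
  shows "(f has_derivative frechet_derivative f (at x)) (at x)" "ddir f (c *s v) x = c *s ddir f v x"
proof -
  obtain D where D: "(f has_derivative D) (at x)" "\<And>c v. D (c *s v) = c *s D v"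
    using assms unfolding holomorphic_map_on_def by blast
  then have "frechet_derivative f (at x) = D" by (metis frechet_derivative_at)
  with D show "(f has_derivative frechet_derivative f (at x)) (at x)" "ddir f (c *s v) x = c *s ddir f v x"
    by auto
qed

lemma holomorphic_map_on_continuous: "holomorphic_map_on f S \<Longrightarrow> continuous_on S f"
  by (intro continuous_at_imp_continuous_on ballI has_derivative_continuous[OF holomorphic_map_on_has_derivative(1)])

lemma holomorphic_map_on_subset: "holomorphic_map_on f T \<Longrightarrow> S \<subseteq> T \<Longrightarrow> open S \<Longrightarrow> holomorphic_map_on f S"
  unfolding holomorphic_map_on_def by blast

lemma holomorphic_map_on_cong:
  assumes "holomorphic_map_on f S" "\<And>x. x \<in> S \<Longrightarrow> f x = g x"
  shows "holomorphic_map_on g S"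
  unfolding holomorphic_map_on_def
proof (intro conjI ballI)
  show S: "open S" using assms(1) holomorphic_map_on_open by auto
  fix x assume x: "x \<in> S"
  have "(g has_derivative frechet_derivative f (at x)) (at x)"
    by (rule has_derivative_transform_within_open[OF holomorphic_map_on_has_derivative(1)[OF assms(1) x] S x])
       (rule assms(2))
  then show "\<exists>D. (g has_derivative D) (at x) \<and> (\<forall>c v. D (c *s v) = c *s D v)"
    using holomorphic_map_on_has_derivative(2)[OF assms(1) x] by blast
qed

lemma holomorphic_map_on_compose:
  assumes f: "holomorphic_map_on f S" and g: "holomorphic_map_on g T" and "f ` S \<subseteq> T"
  shows "holomorphic_map_on (\<lambda>x. g (f x)) S"
  unfolding holomorphic_map_on_def
proof (intro conjI ballI)
  show "open S" using f by (rule holomorphic_map_on_open)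
  fix x assume x: "x \<in> S"
  then have fx: "f x \<in> T" using assms(3) by auto
  have "((\<lambda>x. g (f x)) has_derivative (\<lambda>v. ddir g (ddir f v x) (f x))) (at x)"
    using diff_chain_at[OF holomorphic_map_on_has_derivative(1)[OF f x]
        holomorphic_map_on_has_derivative(1)[OF g fx]] by (simp add: o_def)
  then show "\<exists>D. ((\<lambda>x. g (f x)) has_derivative D) (at x) \<and> (\<forall>c v. D (c *s v) = c *s D v)"
    by (intro exI[of _ "\<lambda>v. ddir g (ddir f v x) (f x)"])
      (simp add: holomorphic_map_on_has_derivative(2)[OF f x] holomorphic_map_on_has_derivative(2)[OF g fx])
qed

lemma holomorphic_map_on_nth:
  assumes "holomorphic_map_on f S"
  shows "holomorphic_fun_on (\<lambda>x. f x $ i) S" "x \<in> S \<Longrightarrow> ddir (\<lambda>x. f x $ i) v x = ddir f v x $ i"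
proof -
  have der: "((\<lambda>x. f x $ i) has_derivative (\<lambda>v. ddir f v x $ i)) (at x)" if "x \<in> S" for x
    by (rule bounded_linear.has_derivative[OF bounded_linear_vec_nth
          holomorphic_map_on_has_derivative(1)[OF assms that]])
  then show "x \<in> S \<Longrightarrow> ddir (\<lambda>x. f x $ i) v x = ddir f v x $ i" by (rule ddir_eq)
  show "holomorphic_fun_on (\<lambda>x. f x $ i) S"
    unfolding holomorphic_fun_on_def
  proof (intro conjI ballI)
    show "open S" using assms by (rule holomorphic_map_on_open)
    fix x assume x: "x \<in> S"
    show "\<exists>D. ((\<lambda>x. f x $ i) has_derivative D) (at x) \<and> (\<forall>c v. D (c *s v) = c * D v)"
      using der[OF x] by (intro exI[of _ "\<lambda>v. ddir f v x $ i"])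
        (simp add: holomorphic_map_on_has_derivative(2)[OF assms x])
  qed
qed

lemma bounded_linear_axis: "bounded_linear (axis i :: 'a::real_normed_vector \<Rightarrow> 'a^'n)"
  by (rule bounded_linear_intro[of _ 1])
    (auto simp: vec_eq_iff axis_def norm_vec_def L2_set_def if_distrib[of "\<lambda>u. (norm u)\<^sup>2"] cong: if_cong)

lemma vec_eq_sum_axis: "(x :: 'a::real_normed_vector^'n) = (\<Sum>i\<in>UNIV. axis i (x $ i))"
  unfolding vec_eq_iff sum_component axis_def vec_lambda_beta by simp

lemma holomorphic_map_on_iff_nth:
  "holomorphic_map_on f S \<longleftrightarrow> (\<forall>i. holomorphic_fun_on (\<lambda>x. f x $ i) S)"
proof
  assume h: "\<forall>i. holomorphic_fun_on (\<lambda>x. f x $ i) S"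
  show "holomorphic_map_on f S"
    unfolding holomorphic_map_on_def
  proof (intro conjI ballI)
    show "open S" using h by (simp add: holomorphic_fun_on_def)
    fix x assume x: "x \<in> S"
    let ?D = "\<lambda>v. \<Sum>i\<in>UNIV. axis i (ddir (\<lambda>x. f x $ i) v x)"
    have "((\<lambda>x. f x $ i) has_derivative (\<lambda>v. ddir (\<lambda>x. f x $ i) v x)) (at x)" for i
      using holomorphic_fun_on_has_derivative(1)[OF spec[OF h] x] .
    from bounded_linear.has_derivative[OF bounded_linear_axis this]
    have "((\<lambda>x. \<Sum>i\<in>UNIV. axis i (f x $ i)) has_derivative ?D) (at x)"
      by (rule has_derivative_sum)
    moreover have "?D (c *s v) = c *s ?D v" for c v
    proof -
      have "?D (c *s v) = (\<Sum>i\<in>UNIV. axis i (c * ddir (\<lambda>x. f x $ i) v x))"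
        by (rule sum.cong[OF refl]) (simp only: holomorphic_fun_on_has_derivative(2)[OF spec[OF h] x])
      also have "\<dots> = c *s ?D v"
        by (simp add: vec_eq_iff axis_def if_distrib[of "\<lambda>u. c * u"] cong: if_cong)
      finally show ?thesis .
    qed
    ultimately show "\<exists>D. (f has_derivative D) (at x) \<and> (\<forall>c v. D (c *s v) = c *s D v)"
      unfolding vec_eq_sum_axis[symmetric] by blast
  qed
qed (simp add: holomorphic_map_on_nth)

lemma holomorphic_map_on_ddir:
  assumes "holomorphic_map_on f S" shows "holomorphic_map_on (ddir f v) S"
  unfolding holomorphic_map_on_iff_nth
proof
  fix i
  have "holomorphic_fun_on (ddir (\<lambda>x. f x $ i) v) S"
    by (rule holomorphic_fun_on_ddir[OF holomorphic_map_on_nth(1)[OF assms]])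
  \<comment> \<open>A scalar function is viewed as a map into \<open>complex^1\<close>, so that the
    congruence rule for holomorphic maps can exchange the derivative of a component for the
    component of the derivative.\<close>
  then have "holomorphic_map_on (\<lambda>x. vec (ddir (\<lambda>x. f x $ i) v x) :: complex^1) S"
    by (simp add: holomorphic_map_on_iff_nth)
  then have "holomorphic_map_on (\<lambda>x. vec (ddir f v x $ i) :: complex^1) S"
    by (rule holomorphic_map_on_cong) (simp add: holomorphic_map_on_nth(2)[OF assms])
  from holomorphic_map_on_nth(1)[OF this, of 1]
  show "holomorphic_fun_on (\<lambda>x. ddir f v x $ i) S" by simp
qed

lemma holomorphic_map_on_imp_smooth_on:
  assumes "holomorphic_map_on f S" shows "smooth_on f S"
proof -
  have "smooth_on (\<lambda>x. \<Sum>i\<in>UNIV. axis i (f x $ i)) S"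
    by (rule smooth_on_sum[OF holomorphic_map_on_open[OF assms]
          smooth_on_bounded_linear[OF holomorphic_fun_on_imp_smooth_on[OF holomorphic_map_on_nth(1)[OF assms]]
            bounded_linear_axis]])
  then show ?thesis by (simp only: vec_eq_sum_axis[symmetric])
qed

section \<open>The complex Hessian\<close>

lemma Jc_Jc [simp]: "Jc (Jc v) = - v"
  by (simp add: Jc_def vec_eq_iff)

lemma linear_Jc: "linear Jc"
  by (rule linearI) (auto simp: Jc_def vec_eq_iff algebra_simps)

lemma norm_Jc [simp]: "norm (Jc v) = norm v"
  by (simp add: Jc_def norm_vector_scalar_mult)

text \<open>A constant multiple of the real part of the complex Hessian, written with real
  derivatives. On the diagonal it is the Laplacian of \<open>F\<close> along the complex line
  through \<open>z\<close> in direction \<open>v\<close>, so nonnegativity there means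
  plurisubharmonicity.\<close>

definition levi :: "(complex^'n::finite \<Rightarrow> real) \<Rightarrow> complex^'n \<Rightarrow> complex^'n \<Rightarrow> complex^'n \<Rightarrow> real" where
  "levi F z v w = ddir (ddir F v) w z + ddir (ddir F (Jc v)) (Jc w) z"

lemma linear_eq_sum_Basis:
  assumes "linear (D :: 'a::euclidean_space \<Rightarrow> real)"
  shows "D u = (\<Sum>b\<in>Basis. (u \<bullet> b) * D b)"
proof -
  have "D u = D (\<Sum>b\<in>Basis. (u \<bullet> b) *\<^sub>R b)" by (simp add: euclidean_representation)
  also have "\<dots> = (\<Sum>b\<in>Basis. (u \<bullet> b) * D b)"
    using assms by (simp add: linear_sum linear_scale del: euclidean_representation)
  finally show ?thesis .
qed

lemma ddir_cong_open:
  assumes "open S" "x \<in> S" "\<And>y. y \<in> S \<Longrightarrow> f y = g y"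
  shows "ddir f v x = ddir g v x"
proof -
  have "frechet_derivative f (at x) = frechet_derivative g (at x)"
    by (rule frechet_derivative_cong_open[OF assms(1,2)]) (rule assms(3))
  then show ?thesis by simp
qed

lemma ddir_ddir_cong_open:
  assumes "open S" "x \<in> S" "\<And>y. y \<in> S \<Longrightarrow> f y = g y"
  shows "ddir (ddir f v) w x = ddir (ddir g v) w x"
proof (rule ddir_cong_open[OF assms(1,2)])
  fix y assume "y \<in> S"
  then show "ddir f v y = ddir g v y" by (rule ddir_cong_open[OF assms(1)]) (rule assms(3))
qed

lemma levi_cong_open:
  assumes "open S" "x \<in> S" "\<And>y. y \<in> S \<Longrightarrow> f y = g y"
  shows "levi f x v w = levi g x v w"
proof -
  have "ddir (ddir f v) w x = ddir (ddir g v) w x" for v w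
    by (rule ddir_ddir_cong_open[OF assms(1,2)]) (rule assms(3))
  then show ?thesis by (simp only: levi_def)
qed

lemma ddir_compose:
  assumes f: "smooth_on f S" and F: "smooth_on F T" and fS: "f ` S \<subseteq> T" and z: "z \<in> S"
  shows "ddir (\<lambda>x. F (f x)) v z = ddir F (ddir f v z) (f z)"
proof (rule ddir_eq)
  have "f z \<in> T" using z fS by auto
  from diff_chain_at[OF smooth_on_has_derivative[OF f z] smooth_on_has_derivative[OF F this]]
  show "((\<lambda>x. F (f x)) has_derivative (\<lambda>v. ddir F (ddir f v z) (f z))) (at z)" by (simp add: o_def)
qed

lemma ddir_ddir_compose:
  fixes F :: "'b::euclidean_space \<Rightarrow> real" and f :: "'a::euclidean_space \<Rightarrow> 'b"
  assumes f: "smooth_on f S" and F: "smooth_on F T" and fS: "f ` S \<subseteq> T" and z: "z \<in> S"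
  shows "ddir (ddir (\<lambda>x. F (f x)) v) w z =
     ddir (ddir F (ddir f v z)) (ddir f w z) (f z) + ddir F (ddir (ddir f v) w z) (f z)"
proof -
  have fz: "f z \<in> T" using z fS by auto
  have "ddir (\<lambda>x. F (f x)) v y = (\<Sum>b\<in>Basis. (ddir f v y \<bullet> b) * ddir F b (f y))" if y: "y \<in> S" for y
    unfolding ddir_compose[OF f F fS y]
    by (rule linear_eq_sum_Basis) (use smooth_on_linear[OF F] fS y in auto)
  then have "ddir (ddir (\<lambda>x. F (f x)) v) w z = ddir (\<lambda>y. \<Sum>b\<in>Basis. (ddir f v y \<bullet> b) * ddir F b (f y)) w z"
    by (rule ddir_cong_open[OF smooth_on_open[OF f] z])
  also have "\<dots> = (\<Sum>b\<in>Basis. (ddir f v z \<bullet> b) * ddir (ddir F b) (ddir f w z) (f z)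
       + (ddir (ddir f v) w z \<bullet> b) * ddir F b (f z))"
  proof (rule ddir_eq, intro has_derivative_sum has_derivative_mult)
    fix b :: 'b
    show "((\<lambda>y. ddir f v y \<bullet> b) has_derivative (\<lambda>w. ddir (ddir f v) w z \<bullet> b)) (at z)"
      by (rule bounded_linear.has_derivative[OF bounded_linear_inner_left
            smooth_on_has_derivative[OF smooth_on_ddir[OF f] z]])
    show "((\<lambda>y. ddir F b (f y)) has_derivative (\<lambda>w. ddir (ddir F b) (ddir f w z) (f z))) (at z)"
      using diff_chain_at[OF smooth_on_has_derivative[OF f z]
          smooth_on_has_derivative[OF smooth_on_ddir[OF F] fz]] by (simp add: o_def)
  qed
  also have "\<dots> = (\<Sum>b\<in>Basis. (ddir f v z \<bullet> b) * ddir (ddir F (ddir f w z)) b (f z))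
       + (\<Sum>b\<in>Basis. (ddir (ddir f v) w z \<bullet> b) * ddir F b (f z))"
    unfolding sum.distrib ddir_commute[OF F fz, of _ "ddir f w z"] ..
  also have "\<dots> = ddir (ddir F (ddir f w z)) (ddir f v z) (f z) + ddir F (ddir (ddir f v) w z) (f z)"
    by (simp only: linear_eq_sum_Basis[OF smooth_on_linear[OF smooth_on_ddir[OF F] fz], symmetric]
      linear_eq_sum_Basis[OF smooth_on_linear[OF F fz], symmetric])
  finally show ?thesis unfolding ddir_commute[OF F fz, of "ddir f w z" "ddir f v z"] .
qed

text \<open>The second derivative of a holomorphic map is complex bilinear, hence its contribution cancels.\<close>

lemma levi_compose:
  assumes f: "holomorphic_map_on f S" and F: "smooth_on F T" and fS: "f ` S \<subseteq> T" and z: "z \<in> S"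
  shows "levi (\<lambda>x. F (f x)) z v w = levi F (f z) (ddir f v z) (ddir f w z)"
proof -
  have fz: "f z \<in> T" using z fS by auto
  note sf = holomorphic_map_on_imp_smooth_on[OF f]
  have J1: "ddir f (Jc v) z = Jc (ddir f v z)" for v
    unfolding Jc_def by (rule holomorphic_map_on_has_derivative(2)[OF f z])
  have "ddir (ddir f (Jc v)) (Jc w) z = \<i> *s ddir (ddir f (Jc v)) w z"
    unfolding Jc_def by (rule holomorphic_map_on_has_derivative(2)[OF holomorphic_map_on_ddir[OF f] z])
  also have "ddir (ddir f (Jc v)) w z = ddir (\<lambda>x. \<i> *s ddir f v x) w z"
    unfolding Jc_def by (rule ddir_cong_open[OF holomorphic_map_on_open[OF f] z])
      (rule holomorphic_map_on_has_derivative(2)[OF f])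
  also have "\<dots> = \<i> *s ddir (ddir f v) w z"
    by (rule ddir_eq, rule bounded_linear.has_derivative[OF bounded_linear_vector_scalar_mult_right])
       (rule smooth_on_has_derivative[OF smooth_on_ddir[OF sf] z])
  finally have J2: "ddir (ddir f (Jc v)) (Jc w) z = - ddir (ddir f v) w z" by (simp add: vec_eq_iff)
  show ?thesis
    unfolding levi_def ddir_ddir_compose[OF sf F fS z] J1 J2
    using linear_neg[OF smooth_on_linear[OF F fz]] by simp
qed

lemma levi_sym:
  assumes F: "smooth_on F S" "z \<in> S" shows "levi F z v w = levi F z w v"
  unfolding levi_def using ddir_commute[OF F, of v w] ddir_commute[OF F, of "Jc v" "Jc w"] by simp

lemma linear_levi: 
  assumes F: "smooth_on F S" "z \<in> S" shows "linear (levi F z v)"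
proof -
  have 1: "linear (\<lambda>w. ddir (ddir F u) w z)" for u
    by (rule smooth_on_linear[OF smooth_on_ddir[OF F(1)] F(2)])
  have "linear (\<lambda>w. ddir (ddir F v) w z + ddir (ddir F (Jc v)) (Jc w) z)"
    using linear_compose_add[OF 1[of v] linear_compose[OF linear_Jc 1[of "Jc v"]]] by (simp only: o_def)
  then show ?thesis unfolding levi_def[abs_def] .
qed

lemma bilinear_levi:
  assumes F: "smooth_on F S" "z \<in> S" shows "bilinear (levi F z)"
proof -
  have "(\<lambda>v. levi F z v w) = levi F z w" for w
    by (rule ext) (rule levi_sym[OF F])
  then show ?thesis unfolding bilinear_def using linear_levi[OF F] by simp
qed

lemma ddir_ddir_minus_left:
  fixes F :: "'a::euclidean_space \<Rightarrow> real"
  assumes F: "smooth_on F S" "z \<in> S"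
  shows "ddir (ddir F (- v)) w z = - ddir (ddir F v) w z"
  unfolding ddir_commute[OF F, of _ w]
  by (rule linear_neg[OF smooth_on_linear[OF smooth_on_ddir[OF F(1)] F(2)]])

lemma levi_Jc:
  assumes F: "smooth_on F S" "z \<in> S"
  shows "levi F z (Jc v) (Jc w) = levi F z v w"
proof -
  have "ddir (ddir F (- v)) (- w) z = ddir (ddir F v) w z"
    using linear_neg[OF smooth_on_linear[OF smooth_on_ddir[OF F(1)] F(2)]]
    by (simp add: ddir_ddir_minus_left[OF F])
  then show ?thesis unfolding levi_def Jc_Jc by simp
qed

text \<open>The right side is dd^c F on the pair \<open>v\<close>, \<open>w\<close>, where d^c F = -
  dF o J. The fundamental form of a metric with potential is thus visibly exact up to the conformal
  factor.\<close>

lemma levi_Jc_left: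
  assumes F: "smooth_on F S" "z \<in> S"
  shows "levi F z (Jc v) w = ddir (ddir F (Jc v)) w z - ddir (ddir F v) (Jc w) z"
  unfolding levi_def Jc_Jc ddir_ddir_minus_left[OF F] by simp

lemma smooth_on_levi: "smooth_on F S \<Longrightarrow> smooth_on (\<lambda>z. levi F z v w) S"
  unfolding levi_def by (rule smooth_on_add[OF smooth_on_ddir[OF smooth_on_ddir] smooth_on_ddir[OF smooth_on_ddir]])

lemma ddir_ddir_sum:
  fixes F :: "'i \<Rightarrow> 'a::euclidean_space \<Rightarrow> real"
  assumes oS: "open S" and F: "\<And>i. i \<in> I \<Longrightarrow> smooth_on (F i) S" and z: "z \<in> S"
  shows "ddir (ddir (\<lambda>x. \<Sum>i\<in>I. c i * F i x) v) w z = (\<Sum>i\<in>I. c i * ddir (ddir (F i) v) w z)"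
proof -
  have 1: "ddir (\<lambda>x. \<Sum>i\<in>I. c i * G i x) v y = (\<Sum>i\<in>I. c i * ddir (G i) v y)"
    if G: "\<And>i. i \<in> I \<Longrightarrow> smooth_on (G i) S" and y: "y \<in> S" for y v and G :: "'i \<Rightarrow> 'a \<Rightarrow> real"
    by (rule ddir_eq) (intro has_derivative_sum has_derivative_mult_right smooth_on_has_derivative[OF G y])
  have "ddir (ddir (\<lambda>x. \<Sum>i\<in>I. c i * F i x) v) w z = ddir (\<lambda>x. \<Sum>i\<in>I. c i * ddir (F i) v x) w z"
    by (rule ddir_cong_open[OF oS z]) (rule 1[OF F])
  also have "\<dots> = (\<Sum>i\<in>I. c i * ddir (ddir (F i) v) w z)"
    by (rule 1[OF _ z]) (rule smooth_on_ddir[OF F])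
  finally show ?thesis .
qed

lemma levi_sum:
  assumes oS: "open S" and F: "\<And>i. i \<in> I \<Longrightarrow> smooth_on (F i) S" and z: "z \<in> S"
  shows "levi (\<lambda>x. \<Sum>i\<in>I. c i * F i x) z v w = (\<Sum>i\<in>I. c i * levi (F i) z v w)"
proof -
  have "ddir (ddir (\<lambda>x. \<Sum>i\<in>I. c i * F i x) v) w z = (\<Sum>i\<in>I. c i * ddir (ddir (F i) v) w z)" for v w
    by (rule ddir_ddir_sum[OF oS _ z]) (rule F)
  then show ?thesis unfolding levi_def by (simp add: sum.distrib distrib_left)
qed

lemma levi_mult:
  assumes F: "smooth_on F S" and z: "z \<in> S"
  shows "levi (\<lambda>x. c * F x) z v w = c * levi F z v w"
  using levi_sum[of S "{()}" "\<lambda>_. F" z "\<lambda>_. c"] F z smooth_on_open[OF F] by simp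

subsection \<open>Locally conformally Kaehler structures with a potential\<close>

lemma ext_deriv1_dlog:
  fixes F :: "complex^'n::finite \<Rightarrow> real"
  assumes F: "smooth_on F S" and z: "z \<in> S" and pos: "\<And>y. y \<in> S \<Longrightarrow> F y \<noteq> 0"
    and th: "\<And>y v. y \<in> S \<Longrightarrow> \<theta> y v = - (ddir F v y / F y)"
  shows "ext_deriv1 \<theta> z u v = 0"
proof -
  have oS: "open S" using smooth_on_open[OF F] .
  have "ddir (\<lambda>y. \<theta> y v) u z = ddir (\<lambda>y. - (ddir F v y / F y)) u z" for u v
    by (rule ddir_cong_open[OF oS z]) (rule th)
  also have "ddir (\<lambda>y. - (ddir F v y / F y)) u z = - ((ddir (ddir F v) u z * F z - ddir F v z * ddir F u z) / (F z * F z))" for u v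
    by (rule ddir_eq, intro has_derivative_minus has_derivative_divide' smooth_on_has_derivative[OF F z]
         smooth_on_has_derivative[OF smooth_on_ddir[OF F] z] pos z)
  finally have "ddir (\<lambda>y. \<theta> y v) u z = - ((ddir (ddir F v) u z * F z - ddir F v z * ddir F u z) / (F z * F z))" for u v .
  then show ?thesis unfolding ext_deriv1_def by (simp add: ddir_commute[OF F z, of v u] mult.commute)
qed

text \<open>Here \<omega> is dd^c F / F. Since dd^c F is closed, d \<omega> is d(1/F) wedged with
  dd^c F, that is, - d log F wedged with \<omega>.\<close>

lemma ext_deriv2_levi:
  fixes F :: "complex^'n::finite \<Rightarrow> real"
  assumes F: "smooth_on F S" and z: "z \<in> S" and pos: "\<And>y. y \<in> S \<Longrightarrow> F y \<noteq> 0"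
    and th: "\<And>v. \<theta> v = - (ddir F v z / F z)"
    and om: "\<And>y v w. y \<in> S \<Longrightarrow> \<omega> y v w = levi F y (Jc v) w / F y"
  shows "ext_deriv2 \<omega> z u v w = wedge12 \<theta> (\<omega> z) u v w"
proof -
  have oS: "open S" using smooth_on_open[OF F] .
  define T where "T = (\<lambda>a b c. ddir (ddir (ddir F a) b) c z)"
  have T1: "T a b c = T a c b" for a b c
    unfolding T_def by (rule ddir_commute[OF smooth_on_ddir[OF F] z])
  have T2: "T a b c = T b a c" for a b c
    unfolding T_def by (rule ddir_cong_open[OF oS z]) (rule ddir_commute[OF F])
  have "ddir (\<lambda>y. \<omega> y v w) u z = ddir (\<lambda>y. (ddir (ddir F (Jc v)) w y - ddir (ddir F v) (Jc w) y) / F y) u z" for u v w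
    by (rule ddir_cong_open[OF oS z]) (simp add: om levi_Jc_left[OF F])
  also have "ddir (\<lambda>y. (ddir (ddir F (Jc v)) w y - ddir (ddir F v) (Jc w) y) / F y) u z =
     ((T (Jc v) w u - T v (Jc w) u) * F z - (ddir (ddir F (Jc v)) w z - ddir (ddir F v) (Jc w) z) * ddir F u z) / (F z * F z)" for u v w
    unfolding T_def
    by (rule ddir_eq, intro has_derivative_diff has_derivative_divide' smooth_on_has_derivative[OF F z]
         smooth_on_has_derivative[OF smooth_on_ddir[OF smooth_on_ddir[OF F]] z] pos z)
  also have "\<dots> u v w = (T (Jc v) w u - T v (Jc w) u) / F z - \<omega> z v w * ddir F u z / F z" for u v w
    using pos[OF z] unfolding om[OF z] levi_Jc_left[OF F z] by (simp add: divide_simps)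
  finally have D: "ddir (\<lambda>y. \<omega> y v w) u z = (T (Jc v) w u - T v (Jc w) u) / F z - \<omega> z v w * ddir F u z / F z" for u v w .
  \<comment> \<open>Closedness of dd^c F: the six third derivatives cancel in pairs by the symmetry
    of \<open>T\<close>.\<close>
  have "T (Jc v) w u - T v (Jc w) u - (T (Jc u) w v - T u (Jc w) v) + (T (Jc u) v w - T u (Jc v) w) = 0"
    using T1[of "Jc v" w u] T2[of "Jc v" u w] T1[of v "Jc w" u] T2[of v u "Jc w"] T1[of u "Jc w" v]
      T1[of "Jc u" w v] by linarith
  then have "(T (Jc v) w u - T v (Jc w) u) / F z - (T (Jc u) w v - T u (Jc w) v) / F z + (T (Jc u) v w - T u (Jc v) w) / F z = 0"
    by (metis add_divide_distrib diff_divide_distrib div_0)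
  then show ?thesis unfolding ext_deriv2_def wedge12_def D th by (simp add: algebra_simps)
qed

section \<open>Embedding a compact manifold into a normed space\<close>

lemma compact_subset_closedin:
  assumes "Hausdorff_space (top_of_set M)" "compact K" "K \<subseteq> M"
  shows "closedin (top_of_set M) K"
  by (rule compactin_imp_closedin[OF assms(1)]) (simp add: assms compactin_subtopology)

text \<open>A cone over a ball in the chart, extended by zero. The preimage \<open>K\<close> of the
  closed ball is compact, hence closed in the Hausdorff space, so the chart domain and the
  complement of \<open>K\<close> are open sets on which to glue. The coordinate map times
  \<open>b\<close> extends as well, and it lets the embedding recover coordinates where
  \<open>b\<close> is positive.\<close>

lemma chart_bump:
  fixes M :: "'a::topological_space set" and c :: "('a, 'n::finite) chart"
  assumes H: "Hausdorff_space (top_of_set M)" and c: "is_chart M c" and x: "x \<in> fst c"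
  shows "\<exists>b :: 'a \<Rightarrow> real. continuous_on M b \<and> continuous_on M (\<lambda>y. b y *\<^sub>R snd c y) \<and>
    (\<forall>y. b y \<ge> 0) \<and> b x > 0 \<and> (\<forall>y\<in>M. b y > 0 \<longrightarrow> y \<in> fst c)"
proof -
  obtain \<psi> where h: "homeomorphism (fst c) (chart_image c) (snd c) \<psi>"
    and o: "openin (top_of_set M) (fst c)" "open (chart_image c)"
    using c unfolding is_chart_def by blast
  have sub: "fst c \<subseteq> M" using o(1) openin_imp_subset by blast
  have "snd c x \<in> chart_image c" using x by (auto simp: chart_image_def)
  then obtain r where r: "r > 0" "cball (snd c x) r \<subseteq> chart_image c"
    using o(2) open_contains_cball by metis
  define K where "K = \<psi> ` cball (snd c x) r"
  define b where "b = (\<lambda>y. if y \<in> fst c then max 0 (r - dist (snd c y) (snd c x)) else 0)"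
  have "\<psi> ` chart_image c = fst c" using h by (simp add: homeomorphism_def)
  then have KU: "K \<subseteq> fst c" using r by (auto simp: K_def)
  have "continuous_on (cball (snd c x) r) \<psi>"
    using h r continuous_on_subset by (auto simp: homeomorphism_def)
  then have "compact K" unfolding K_def by (rule compact_continuous_image) simp
  then have "closedin (top_of_set M) K" by (rule compact_subset_closedin[OF H]) (use KU sub in auto)
  then have oK: "openin (top_of_set M) (M - K)" by (simp add: openin_diff)
  have zero: "b y = 0" if "y \<in> M - K" for y
  proof (cases "y \<in> fst c")
    case True
    have "dist (snd c y) (snd c x) > r"
    proof (rule ccontr)
      assume "\<not> ?thesis"
      then have "snd c y \<in> cball (snd c x) r" by (simp add: dist_commute)
      moreover have "\<psi> (snd c y) = y" using h True by (simp add: homeomorphism_def)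
      ultimately have "y \<in> K" unfolding K_def by (metis image_eqI)
      then show False using that by simp
    qed
    then show ?thesis by (simp add: b_def)
  qed (simp add: b_def)
  have un: "fst c \<union> (M - K) = M" using KU sub by auto
  have cphi: "continuous_on (fst c) (snd c)" using h by (simp add: homeomorphism_def)
  have "continuous_on (fst c) (\<lambda>y. max 0 (r - dist (snd c y) (snd c x)))"
    by (intro continuous_intros cphi)
  then have b1: "continuous_on (fst c) b" by (rule continuous_on_eq) (simp add: b_def)
  have "continuous_on (M - K) (\<lambda>y. 0::real)" by simp
  then have b2: "continuous_on (M - K) b" by (rule continuous_on_eq) (simp add: zero)
  have "continuous_on (M - K) (\<lambda>y. 0::complex^'n)" by simp
  then have b3: "continuous_on (M - K) (\<lambda>y. b y *\<^sub>R snd c y)" by (rule continuous_on_eq) (simp add: zero)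
  have "continuous_on (fst c \<union> (M - K)) b"
    by (rule continuous_on_Un_local_open) (use o(1) oK b1 b2 un in auto)
  moreover have "continuous_on (fst c \<union> (M - K)) (\<lambda>y. b y *\<^sub>R snd c y)"
    by (rule continuous_on_Un_local_open) (use o(1) oK b1 cphi b3 un in \<open>auto intro: continuous_on_scaleR\<close>)
  ultimately show ?thesis
    unfolding un using x r(1) by (intro exI[of _ b]) (auto simp: b_def)
qed

text \<open>Finitely many bumps are positive somewhere at every point. If the values of one bump
  agree and are positive, both points lie in its chart, and dividing the second component by that
  value shows that their coordinates agree. The number of bumps comes from compactness and is not
  fixed by the type, so the target consists of bounded sequences, filled up with zeros.\<close>

lemma compact_manifold_embedding:
  fixes M :: "'a::topological_space set" and A :: "('a, 'n::finite) chart set"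
  assumes M: "complex_manifold M A" and comp: "compact M"
  shows "\<exists>e :: 'a \<Rightarrow> (nat \<Rightarrow>\<^sub>C (real \<times> (complex^'n))). continuous_on M e \<and> inj_on e M"
proof -
  have H: "Hausdorff_space (top_of_set M)" and ch: "\<And>c. c \<in> A \<Longrightarrow> is_chart M c" and cov: "\<Union>(fst ` A) = M"
    using M unfolding complex_manifold_def by auto
  define P where "P = (\<lambda>x (c, b). c \<in> A \<and> continuous_on M b \<and> continuous_on M (\<lambda>y. b y *\<^sub>R snd c y) \<and>
    (\<forall>y. b y \<ge> 0) \<and> b x > (0::real) \<and> (\<forall>y\<in>M. b y > 0 \<longrightarrow> y \<in> fst c))"
  have "\<exists>q. P x q" if xM: "x \<in> M" for x
  proof -
    obtain c where "c \<in> A" "x \<in> fst c" using xM cov by blast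
    moreover from this obtain b :: "'a \<Rightarrow> real" where "continuous_on M b"
      "continuous_on M (\<lambda>y. b y *\<^sub>R snd c y)" "\<forall>y. b y \<ge> 0" "b x > 0" "\<forall>y\<in>M. b y > 0 \<longrightarrow> y \<in> fst c"
      using chart_bump[OF H ch[of c], of x] by auto
    ultimately have "P x (c, b)" by (simp add: P_def)
    then show ?thesis ..
  qed
  then have "\<forall>x\<in>M. \<exists>q. P x q" ..
  from bchoice[OF this] obtain q where q: "\<forall>x\<in>M. P x (q x)" ..
  define c where "c = (\<lambda>x. fst (q x))"
  define b where "b = (\<lambda>x. snd (q x))"
  have cb: "c x \<in> A" "continuous_on M (b x)" "continuous_on M (\<lambda>y. b x y *\<^sub>R snd (c x) y)"
    "b x y \<ge> 0" "b x x > 0" "y \<in> M \<Longrightarrow> b x y > 0 \<Longrightarrow> y \<in> fst (c x)" if "x \<in> M" for x y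
    using bspec[OF q that] by (auto simp: P_def b_def c_def split: prod.splits)
  define V where "V = (\<lambda>x. M \<inter> b x -` {0<..})"
  have oV: "openin (top_of_set M) (V x)" if "x \<in> M" for x
    unfolding V_def using cb(2)[OF that] by (rule continuous_openin_preimage_gen) simp
  have "M \<subseteq> \<Union>(V ` M)" using cb(5) by (auto simp: V_def)
  then obtain D where D: "D \<subseteq> V ` M" "finite D" "M \<subseteq> \<Union>D"
    using comp[unfolded compact_eq_openin_cover, rule_format, of "V ` M"] oV by auto
  then obtain F where F: "F \<subseteq> M" "finite F" "M \<subseteq> \<Union>(V ` F)"
    using finite_subset_image[of D V M] by blast
  obtain xs where xs: "set xs = F" using F(2) finite_list by blast
  define g where "g = (\<lambda>y k. if k < length xs then (b (xs!k) y, b (xs!k) y *\<^sub>R snd (c (xs!k)) y) else 0)"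
  define e where "e = (\<lambda>y. Bcontfun (g y))"
  have "g y \<in> bcontfun" for y
  proof -
    have "range (g y) \<subseteq> insert 0 (g y ` {..<length xs})" by (auto simp: g_def)
    then have "finite (range (g y))" by (rule finite_subset) simp
    then show ?thesis by (simp add: bcontfun_def continuous_on_discrete finite_imp_bounded)
  qed
  then have e: "apply_bcontfun (e y) k = g y k" for y k by (simp add: e_def Bcontfun_inverse)
  have contg: "continuous_on M (\<lambda>y. g y k)" for k
  proof (cases "k < length xs")
    case True
    then have "xs!k \<in> M" using xs F(1) by auto
    then show ?thesis using True cb(2,3) by (simp add: g_def continuous_on_Pair)
  qed (simp add: g_def)
  have "continuous_on M e"
    unfolding continuous_on_def
  proof (intro ballI tendstoI)
    fix y and \<epsilon> :: real assume y: "y \<in> M" and eps: "\<epsilon> > 0"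
    have "\<forall>\<^sub>F y' in at y within M. \<forall>k\<in>{..<length xs}. dist (g y' k) (g y k) < \<epsilon> / 2"
    proof (rule eventually_ball_finite, simp, rule ballI)
      fix k
      have "((\<lambda>y. g y k) \<longlongrightarrow> g y k) (at y within M)" using contg[of k] y by (simp add: continuous_on_def)
      then show "\<forall>\<^sub>F y' in at y within M. dist (g y' k) (g y k) < \<epsilon> / 2"
        by (rule tendstoD) (use eps in simp)
    qed
    then show "\<forall>\<^sub>F y' in at y within M. dist (e y') (e y) < \<epsilon>"
    proof (rule eventually_mono)
      fix y' assume h: "\<forall>k\<in>{..<length xs}. dist (g y' k) (g y k) < \<epsilon> / 2"
      have "dist (e y') (e y) \<le> \<epsilon> / 2"
      proof (rule dist_bound)
        fix k show "dist (apply_bcontfun (e y') k) (apply_bcontfun (e y) k) \<le> \<epsilon> / 2"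
          unfolding e using h eps by (cases "k < length xs") (auto simp: g_def less_imp_le)
      qed
      then show "dist (e y') (e y) < \<epsilon>" using eps by linarith
    qed
  qed
  moreover have "inj_on e M"
  proof (rule inj_onI)
    fix y y' assume y: "y \<in> M" "y' \<in> M" and eq: "e y = e y'"
    obtain x where x: "x \<in> F" "y \<in> V x" using F(3) y by blast
    then obtain k where k: "k < length xs" "xs!k = x" using xs by (metis in_set_conv_nth)
    have xM: "x \<in> M" using x F by auto
    have "g y k = g y' k" using eq e by metis
    then have b: "b x y = b x y'" "b x y *\<^sub>R snd (c x) y = b x y' *\<^sub>R snd (c x) y'"
      using k by (auto simp: g_def)
    have pos: "b x y > 0" using x by (simp add: V_def)
    then have "snd (c x) y = snd (c x) y'" using b by simp
    moreover have "y \<in> fst (c x)" "y' \<in> fst (c x)" using cb(6) xM y pos b(1) by auto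
    moreover have "inj_on (snd (c x)) (fst (c x))"
      using ch[OF cb(1)[OF xM]] unfolding is_chart_def homeomorphism_def by (metis inj_onI)
    ultimately show "y = y'" by (auto dest: inj_onD)
  qed
  ultimately show ?thesis by (intro exI[of _ e] conjI)
qed

text \<open>Lifting is carried out over the embedded base; a homeomorphism of the base carries
  evenly covered sets along and keeps their sheets.\<close>

lemma covering_space_homeomorphism:
  assumes p: "covering_space W p M" and h: "homeomorphism M B e k"
  shows "covering_space W (e \<circ> p) B"
proof (rule covering_spaceI)
  have pc: "continuous_on W p" "p ` W = M" using p by (auto simp: covering_space_def)
  have e: "continuous_on M e" "e ` M = B" "\<And>x. x \<in> M \<Longrightarrow> k (e x) = x" using h by (auto simp: homeomorphism_def)
  show "continuous_on W (e \<circ> p)" using pc e by (intro continuous_on_compose) auto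
  show "(e \<circ> p) ` W = B" using pc e by (simp flip: image_image add: image_comp[symmetric])
  fix y assume "y \<in> B"
  then obtain x where x: "x \<in> M" "y = e x" using e by blast
  have "\<exists>T. x \<in> T \<and> openin (top_of_set M) T \<and> (\<exists>v. \<Union>v = W \<inter> p -` T \<and>
      (\<forall>u\<in>v. openin (top_of_set W) u) \<and> pairwise disjnt v \<and> (\<forall>u\<in>v. \<exists>q. homeomorphism u T p q))"
    using p x(1) unfolding covering_space_def by simp
  then obtain T v where T: "x \<in> T" "openin (top_of_set M) T" "\<Union>v = W \<inter> p -` T"
      "\<forall>u\<in>v. openin (top_of_set W) u" "pairwise disjnt v" "\<forall>u\<in>v. \<exists>q. homeomorphism u T p q"
    by (elim exE conjE)
  have TM: "T \<subseteq> M" using T(2) openin_imp_subset by blast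
  have hT: "homeomorphism T (e ` T) e k" by (rule homeomorphism_of_subsets[OF h TM order_refl refl])
  have pre: "W \<inter> (e \<circ> p) -` (e ` T) = W \<inter> p -` T"
  proof safe
    fix w t assume w: "w \<in> W" "(e \<circ> p) w = e t" "t \<in> T"
    have "p w \<in> M" "t \<in> M" using w pc TM by auto
    then have "p w = t" using w(2) e(3) by (metis comp_apply)
    then show "w \<in> p -` T" using w by simp
  qed auto
  then show "\<exists>T. y \<in> T \<and> openin (top_of_set B) T \<and>
       (\<exists>v. \<Union>v = W \<inter> (e \<circ> p) -` T \<and> (\<forall>u\<in>v. openin (top_of_set W) u) \<and>
            pairwise disjnt v \<and> (\<forall>u\<in>v. \<exists>q. homeomorphism u T (e \<circ> p) q))"
  proof (intro exI[of _ "e ` T"] conjI exI[of _ v] ballI)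
    fix u assume "u \<in> v"
    then show "\<exists>q. homeomorphism u (e ` T) (e \<circ> p) q" "openin (top_of_set W) u"
      using T(4,6) homeomorphism_compose[OF _ hT] by blast+
  qed (use T(1,3,5) x(2) pre homeomorphism_imp_open_map[OF h T(2)] in auto)
qed

section \<open>Deck transformations\<close>

lemma holomorphic_map_on_locally:
  assumes "open S" "\<And>x. x \<in> S \<Longrightarrow> \<exists>N. x \<in> N \<and> holomorphic_map_on f N"
  shows "holomorphic_map_on f S"
  unfolding holomorphic_map_on_def
proof (intro conjI ballI assms(1))
  fix x assume "x \<in> S"
  then obtain N where "x \<in> N" "holomorphic_map_on f N" using assms(2) by blast
  then show "\<exists>D. (f has_derivative D) (at x) \<and> (\<forall>c v. D (c *s v) = c *s D v)"
    unfolding holomorphic_map_on_def by blast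
qed

text \<open>For \<open>j \<ge> 1\<close> these are compact annuli that exhaust the punctured space
  as \<open>j\<close> grows, at the origin and at infinity simultaneously.\<close>

definition shell :: "real \<Rightarrow> ('a::euclidean_space) set" where
  "shell j = {w. 1 / j \<le> norm w \<and> norm w \<le> j}"

lemma compact_shell: "compact (shell j :: 'a::euclidean_space set)"
proof -
  have "(shell j :: 'a set) = cball 0 j - ball 0 (1 / j)" by (auto simp: shell_def)
  then show ?thesis using compact_diff[of "cball (0::'a) j" "ball 0 (1 / j)"] by simp
qed

lemma shell_mono: "0 < i \<Longrightarrow> i \<le> j \<Longrightarrow> shell i \<subseteq> shell j"
  unfolding shell_def by (auto intro: order_trans[of "1 / j" "1 / i"] simp: frac_le)

lemma zero_notin_shell: "j > 0 \<Longrightarrow> 0 \<notin> shell j"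
  by (simp add: shell_def)

lemma ex_shell:
  assumes "w \<noteq> 0" shows "\<exists>j\<ge>J. j \<ge> 1 \<and> w \<in> shell j"
proof (intro exI conjI)
  let ?j = "max J (max 1 (max (norm w) (1 / norm w)))"
  show "?j \<ge> J" "?j \<ge> 1" by auto
  have "1 / norm w \<le> ?j" by simp
  then have "1 / ?j \<le> norm w" using assms by (simp add: field_simps)
  moreover have "norm w \<le> ?j" by simp
  ultimately show "w \<in> shell ?j" unfolding shell_def by blast
qed

text \<open>The embedding \<open>e\<close> replaces \<open>M\<close> by a homeomorphic subset of a
  normed space, where lifts of maps and limits of sequences are available.\<close>

locale hopf_covering =
  fixes M :: "'a::topological_space set" and A :: "('a, 'n::finite) chart set"
    and p :: "complex^'n \<Rightarrow> 'a" and e :: "'a \<Rightarrow> 'e::real_normed_vector"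
  assumes manifold: "complex_manifold M A" and compact_M: "compact M"
    and covering: "holomorphic_universal_covering (- {0}) p M A"
    and card: "CARD('n) \<ge> 2"
    and cont_e: "continuous_on M e" and inj_e: "inj_on e M"
begin

abbreviation W :: "(complex^'n) set" where "W \<equiv> - {0}"

text \<open>The value at the excluded point 0 is normalized, so that equality of deck
  transformations is equality of functions. Bijectivity is not demanded; it follows in
  \<open>deck_inverse\<close>.\<close>

definition deck :: "(complex^'n \<Rightarrow> complex^'n) set" where
  "deck = {g. continuous_on W g \<and> g ` W \<subseteq> W \<and> (\<forall>z\<in>W. p (g z) = p z) \<and> g 0 = 0}"

lemma cov: "covering_space W p M" and simply: "simply_connected W"
  using covering by (auto simp: holomorphic_universal_covering_def)

lemma p_image: "p ` W = M" and cont_p: "continuous_on W p"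
  using cov by (auto simp: covering_space_def)

lemma cov_e: "covering_space W (e \<circ> p) (e ` M)"
proof -
  obtain k where "homeomorphism M (e ` M) e k"
    using homeomorphism_compact[OF compact_M cont_e refl inj_e] by blast
  then show ?thesis by (rule covering_space_homeomorphism[OF cov])
qed

lemma cont_ep: "continuous_on W (e \<circ> p)"
  using cov_e by (simp add: covering_space_def)

lemma ep_eq: "z \<in> W \<Longrightarrow> w \<in> W \<Longrightarrow> e (p z) = e (p w) \<Longrightarrow> p z = p w"
  using inj_e p_image by (auto dest: inj_onD)

lemma deckD:
  assumes "g \<in> deck"
  shows "continuous_on W g" "z \<in> W \<Longrightarrow> g z \<in> W" "z \<in> W \<Longrightarrow> p (g z) = p z" "g 0 = 0"
  using assms by (auto simp: deck_def)

lemma deck_unique: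
  assumes g: "g \<in> deck" and h: "h \<in> deck" and x: "x \<in> W" "g x = h x"
  shows "g = h"
proof
  fix z show "g z = h z"
  proof (cases "z = 0")
    case True then show ?thesis using g h by (simp add: deckD(4))
  next
    case False
    show ?thesis
    proof (rule covering_space_lift_unique[OF cov x(2) cont_p _ deckD(1)[OF g] _ _ deckD(1)[OF h]])
      show "connected W" using simply by (rule simply_connected_imp_connected)
    qed (use x False p_image deckD(2,3)[OF g] deckD(2,3)[OF h] in auto)
  qed
qed

text \<open>The covering map is lifted through itself with \<open>x\<close> sent to
  \<open>y\<close>; the lift exists because \<open>W\<close> is simply connected and locally path
  connected. Hence the fibres of \<open>p\<close> are exactly the orbits of
  \<open>deck\<close>.\<close>

lemma deck_transitive:
  assumes x: "x \<in> W" and y: "y \<in> W" and xy: "p x = p y"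
  shows "\<exists>g\<in>deck. g x = y"
proof -
  obtain g where g: "continuous_on W g" "g \<in> W \<rightarrow> W" "g x = y" "\<And>z. z \<in> W \<Longrightarrow> (e \<circ> p) (g z) = (e \<circ> p) z"
  proof (rule covering_space_lift_strong[OF cov_e y x simply _ cont_ep])
    show "locally path_connected W" by (rule open_imp_locally_path_connected) auto
    show "e \<circ> p \<in> W \<rightarrow> e ` M" using p_image by auto
    show "(e \<circ> p) x = (e \<circ> p) y" using xy by simp
  qed (rule that)
  define h where "h = (\<lambda>z. if z = 0 then 0 else g z)"
  have "continuous_on W h" by (rule continuous_on_eq[OF g(1)]) (simp add: h_def)
  moreover have "p (h z) = p z" if "z \<in> W" for z
    using ep_eq[of "g z" z] g(2,4) that by (auto simp: h_def)
  ultimately have "h \<in> deck" using g(2) by (auto simp: deck_def h_def)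
  then show ?thesis using g(3) x by (intro bexI[of _ h]) (auto simp: h_def)
qed

section \<open>Group structure of the deck transformations\<close>

lemma deck_id: "(\<lambda>z. z) \<in> deck"
  by (simp add: deck_def continuous_on_id)

lemma deck_compose:
  assumes "g \<in> deck" "h \<in> deck" shows "g \<circ> h \<in> deck"
proof -
  have "h ` W \<subseteq> W" using assms(2) by (simp add: deck_def)
  then have "continuous_on W (g \<circ> h)"
    by (intro continuous_on_compose deckD(1) assms continuous_on_subset[OF deckD(1)[OF assms(1)]])
  moreover have "\<forall>z\<in>W. p ((g \<circ> h) z) = p z"
    using deckD(3)[OF assms(1) deckD(2)[OF assms(2)]] deckD(3)[OF assms(2)] by simp
  moreover have "(g \<circ> h) ` W \<subseteq> W"
    using deckD(2)[OF assms(1) deckD(2)[OF assms(2)]] by (simp only: o_apply image_subset_iff) simp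
  moreover have "(g \<circ> h) 0 = 0" using deckD(4)[OF assms(1)] deckD(4)[OF assms(2)] by simp
  ultimately show ?thesis unfolding deck_def by blast
qed

text \<open>Transitivity provides a deck transformation that undoes \<open>g\<close> at one base
  point; uniqueness of lifts then makes both composites the identity everywhere.\<close>

lemma deck_inverse:
  assumes g: "g \<in> deck" shows "\<exists>h\<in>deck. (\<forall>z. h (g z) = z) \<and> (\<forall>z. g (h z) = z)"
proof -
  define x :: "complex^'n" where "x = axis undefined 1"
  have x: "x \<in> W" by (simp add: x_def axis_eq_0_iff)
  obtain h where h: "h \<in> deck" "h (g x) = x"
    using deck_transitive[OF deckD(2)[OF g x] x] deckD(3)[OF g x] by blast
  have 1: "h \<circ> g = (\<lambda>z. z)"
    by (rule deck_unique[OF deck_compose[OF h(1) g] deck_id x]) (simp add: h)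
  have 2: "g \<circ> h = (\<lambda>z. z)"
    by (rule deck_unique[OF deck_compose[OF g h(1)] deck_id deckD(2)[OF g x]]) (simp add: h)
  show ?thesis using fun_cong[OF 1] fun_cong[OF 2] by (intro bexI[OF _ h(1)]) simp
qed

lemma inj_on_compose_deck:
  assumes g: "g \<in> deck" shows "inj_on (\<lambda>h. g \<circ> h) S" "inj_on (\<lambda>h. h \<circ> g) S"
proof -
  obtain k where "\<forall>z. k (g z) = z" "\<forall>z. g (k z) = z" using deck_inverse[OF g] by (elim bexE conjE)
  then have k: "k \<circ> g = id" "g \<circ> k = id" by (simp_all add: fun_eq_iff)
  show "inj_on (\<lambda>h. g \<circ> h) S"
  proof (rule inj_onI)
    fix h h' assume "g \<circ> h = g \<circ> h'"
    then have "(k \<circ> g) \<circ> h = (k \<circ> g) \<circ> h'" by (simp add: comp_assoc)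
    then show "h = h'" by (simp add: k)
  qed
  show "inj_on (\<lambda>h. h \<circ> g) S"
  proof (rule inj_onI)
    fix h h' assume "h \<circ> g = h' \<circ> g"
    then have "h \<circ> (g \<circ> k) = h' \<circ> (g \<circ> k)" by (simp flip: comp_assoc)
    then show "h = h'" by (simp add: k)
  qed
qed

section \<open>Holomorphy, proper discontinuity and cocompactness of the action\<close>

lemma local_chart:
  assumes c: "c \<in> A" and z: "z \<in> W" "p z \<in> fst c"
  shows "\<exists>V k. open V \<and> z \<in> V \<and> V \<subseteq> W \<and> p ` V \<subseteq> fst c \<and> holomorphic_map_on (snd c \<circ> p) V \<and>
    holomorphic_map_on k ((snd c \<circ> p) ` V) \<and> (\<forall>w\<in>V. k (snd c (p w)) = w)"
proof -
  obtain V where V: "open V" "z \<in> V" "V \<subseteq> W" "p ` V \<subseteq> fst c" "biholomorphic_map_on (snd c \<circ> p) V"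
    using covering[unfolded holomorphic_universal_covering_def, THEN conjunct2, THEN conjunct2, THEN conjunct2,
        rule_format, OF c z] by (elim exE conjE) (rule that)
  from V(5) obtain k where "holomorphic_map_on k ((snd c \<circ> p) ` V)" "\<forall>w\<in>V. k ((snd c \<circ> p) w) = w"
    unfolding biholomorphic_map_on_def by blast
  with V show ?thesis
    by (intro exI[of _ V] exI[of _ k]) (simp add: biholomorphic_map_on_def)
qed

lemma chart_at: "z \<in> W \<Longrightarrow> \<exists>c\<in>A. p z \<in> fst c"
proof -
  have "\<Union>(fst ` A) = M" using manifold by (simp add: complex_manifold_def)
  then show "z \<in> W \<Longrightarrow> \<exists>c\<in>A. p z \<in> fst c" using p_image by blast
qed

lemma p_locally_injective:
  assumes "z \<in> W" shows "\<exists>V. open V \<and> z \<in> V \<and> V \<subseteq> W \<and> inj_on p V"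
proof -
  obtain c where "c \<in> A" "p z \<in> fst c" using chart_at[OF assms] by blast
  from local_chart[OF this(1) assms this(2)]
  obtain V k where V: "open V" "z \<in> V" "V \<subseteq> W" "\<forall>w\<in>V. k (snd c (p w)) = w"
    by (elim exE conjE) (rule that)
  have "inj_on p V"
  proof (rule inj_onI)
    fix v w assume "v \<in> V" "w \<in> V" "p v = p w"
    then show "v = w" using V(4) by metis
  qed
  with V show ?thesis by blast
qed

text \<open>Near any point \<open>g\<close> is the coordinate expression of \<open>p\<close>
  followed by a local holomorphic inverse of that expression near the image point.\<close>

lemma deck_holomorphic:
  assumes g: "g \<in> deck" shows "holomorphic_map_on g W"
proof (rule holomorphic_map_on_locally)
  fix x assume x: "x \<in> W"
  obtain c where c: "c \<in> A" "p x \<in> fst c" using chart_at[OF x] by blast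
  obtain V1 where V1: "open V1" "x \<in> V1" "V1 \<subseteq> W" "holomorphic_map_on (snd c \<circ> p) V1"
    using local_chart[OF c(1) x c(2)] by (elim exE conjE) (rule that)
  obtain V2 k where V2: "open V2" "g x \<in> V2" "holomorphic_map_on k ((snd c \<circ> p) ` V2)"
     "\<forall>w\<in>V2. k (snd c (p w)) = w"
    using local_chart[OF c(1) deckD(2)[OF g x], unfolded deckD(3)[OF g x], OF c(2)] by (elim exE conjE) (rule that)
  define N where "N = V1 \<inter> (W \<inter> g -` V2)"
  have N: "open N"
    unfolding N_def by (intro open_Int V1 continuous_open_preimage deckD(1)[OF g] V2) auto
  have "holomorphic_map_on (\<lambda>z. k ((snd c \<circ> p) z)) N"
  proof (rule holomorphic_map_on_compose[OF holomorphic_map_on_subset[OF V1(4) _ N] V2(3)])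
    show "(snd c \<circ> p) ` N \<subseteq> (snd c \<circ> p) ` V2"
    proof
      fix y assume "y \<in> (snd c \<circ> p) ` N"
      then obtain z where "y = (snd c \<circ> p) z" "z \<in> N" by blast
      then show "y \<in> (snd c \<circ> p) ` V2"
        using deckD(3)[OF g, of z] by (intro image_eqI[of _ _ "g z"]) (auto simp: N_def)
    qed
  qed (auto simp: N_def)
  then have "holomorphic_map_on g N"
  proof (rule holomorphic_map_on_cong)
    fix z assume "z \<in> N"
    then show "k ((snd c \<circ> p) z) = g z"
      using V2(4)[rule_format, of "g z"] deckD(3)[OF g, of z] by (simp add: N_def)
  qed
  then show "\<exists>N. x \<in> N \<and> holomorphic_map_on g N" using V1 V2 x by (intro exI[of _ N]) (simp add: N_def)
qed auto

text \<open>Infinitely many such elements would give, along a subsequence, points converging to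
  \<open>a\<close> with images converging to \<open>b\<close>. Then \<open>a\<close> and
  \<open>b\<close> lie in one fibre, so some \<open>g\<close> in \<open>deck\<close> sends
  \<open>a\<close> to \<open>b\<close>. As \<open>p\<close> is injective near \<open>b\<close>, the
  elements of the subsequence eventually agree with \<open>g\<close> at one point and hence equal
  \<open>g\<close>, although they were distinct.\<close>

lemma deck_properly_discontinuous:
  assumes K: "compact K" "K \<subseteq> W"
  shows "finite {g\<in>deck. \<exists>z\<in>K. g z \<in> K}"
proof (rule ccontr)
  assume "infinite {g\<in>deck. \<exists>z\<in>K. g z \<in> K}"
  then obtain G :: "nat \<Rightarrow> complex^'n \<Rightarrow> complex^'n" where G: "inj G" "range G \<subseteq> {g\<in>deck. \<exists>z\<in>K. g z \<in> K}"
    using infinite_countable_subset by blast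
  then have "\<forall>n. \<exists>z. z \<in> K \<and> G n z \<in> K" by blast
  from choice[OF this] obtain x where x: "\<And>n. x n \<in> K" "\<And>n. G n (x n) \<in> K" by auto
  have Gd: "G n \<in> deck" for n using G by blast
  have "compact (K \<times> K)" using K by (intro compact_Times)
  then obtain l r where l: "l \<in> K \<times> K" "strict_mono (r :: nat \<Rightarrow> nat)" "((\<lambda>n. (x n, G n (x n))) \<circ> r) \<longlonglongrightarrow> l"
    by (rule seq_compactE[OF compact_imp_seq_compact, of "K \<times> K" "\<lambda>n. (x n, G n (x n))"]) (use x in auto)
  obtain a b where ab: "l = (a, b)" by (cases l)
  have aW: "a \<in> W" and bW: "b \<in> W" using l(1) ab K(2) by auto
  have la: "(\<lambda>n. x (r n)) \<longlonglongrightarrow> a" and lb: "(\<lambda>n. G (r n) (x (r n))) \<longlonglongrightarrow> b"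
    using tendsto_fst[OF l(3)] tendsto_snd[OF l(3)] ab by (auto simp: o_def)
  have xW: "x n \<in> W" "G n (x n) \<in> W" for n using x K(2) by blast+
  have "(\<lambda>n. (e \<circ> p) (x (r n))) \<longlonglongrightarrow> (e \<circ> p) a"
    by (rule continuous_on_tendsto_compose[OF cont_ep la aW]) (use xW in simp)
  moreover have "(\<lambda>n. (e \<circ> p) (G (r n) (x (r n)))) \<longlonglongrightarrow> (e \<circ> p) b"
    by (rule continuous_on_tendsto_compose[OF cont_ep lb bW]) (use xW in simp)
  moreover have "(e \<circ> p) (G (r n) (x (r n))) = (e \<circ> p) (x (r n))" for n
    using deckD(3)[OF Gd xW(1)] by simp
  ultimately have "(e \<circ> p) a = (e \<circ> p) b" using LIMSEQ_unique by simp
  then have "p a = p b" using ep_eq[OF aW bW] by simp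
  then obtain g where g: "g \<in> deck" "g a = b" using deck_transitive[OF aW bW] by blast
  obtain V where V: "open V" "b \<in> V" "inj_on p V" using p_locally_injective[OF bW] by blast
  have "(\<lambda>n. g (x (r n))) \<longlonglongrightarrow> b"
    using continuous_on_tendsto_compose[OF deckD(1)[OF g(1)] la aW] xW(1) g(2) by simp
  then have "\<forall>\<^sub>F n in sequentially. g (x (r n)) \<in> V" using V by (intro topological_tendstoD)
  moreover have "\<forall>\<^sub>F n in sequentially. G (r n) (x (r n)) \<in> V"
    by (rule topological_tendstoD[OF lb V(1,2)])
  ultimately have "\<forall>\<^sub>F n in sequentially. G (r n) = g"
  proof eventually_elim
    case (elim n)
    have "p (g (x (r n))) = p (G (r n) (x (r n)))"
      using deckD(3)[OF g(1) xW(1)] deckD(3)[OF Gd xW(1)] by simp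
    then have "g (x (r n)) = G (r n) (x (r n))" using inj_onD[OF V(3)] elim by blast
    then show ?case using deck_unique[OF g(1) Gd xW(1)] by metis
  qed
  then obtain N where N: "\<And>n. n \<ge> N \<Longrightarrow> G (r n) = g" by (auto simp: eventually_sequentially)
  have "G (r N) = G (r (Suc N))" using N[of N] N[of "Suc N"] by simp
  then have "r N = r (Suc N)" using G(1) by (simp add: inj_eq)
  then show False using l(2) by (metis lessI less_irrefl strict_mono_less)
qed

text \<open>The covering map is open, so the images of the open annuli \<open>U j\<close> form an
  increasing open cover of the compact base, and one of them is everything.\<close>

lemma cocompact: "\<exists>m\<ge>1. \<forall>j\<ge>m. \<forall>z\<in>W. \<exists>g\<in>deck. g z \<in> shell j"
proof -
  define U where "U = (\<lambda>j::nat. {w::complex^'n. 1 / (real j + 1) < norm w \<and> norm w < real j + 1})"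
  have "open (U j)" for j unfolding U_def by (intro open_Collect_conj open_Collect_less continuous_intros)
  have UW: "U j \<subseteq> W" for j by (auto simp: U_def)
  have op: "openin (top_of_set (e ` M)) ((e \<circ> p) ` U j)" for j
  proof (rule covering_space_open_map[OF cov_e])
    have "open W" by auto
    then show "openin (top_of_set W) (U j)" using \<open>open (U j)\<close> UW[of j] openin_open_eq by blast
  qed
  have comp: "compact (e ` M)" by (rule compact_continuous_image[OF cont_e compact_M])
  have mono: "U i \<subseteq> U j" if "i \<le> j" for i j
  proof -
    have "1 / (real j + 1) \<le> 1 / (real i + 1)" using that by (simp add: frac_le)
    then show ?thesis using that by (auto simp: U_def)
  qed
  have "e ` M \<subseteq> \<Union>(range (\<lambda>j. (e \<circ> p) ` U j))"
  proof
    fix y assume "y \<in> e ` M"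
    then obtain w where w: "w \<in> W" "y = e (p w)" using p_image by blast
    obtain j where j: "w \<in> shell j" "j \<ge> 1" using ex_shell[of w 1] w by auto
    obtain n :: nat where n: "j < real n" using reals_Archimedean2 by blast
    have "1 / (real n + 1) < 1 / j" using n j by (intro divide_strict_left_mono) auto
    then have "w \<in> U n" using n j by (auto simp: U_def shell_def)
    then show "y \<in> \<Union>(range (\<lambda>j. (e \<circ> p) ` U j))" using w by auto
  qed
  then obtain D where D: "D \<subseteq> range (\<lambda>j. (e \<circ> p) ` U j)" "finite D" "e ` M \<subseteq> \<Union>D"
    using comp[unfolded compact_eq_openin_cover, rule_format, of "range (\<lambda>j. (e \<circ> p) ` U j)"] op by auto
  then obtain F where F: "finite F" "D = (\<lambda>j. (e \<circ> p) ` U j) ` F"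
    using finite_subset_image[of D "\<lambda>j. (e \<circ> p) ` U j" UNIV] by auto
  define m where "m = Max (insert 0 F)"
  have m: "\<exists>w\<in>U m. p w = p z" if z: "z \<in> W" for z
  proof -
    have "e (p z) \<in> e ` M" using z p_image by blast
    then obtain j w where jw: "j \<in> F" "w \<in> U j" "e (p z) = e (p w)" using D(3) F(2) by auto
    have "j \<le> m" unfolding m_def using F(1) jw(1) by simp
    then have "w \<in> U m" using mono jw(2) by blast
    moreover have "p z = p w" using ep_eq[OF z _ jw(3)] UW jw(2) by blast
    ultimately show ?thesis by force
  qed
  have "\<exists>g\<in>deck. g z \<in> shell j" if j: "j \<ge> real m + 1" and z: "z \<in> W" for j z
  proof -
    obtain w where w: "w \<in> U m" "p w = p z" using m[OF z] by blast
    then have "w \<in> W" using UW[of m] by blast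
    then obtain g where g: "g \<in> deck" "g z = w" using deck_transitive[OF z _ w(2)[symmetric]] by blast
    have "U m \<subseteq> shell (real m + 1)" by (auto simp: U_def shell_def)
    then have "w \<in> shell j" using w shell_mono[of "real m + 1" j] j by auto
    then show ?thesis using g by auto
  qed
  then show ?thesis by (intro exI[of _ "real m + 1"]) auto
qed

end

section \<open>A contraction and a character of the deck group\<close>

text \<open>For \<open>n \<ge> 2\<close> every point near the origin lies on a complex disc that avoids the origin and whose
  boundary stays away from it; the maximum principle on such discs replaces Hartogs' theorem.\<close>

lemma holomorphic_bound_near_zero:
  fixes g :: "complex^'n::finite \<Rightarrow> complex^'n"
  assumes n: "CARD('n) \<ge> 2" and g: "holomorphic_map_on g (- {0})"
    and B: "\<And>w. w \<in> shell 2 \<Longrightarrow> norm (g w) \<le> B" and z: "z \<noteq> 0" "norm z \<le> 1 / 2"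
  shows "norm (g z) \<le> real CARD('n) * B"
proof -
  obtain j where j: "z $ j \<noteq> 0" using z(1) by (auto simp: vec_eq_iff)
  obtain i :: 'n where i: "i \<noteq> j"
  proof -
    have "UNIV \<noteq> {j}"
    proof
      assume "UNIV = {j}"
      then have "CARD('n) = card {j}" by (rule arg_cong)
      then show False using n by simp
    qed
    then show ?thesis using that by blast
  qed
  \<comment> \<open>Moving along a coordinate axis other than \<open>j\<close> leaves the nonzero
    coordinate \<open>z $ j\<close> unchanged, so the line misses the origin. On the unit circle of
    parameters the norm lies between 1/2 and 3/2, inside \<open>shell 2\<close>.\<close>
  define v :: "complex^'n" where "v = axis i 1"
  have nv: "norm v = 1" by (simp add: v_def norm_axis_1)
  have nz: "z + \<zeta> *s v \<in> - {0}" for \<zeta>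
  proof -
    have "(z + \<zeta> *s v) $ j \<noteq> 0" using j i by (simp add: v_def axis_def)
    then show ?thesis by (metis ComplI singletonD zero_index)
  qed
  have comp: "norm (g z $ k) \<le> B" for k
  proof -
    let ?f = "\<lambda>\<zeta>. g (z + \<zeta> *s v) $ k"
    have der: "(?f has_field_derivative ddir (\<lambda>x. g x $ k) v (z + \<zeta> *s v)) (at \<zeta>)" for \<zeta>
      by (rule holomorphic_fun_on_slice[OF holomorphic_map_on_nth(1)[OF g] nz])
    have "?f holomorphic_on interior (ball 0 1)"
      unfolding interior_open[OF open_ball] holomorphic_on_open[OF open_ball] using der by blast
    moreover have "continuous_on (closure (ball 0 1)) ?f"
      by (intro continuous_at_imp_continuous_on ballI DERIV_isCont[OF der])
    ultimately have "norm (?f 0) \<le> B"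
    proof (rule maximum_modulus_frontier)
      fix \<zeta> :: complex assume "\<zeta> \<in> frontier (ball 0 1)"
      then have "norm (\<zeta> *s v) = 1" by (simp add: norm_vector_scalar_mult nv)
      then have "z + \<zeta> *s v \<in> shell 2"
        using z(2) norm_triangle_ineq[of z "\<zeta> *s v"] norm_diff_ineq[of "\<zeta> *s v" z]
        by (simp add: shell_def add.commute)
      then have "norm (g (z + \<zeta> *s v)) \<le> B" by (rule B)
      then show "norm (?f \<zeta>) \<le> B" using Finite_Cartesian_Product.norm_nth_le[of "g (z + \<zeta> *s v)" k] by linarith
    qed auto
    then show ?thesis by simp
  qed
  \<comment> \<open>The maximum principle was applied to each component separately; summing the
    components costs the factor \<open>CARD('n)\<close>.\<close>
  have "norm (g z) \<le> (\<Sum>k\<in>UNIV. norm (g z $ k))"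
    unfolding norm_vec_def by (rule L2_set_le_sum) simp
  also have "\<dots> \<le> (\<Sum>k\<in>(UNIV::'n set). B)" by (rule sum_mono) (rule comp)
  finally show ?thesis by simp
qed

context hopf_covering
begin

section \<open>An element contracting a shell into the unit ball\<close>

lemma deck_compact_image:
  assumes "g \<in> deck" "compact K" "K \<subseteq> W" shows "compact (g ` K)" "g ` K \<subseteq> W"
proof -
  show "compact (g ` K)"
    by (rule compact_continuous_image[OF continuous_on_subset[OF deckD(1)[OF assms(1)] assms(3)] assms(2)])
  show "g ` K \<subseteq> W" by (intro image_subsetI deckD(2)[OF assms(1)] subsetD[OF assms(3)])
qed

lemma shell_subset_W: "j > 0 \<Longrightarrow> shell j \<subseteq> W"
  using zero_notin_shell by auto

text \<open>Away from the origin this is compactness, near it the maximum principle on discs.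
  Boundedness prevents an orbit point in the unit ball from being moved arbitrarily far out, so only
  finitely many orbit points cross the sphere.\<close>

lemma deck_bounded:
  assumes g: "g \<in> deck" shows "\<exists>B. \<forall>z\<in>W. norm z \<le> 1 \<longrightarrow> norm (g z) \<le> B"
proof -
  have "bounded (g ` shell 2)"
    using deck_compact_image(1)[OF g compact_shell shell_subset_W, of 2] by (simp add: compact_imp_bounded)
  then obtain B where B: "\<And>w. w \<in> shell 2 \<Longrightarrow> norm (g w) \<le> B" unfolding bounded_iff by auto
  have "norm (g z) \<le> max B (real CARD('n) * B)" if z: "z \<in> W" "norm z \<le> 1" for z
  proof (cases "norm z \<le> 1 / 2")
    case True
    then show ?thesis
      using holomorphic_bound_near_zero[OF card deck_holomorphic[OF g] B, of z] z by simp
  next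
    case False
    then have "z \<in> shell 2" using z by (simp add: shell_def)
    then show ?thesis using B[of z] by simp
  qed
  then show ?thesis by (intro exI ballI impI)
qed

text \<open>Only finitely many elements move \<open>shell j\<close> to a set meeting it, and the
  union \<open>T\<close> of these images stays away from 0. A point \<open>w\<close> closer to 0
  than \<open>T\<close> can be moved into \<open>shell j\<close> by some \<open>h\<close>; the
  inverse of \<open>h\<close> then moves the shell off itself, and by connectedness the image lies
  entirely inside or entirely outside. It contains \<open>w\<close>, so it lies inside.\<close>

lemma exists_small_deck:
  "\<exists>j\<ge>J. j \<ge> 1 \<and> (\<forall>z\<in>W. \<exists>g\<in>deck. g z \<in> shell j) \<and> (\<exists>\<gamma>\<in>deck. \<forall>z\<in>shell j. norm (\<gamma> z) < 1 / j)"
proof -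
  obtain m where m: "m \<ge> 1" "\<And>j z. j \<ge> m \<Longrightarrow> z \<in> W \<Longrightarrow> \<exists>g\<in>deck. g z \<in> shell j"
    using cocompact by blast
  define j where "j = max J m"
  have j: "j \<ge> J" "j \<ge> 1" "j \<ge> m" using m(1) by (auto simp: j_def)
  have SW: "shell j \<subseteq> W" using j shell_subset_W by simp
  define F where "F = {g\<in>deck. \<exists>z\<in>shell j. g z \<in> shell j}"
  have F: "finite F" unfolding F_def by (rule deck_properly_discontinuous[OF compact_shell SW])
  define T where "T = (\<Union>g\<in>F. g ` shell j)"
  have "compact T" unfolding T_def
    by (intro compact_UN F deck_compact_image(1)[OF _ compact_shell SW]) (simp add: F_def)
  moreover have "0 \<notin> T" using deck_compact_image(2)[OF _ compact_shell SW] by (force simp: T_def F_def)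
  ultimately obtain d where d: "d > 0" "ball 0 d \<subseteq> - T"
    using compact_imp_closed open_Compl open_contains_ball by (metis ComplI)
  define w :: "complex^'n" where "w = (min d (1 / j) / 2) *\<^sub>R axis undefined 1"
  have w: "w \<in> W" "norm w < d" "norm w < 1 / j"
    using d j by (auto simp: w_def norm_axis_1 axis_eq_0_iff min_def field_simps)
  obtain h where h: "h \<in> deck" "h w \<in> shell j" using m(2)[OF j(3) w(1)] by blast
  obtain \<gamma> where g: "\<gamma> \<in> deck" "\<And>z. \<gamma> (h z) = z" using deck_inverse[OF h(1)] by blast
  have "w \<in> \<gamma> ` shell j" using g(2)[of w] h(2) by (metis image_eqI)
  moreover have "w \<notin> T" using d(2) w(2) by (auto simp: subset_iff)
  ultimately have "\<gamma> \<notin> F" by (auto simp: T_def)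
  then have disj: "\<gamma> z \<notin> shell j" if "z \<in> shell j" for z using g(1) that by (auto simp: F_def)
  have "DIM(complex^'n) \<ge> 2" using card by simp
  from connected_annulus(4)[OF this, of "1 / j" 0 j]
  have "connected (shell j :: (complex^'n) set)" by (simp add: shell_def)
  then have con: "connected (\<gamma> ` shell j)"
    by (rule connected_continuous_image[OF continuous_on_subset[OF deckD(1)[OF g(1)] SW]])
  have "ball 0 (1 / j) \<inter> \<gamma> ` shell j = {} \<or> - cball 0 j \<inter> \<gamma> ` shell j = {}"
  proof (rule connectedD[OF con open_ball])
    show "open (- cball 0 j)" using closed_cball by (simp add: open_Compl)
    have "1 / j \<le> j" using j(2) by (simp add: field_simps mult_ge1_I order_trans[of 1 j "j * j"])
    then show "ball 0 (1 / j) \<inter> - cball 0 j \<inter> \<gamma> ` shell j = {}" by auto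
    show "\<gamma> ` shell j \<subseteq> ball 0 (1 / j) \<union> - cball 0 j"
    proof
      fix y assume "y \<in> \<gamma> ` shell j"
      then have "y \<notin> shell j" using disj by blast
      then show "y \<in> ball 0 (1 / j) \<union> - cball 0 j" by (auto simp: shell_def)
    qed
  qed
  moreover have "w \<in> ball 0 (1 / j)" using w(3) by simp
  ultimately have "- cball 0 j \<inter> \<gamma> ` shell j = {}" using \<open>w \<in> \<gamma> ` shell j\<close> by blast
  then have "norm (\<gamma> z) < 1 / j" if "z \<in> shell j" for z
  proof -
    have "\<gamma> z \<in> cball 0 j" using \<open>- cball 0 j \<inter> \<gamma> ` shell j = {}\<close> that by blast
    then show ?thesis using disj[OF that] by (simp add: shell_def)
  qed
  then have "\<exists>\<gamma>\<in>deck. \<forall>z\<in>shell j. norm (\<gamma> z) < 1 / j" using g(1) by (intro bexI[of _ \<gamma>]) simp_all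
  moreover have "\<forall>z\<in>W. \<exists>g\<in>deck. g z \<in> shell j" using m(2)[OF j(3)] by (rule ballI)
  ultimately show ?thesis using j(1,2) by (intro exI[of _ j] conjI)
qed

text \<open>The bound on \<open>shell j\<close> extends to the punctured ball: points of norm
  between 1/2 and 1 lie in the shell as \<open>j \<ge> 2\<close>, and for smaller ones the maximum
  principle gives \<open>CARD('n) / j\<close>, which is below 1.\<close>

lemma small_deck_unit_ball:
  assumes g: "\<gamma> \<in> deck" and j: "j \<ge> 2" "j > real CARD('n)" and sm: "\<And>z. z \<in> shell j \<Longrightarrow> norm (\<gamma> z) < 1 / j"
    and z: "z \<in> W" "norm z \<le> 1"
  shows "norm (\<gamma> z) < 1"
proof (cases "norm z \<le> 1 / 2")
  case True
  have "norm (\<gamma> w) \<le> 1 / j" if "w \<in> shell 2" for w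
    using sm[of w] shell_mono[of 2 j] j that by (auto intro: less_imp_le)
  then have "norm (\<gamma> z) \<le> real CARD('n) * (1 / j)"
    using holomorphic_bound_near_zero[OF card deck_holomorphic[OF g], of "1 / j" z] True z by auto
  also have "\<dots> < 1" using j by (simp add: field_simps)
  finally show ?thesis .
next
  case False
  have "1 / j \<le> 1 / 2" using j by (simp add: field_simps)
  then have "1 / j \<le> norm z" using False by linarith
  then have "z \<in> shell j" using z j by (simp add: shell_def)
  then have "norm (\<gamma> z) < 1 / j" by (rule sm)
  also have "\<dots> \<le> 1" using j by simp
  finally show ?thesis .
qed

section \<open>A homomorphism from the deck group to the integers\<close>

lemma finite_orbit:
  assumes "compact Q" "Q \<subseteq> W" "x \<in> W" shows "finite {h\<in>deck. h x \<in> Q}"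
proof -
  have "finite {g\<in>deck. \<exists>z\<in>insert x Q. g z \<in> insert x Q}"
    by (rule deck_properly_discontinuous) (use assms in auto)
  then show ?thesis by (rule rev_finite_subset) auto
qed

lemma finite_deck_vimage:
  fixes F :: "(complex^'n \<Rightarrow> complex^'n) set"
  assumes g: "g \<in> deck" and F: "finite F" shows "finite {h. g \<circ> h \<in> F}"
proof -
  have "finite ((\<lambda>h. g \<circ> h) ` {h. g \<circ> h \<in> F})" by (rule finite_subset[OF _ F]) auto
  then show ?thesis by (rule finite_imageD) (rule inj_on_compose_deck(1)[OF g])
qed

definition crossing :: "complex^'n \<Rightarrow> (complex^'n \<Rightarrow> complex^'n) \<Rightarrow> (complex^'n \<Rightarrow> complex^'n) \<Rightarrow> int" where
  "crossing x g h = of_bool (norm (g (h x)) < 1) - of_bool (norm (h x) < 1)"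

definition crossings :: "complex^'n \<Rightarrow> (complex^'n \<Rightarrow> complex^'n) \<Rightarrow> (complex^'n \<Rightarrow> complex^'n) set" where
  "crossings x g = {h\<in>deck. crossing x g h \<noteq> 0}"

text \<open>The number of orbit points that \<open>g\<close> moves into the punctured unit ball, minus the number of those
  that it moves out of it; reindexing the sum shows that this is a homomorphism.\<close>

definition charge :: "complex^'n \<Rightarrow> (complex^'n \<Rightarrow> complex^'n) \<Rightarrow> int" where
  "charge x g = (\<Sum>h\<in>crossings x g. crossing x g h)"

text \<open>If \<open>g\<close> moves \<open>h x\<close> out of the ball, then
  \<open>g (h x)\<close> has norm between 1 and \<open>B\<close>. If \<open>g\<close> moves it in,
  then \<open>h x\<close> is the image of a point of the ball under the inverse \<open>k\<close>, so
  its norm lies between 1 and \<open>B'\<close>. Both annuli are compact in \<open>W\<close> and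
  contain finitely many orbit points, counted by group elements.\<close>

lemma finite_crossings:
  assumes g: "g \<in> deck" and x: "x \<in> W" shows "finite (crossings x g)"
proof -
  obtain k where k: "k \<in> deck" "\<And>z. k (g z) = z" using deck_inverse[OF g] by blast
  obtain B where B: "\<And>z. z \<in> W \<Longrightarrow> norm z \<le> 1 \<Longrightarrow> norm (g z) \<le> B" using deck_bounded[OF g] by blast
  obtain B' where B': "\<And>z. z \<in> W \<Longrightarrow> norm z \<le> 1 \<Longrightarrow> norm (k z) \<le> B'" using deck_bounded[OF k(1)] by blast
  define Q where "Q = (\<lambda>b. cball 0 b - ball (0::complex^'n) 1)"
  have Q: "compact (Q b)" "Q b \<subseteq> W" for b unfolding Q_def by (auto intro: compact_diff)
  have sub: "crossings x g \<subseteq> {h\<in>deck. h x \<in> Q B'} \<union> {h. g \<circ> h \<in> {h\<in>deck. h x \<in> Q B}}"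
  proof
    fix h assume "h \<in> crossings x g"
    then have h: "h \<in> deck" "(norm (g (h x)) < 1) \<noteq> (norm (h x) < 1)"
      by (auto simp: crossings_def crossing_def)
    have hx: "h x \<in> W" "g (h x) \<in> W" using deckD(2) g h x by blast+
    show "h \<in> {h\<in>deck. h x \<in> Q B'} \<union> {h. g \<circ> h \<in> {h\<in>deck. h x \<in> Q B}}"
    proof (cases "norm (h x) < 1")
      case True
      then have "g (h x) \<in> Q B" using h B[OF hx(1)] by (simp add: Q_def)
      then show ?thesis using deck_compose[OF g h(1)] by simp
    next
      case False
      then have "h x \<in> Q B'" using h B'[OF hx(2)] k(2)[of "h x"] by (simp add: Q_def)
      then show ?thesis using h by simp
    qed
  qed
  have fin: "finite {h\<in>deck. h x \<in> Q b}" for b by (rule finite_orbit[OF Q x])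
  have "finite {h. g \<circ> h \<in> {h\<in>deck. h x \<in> Q B}}" by (rule finite_deck_vimage[OF g fin])
  with fin have "finite ({h\<in>deck. h x \<in> Q B'} \<union> {h. g \<circ> h \<in> {h\<in>deck. h x \<in> Q B}})" by (rule finite_UnI)
  then show ?thesis by (rule finite_subset[OF sub])
qed

lemma charge_superset:
  assumes "finite F" "crossings x g \<subseteq> F" "F \<subseteq> deck"
  shows "charge x g = (\<Sum>h\<in>F. crossing x g h)"
  unfolding charge_def
proof (rule sum.mono_neutral_left[OF assms(1,2)], rule ballI)
  fix h assume h: "h \<in> F - crossings x g"
  have "h \<in> deck" by (rule subsetD[OF assms(3)]) (use h in simp)
  then show "crossing x g h = 0" using h by (simp add: crossings_def)
qed

lemma charge_compose:
  assumes g: "g \<in> deck" and k: "k \<in> deck" and x: "x \<in> W"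
  shows "charge x (g \<circ> k) = charge x g + charge x k"
proof -
  \<comment> \<open>A finite index set supporting all three sums at once, so that the cocycle
    identity \<open>split\<close> can be summed term by term.\<close>
  define F where "F = crossings x k \<union> {h. k \<circ> h \<in> crossings x g} \<inter> deck"
  have "finite F" unfolding F_def
    by (rule finite_UnI[OF finite_crossings[OF k x]
          finite_Int[OF disjI1[OF finite_deck_vimage[OF k finite_crossings[OF g x]]]]])
  moreover have "F \<subseteq> deck" by (auto simp: F_def crossings_def)
  ultimately have F: "finite F" "F \<subseteq> deck" by auto
  have split: "crossing x (g \<circ> k) h = crossing x g (k \<circ> h) + crossing x k h" for h
    by (simp add: crossing_def)
  have "crossings x (g \<circ> k) \<subseteq> F"
  proof
    fix h assume h: "h \<in> crossings x (g \<circ> k)"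
    then have "h \<in> deck" "crossing x g (k \<circ> h) + crossing x k h \<noteq> 0"
      using split[of h] by (auto simp: crossings_def)
    then show "h \<in> F" using deck_compose[OF k] by (auto simp: F_def crossings_def)
  qed
  then have "charge x (g \<circ> k) = (\<Sum>h\<in>F. crossing x g (k \<circ> h)) + (\<Sum>h\<in>F. crossing x k h)"
    using charge_superset[OF F(1) _ F(2)] by (simp add: split sum.distrib)
  also have "(\<Sum>h\<in>F. crossing x k h) = charge x k"
    using charge_superset[OF F(1) _ F(2), of x k] by (simp add: F_def)
  also have "(\<Sum>h\<in>F. crossing x g (k \<circ> h)) = (\<Sum>h\<in>(\<lambda>h. k \<circ> h) ` F. crossing x g h)"
    by (simp add: sum.reindex[OF inj_on_compose_deck(1)[OF k]] o_def[of "crossing x g"])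
  also have "\<dots> = charge x g"
  proof (rule charge_superset[symmetric])
    show "crossings x g \<subseteq> (\<lambda>h. k \<circ> h) ` F"
    proof
      fix h assume h: "h \<in> crossings x g"
      obtain l where l: "l \<in> deck" "\<And>z. k (l z) = z" using deck_inverse[OF k] by blast
      have eq: "h = k \<circ> (l \<circ> h)" by (simp add: fun_eq_iff l(2))
      have "l \<circ> h \<in> deck" using deck_compose[OF l(1)] h by (simp add: crossings_def)
      then have "l \<circ> h \<in> F" using h eq by (simp add: F_def)
      then show "h \<in> (\<lambda>h. k \<circ> h) ` F" using eq by blast
    qed
    show "(\<lambda>h. k \<circ> h) ` F \<subseteq> deck" using deck_compose[OF k] F(2) by blast
  qed (use F in simp)
  finally show ?thesis .
qed

text \<open>No orbit point leaves the ball, so no term is negative. The point \<open>x\<close>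
  itself has norm exactly 1, counts as outside because the inequality in \<open>crossing\<close> is
  strict, and is moved inside.\<close>

lemma charge_pos:
  assumes g: "\<gamma> \<in> deck" and sm: "\<And>z. z \<in> W \<Longrightarrow> norm z \<le> 1 \<Longrightarrow> norm (\<gamma> z) < 1"
    and x: "x \<in> W" "norm x = 1"
  shows "charge x \<gamma> > 0"
  unfolding charge_def
proof (rule sum_pos2[OF finite_crossings[OF g x(1)]])
  show "(\<lambda>z. z) \<in> crossings x \<gamma>"
    using sm[OF x(1)] x(2) deck_id by (simp add: crossings_def crossing_def)
  show "crossing x \<gamma> (\<lambda>z. z) > 0" using sm[OF x(1)] x(2) by (simp add: crossing_def)
  fix h assume "h \<in> crossings x \<gamma>"
  then have "h x \<in> W" using deckD(2)[OF _ x(1)] by (simp add: crossings_def)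
  then show "crossing x \<gamma> h \<ge> 0" using sm[of "h x"] by (auto simp: crossing_def less_imp_le)
qed

end

section \<open>A bump function\<close>

text \<open>The powers of t in the denominator make the family closed under differentiation up to
  linear combinations, so smoothness of all members follows by one induction.\<close>

definition flat :: "nat \<Rightarrow> real \<Rightarrow> real" where
  "flat m t = (if t > 0 then exp (- 1 / t) / t ^ m else 0)"

lemma flat_nonneg: "flat m t \<ge> 0" by (simp add: flat_def)

lemma flat_pos_iff: "flat m t > 0 \<longleftrightarrow> t > 0" by (simp add: flat_def)

text \<open>A single term of the exponential series bounds exp(1/t) from below. The quadratic bound
  makes the difference quotient at 0 tend to 0.\<close>

lemma flat_le_square:
  assumes "t > 0" shows "flat m t \<le> fact (m + 2) * t\<^sup>2"
proof -
  define C :: real where "C = fact (m + 2)"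
  have C: "C > 0" unfolding C_def by (rule fact_gt_zero)
  have "(\<Sum>i\<in>{m + 2}. inverse (fact i) *\<^sub>R (1 / t) ^ i) \<le> (\<Sum>i. inverse (fact i) *\<^sub>R (1 / t) ^ i)"
    by (rule sum_le_suminf[OF summable_exp_generic]) (use assms in auto)
  then have "inverse C * (1 / t) ^ (m + 2) \<le> exp (1 / t)" unfolding C_def by (simp only: exp_def) simp
  then have "1 \<le> C * t ^ (m + 2) * exp (1 / t)"
    unfolding power_one_over using C assms by (simp add: field_simps)
  then have "exp (- 1 / t) \<le> C * t ^ (m + 2)"
    using assms by (simp add: exp_minus field_simps)
  then show ?thesis unfolding C_def[symmetric] using assms by (simp add: flat_def field_simps power_add power2_eq_square)
qed

lemma has_derivative_flat:
  "(flat m has_real_derivative (- real m * flat (m + 1) t + flat (m + 2) t)) (at t)"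
proof (cases t "0::real" rule: linorder_cases)
  case less
  have "((\<lambda>t. 0) has_real_derivative 0) (at t)" by simp
  then have "(flat m has_real_derivative 0) (at t)"
    by (rule DERIV_cong_ev[THEN iffD1, rotated -1, OF _ refl _ refl])
       (use less in \<open>auto intro!: eventually_nhds_in_open[of "{..<0}", THEN eventually_mono] simp: flat_def\<close>)
  then show ?thesis using less by (simp add: flat_def)
next
  case equal
  have "((\<lambda>h. flat m h / h) \<longlongrightarrow> 0) (at 0)"
  proof (rule Lim_null_comparison)
    have "norm (flat m h / h) \<le> fact (m + 2) * \<bar>h\<bar>" for h
    proof (cases "h > 0")
      case True
      then show ?thesis using flat_le_square[OF True, of m] flat_nonneg[of m h]
        by (simp add: divide_le_eq power2_eq_square)
    next
      case False
      then have "norm (flat m h / h) = 0" by (simp add: flat_def)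
      then show ?thesis by (simp only: mult_nonneg_nonneg fact_ge_zero abs_ge_zero)
    qed
    then show "\<forall>\<^sub>F h in at 0. norm (flat m h / h) \<le> fact (m + 2) * \<bar>h\<bar>" by (intro always_eventually allI)
    show "((\<lambda>h::real. fact (m + 2) * \<bar>h\<bar>) \<longlongrightarrow> 0) (at 0)" by (auto intro!: tendsto_eq_intros)
  qed
  then have "(flat m has_real_derivative 0) (at 0)"
    by (simp add: DERIV_def flat_def[of m 0])
  then show ?thesis using equal by (simp add: flat_def)
next
  case greater
  have "((\<lambda>t. exp (- 1 / t) / t ^ m) has_real_derivative (- real m * flat (m + 1) t + flat (m + 2) t)) (at t)"
  proof -
    have "((\<lambda>t. exp (- 1 / t)) has_real_derivative exp (- 1 / t) * (1 / t\<^sup>2)) (at t)"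
      using greater by (auto intro!: derivative_eq_intros simp: power2_eq_square)
    from DERIV_mult[OF this DERIV_power[OF DERIV_inverse, of t m]]
    have "((\<lambda>t. exp (- 1 / t) * inverse t ^ m) has_real_derivative
       (exp (- 1 / t) * (1 / t\<^sup>2)) * inverse t ^ m + (real m * inverse t ^ (m - 1) * (- (inverse t ^ 2))) * exp (- 1 / t)) (at t)"
      using greater by (simp add: power2_eq_square ac_simps)
    also have "(exp (- 1 / t) * (1 / t\<^sup>2)) * inverse t ^ m + (real m * inverse t ^ (m - 1) * (- (inverse t ^ 2))) * exp (- 1 / t)
      = - real m * flat (m + 1) t + flat (m + 2) t"
      using greater by (cases m) (auto simp: flat_def power2_eq_square field_simps)
    finally show ?thesis by (simp add: power_inverse divide_inverse)
  qed
  then show ?thesis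
    by (rule DERIV_cong_ev[THEN iffD1, rotated -1, OF _ refl _ refl])
       (use greater in \<open>auto intro!: eventually_nhds_in_open[of "{0<..}", THEN eventually_mono] simp: flat_def\<close>)
qed

lemma smooth_on_flat: "smooth_on (flat m) UNIV"
proof -
  have "Ck_on k (flat m) UNIV" for k
  proof (induction k arbitrary: m)
    case 0
    have "isCont (flat m) t" for t using has_derivative_flat DERIV_isCont by blast
    then show ?case by (simp add: continuous_on_eq_continuous_at)
  next
    case (Suc k)
    show ?case
    proof (rule Ck_on_SucI[OF open_UNIV])
      fix t show "(flat m has_derivative (\<lambda>h. (- real m * flat (m + 1) t + flat (m + 2) t) * h)) (at t)"
        using has_derivative_flat unfolding has_field_derivative_def .
      fix h show "Ck_on k (\<lambda>t. (- real m * flat (m + 1) t + flat (m + 2) t) * h) UNIV"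
        by (intro Ck_on_mult Ck_on_add Ck_on_const Suc open_UNIV)
    qed
  qed
  then show ?thesis by (simp add: smooth_on_def)
qed

lemma smooth_on_inner_self: "smooth_on (\<lambda>w::'a::euclidean_space. w \<bullet> w) UNIV"
  unfolding smooth_on_def
  by (intro conjI allI open_UNIV Ck_on_bilinear[OF _ _ _ bounded_bilinear_inner] Ck_on_ident)

definition step :: "real \<Rightarrow> real \<Rightarrow> real \<Rightarrow> real" where
  "step b c t = flat 0 (c - t) / (flat 0 (c - t) + flat 0 (t - b))"

lemma step_props:
  assumes "b < c"
  shows "smooth_on (step b c) UNIV" "step b c t \<ge> 0" "t \<le> b \<Longrightarrow> step b c t = 1" "t \<ge> c \<Longrightarrow> step b c t = 0"
proof -
  have den: "flat 0 (c - t) + flat 0 (t - b) > 0" for t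
    using flat_nonneg[of 0 "c - t"] flat_nonneg[of 0 "t - b"] flat_pos_iff[of 0 "c - t"] flat_pos_iff[of 0 "t - b"] assms
    by linarith
  have "smooth_on (\<lambda>t::real. c - t) UNIV" "smooth_on (\<lambda>t::real. t - b) UNIV"
    using smooth_on_add[OF smooth_on_const smooth_on_minus[OF smooth_on_ident], of UNIV c]
      smooth_on_add[OF smooth_on_ident smooth_on_const, of UNIV "- b"] by simp_all
  then have s: "smooth_on (\<lambda>t. flat 0 (c - t)) UNIV" "smooth_on (\<lambda>t. flat 0 (t - b)) UNIV"
    using smooth_on_compose[OF _ smooth_on_flat] by auto
  show "smooth_on (step b c) UNIV"
    unfolding step_def[abs_def]
    by (rule smooth_on_divide[OF s(1) smooth_on_add[OF s]]) (use den less_irrefl in metis)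
  show "step b c t \<ge> 0" unfolding step_def by (intro divide_nonneg_nonneg add_nonneg_nonneg flat_nonneg)
  show "t \<le> b \<Longrightarrow> step b c t = 1" using den[of t] by (simp add: step_def flat_def)
  show "t \<ge> c \<Longrightarrow> step b c t = 0" by (simp add: step_def flat_def)
qed

text \<open>For a profile \<chi>(s) the Levi form is \<chi>''(s) times the squares of ds on
  \<open>v\<close> and \<open>Jc v\<close>, plus \<chi>'(s) times the Levi form of s. Here \<chi> is
  \<open>flat 0\<close>, with first derivative \<open>flat 2\<close> and second derivative
  \<open>flat 4\<close> minus twice \<open>flat 3\<close>.\<close>

lemma levi_flat_inner:
  fixes w v :: "complex^'n::finite" and \<kappa> a :: real
  defines "s \<equiv> \<lambda>w::complex^'n. \<kappa> * (w \<bullet> w) - \<kappa> * a"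
  shows "levi (\<lambda>w. flat 0 (s w)) w v v =
    (flat 4 (s w) - 2 * flat 3 (s w)) * ((2 * \<kappa> * (w \<bullet> v))\<^sup>2 + (2 * \<kappa> * (w \<bullet> Jc v))\<^sup>2)
    + flat 2 (s w) * (4 * \<kappa> * (v \<bullet> v))"
proof -
  have s: "(s has_derivative (\<lambda>u. 2 * \<kappa> * (w \<bullet> u))) (at w)" for w
    unfolding s_def by (auto intro!: derivative_eq_intros simp: inner_commute algebra_simps)
  have fl: "((\<lambda>w. flat m (s w)) has_derivative (\<lambda>u. (- real m * flat (m + 1) (s w) + flat (m + 2) (s w)) * (2 * \<kappa> * (w \<bullet> u)))) (at w)" for m w
    using diff_chain_at[OF s has_derivative_flat[unfolded has_field_derivative_def]] by (simp add: o_def)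
  have 1: "ddir (\<lambda>w. flat 0 (s w)) v = (\<lambda>w. flat 2 (s w) * (2 * \<kappa> * (w \<bullet> v)))" for v
    by (rule ext) (simp add: ddir_eq[OF fl] numeral_2_eq_2)
  have der: "((\<lambda>w. flat 2 (s w) * (2 * \<kappa> * (w \<bullet> v))) has_derivative
     (\<lambda>u. flat 2 (s w) * (2 * \<kappa> * (u \<bullet> v)) +
       (- real 2 * flat (2 + 1) (s w) + flat (2 + 2) (s w)) * (2 * \<kappa> * (w \<bullet> u)) * (2 * \<kappa> * (w \<bullet> v)))) (at w)" for v
    by (intro has_derivative_mult fl) (auto intro!: derivative_eq_intros)
  have 2: "ddir (ddir (\<lambda>w. flat 0 (s w)) v) u w = flat 2 (s w) * (2 * \<kappa> * (u \<bullet> v)) +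
       (- 2 * flat 3 (s w) + flat 4 (s w)) * (2 * \<kappa> * (w \<bullet> u)) * (2 * \<kappa> * (w \<bullet> v))" for v u
    unfolding 1 using ddir_eq[OF der[of v], of u] by simp
  have "Jc v \<bullet> Jc v = v \<bullet> v" using norm_Jc[of v] by (simp add: norm_eq_sqrt_inner)
  then show ?thesis unfolding levi_def 2 by (simp add: power2_eq_square algebra_simps)
qed

text \<open>A convex increasing function of \<open>w \<bullet> w\<close> is plurisubharmonic, so the
  profile \<open>flat 0\<close> can be switched on at \<open>a\<close> without loss. The factor
  \<open>step b c\<close> equals 1 below \<open>b\<close>, and the sign of the Levi form is given up
  only where this factor decreases.\<close>

lemma exists_plurisubharmonic_bump:
  fixes a b c :: real
  assumes "0 < a" "a < b" "b < c"
  shows "\<exists>\<psi> :: complex^'n::finite \<Rightarrow> real. smooth_on \<psi> UNIV \<and> (\<forall>w. \<psi> w \<ge> 0) \<and>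
    (\<forall>w. w \<bullet> w \<le> a \<or> w \<bullet> w \<ge> c \<longrightarrow> \<psi> w = 0) \<and>
    (\<forall>w v. w \<bullet> w < b \<longrightarrow> levi \<psi> w v v \<ge> 0) \<and>
    (\<forall>w. a < w \<bullet> w \<and> w \<bullet> w < b \<longrightarrow> \<psi> w > 0 \<and> (\<forall>v. v \<noteq> 0 \<longrightarrow> levi \<psi> w v v > 0))"
proof -
  \<comment> \<open>With this scale \<open>s\<close> stays at most 1/2 where
    \<open>w \<bullet> w < b\<close>, and for 0 < t \<le> 1/2 the second derivative exp(-1/t) (1 -
    2t) / t^4 of the profile is nonnegative.\<close>
  define \<kappa> where "\<kappa> = 1 / (2 * b)"
  have k: "\<kappa> > 0" using assms by (simp add: \<kappa>_def)
  define s where "s = (\<lambda>w::complex^'n. \<kappa> * (w \<bullet> w) - \<kappa> * a)"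
  define \<psi> where "\<psi> = (\<lambda>w. flat 0 (s w) * step b c (w \<bullet> w))"
  have s_le: "s w \<le> 0 \<longleftrightarrow> w \<bullet> w \<le> a" for w using k by (simp add: s_def)
  have s_half: "s w \<le> 1 / 2" if "w \<bullet> w < b" for w
  proof -
    have "\<kappa> * (w \<bullet> w) \<le> \<kappa> * b" using k that by simp
    also have "\<kappa> * b = 1 / 2" using assms by (simp add: \<kappa>_def)
    finally show ?thesis using k assms(1) by (simp add: s_def) (smt (verit) mult_pos_pos)
  qed
  have "smooth_on (\<lambda>w. \<kappa> * (w \<bullet> w) + - (\<kappa> * a)) (UNIV :: (complex^'n) set)"
    by (intro smooth_on_add smooth_on_mult smooth_on_const smooth_on_inner_self open_UNIV)
  then have ss: "smooth_on s UNIV" by (simp add: s_def)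
  have 1: "smooth_on \<psi> UNIV" unfolding \<psi>_def
    using smooth_on_compose[OF ss smooth_on_flat] smooth_on_compose[OF smooth_on_inner_self step_props(1)[OF assms(3)]]
    by (intro smooth_on_mult) auto
  have 2: "\<psi> w \<ge> 0" for w unfolding \<psi>_def by (intro mult_nonneg_nonneg flat_nonneg step_props(2) assms)
  have 3: "\<psi> w = 0" if "w \<bullet> w \<le> a \<or> w \<bullet> w \<ge> c" for w
    using that s_le[of w] step_props(4)[OF assms(3), of "w \<bullet> w"] by (auto simp: \<psi>_def flat_def)
  have eq: "\<psi> w = flat 0 (s w)" if "w \<bullet> w < b" for w
    using step_props(3)[OF assms(3), of "w \<bullet> w"] that by (simp add: \<psi>_def)
  have op: "open {w::complex^'n. w \<bullet> w < b}" by (intro open_Collect_less continuous_intros)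
  have lev: "levi \<psi> w v v =
    (flat 4 (s w) - 2 * flat 3 (s w)) * ((2 * \<kappa> * (w \<bullet> v))\<^sup>2 + (2 * \<kappa> * (w \<bullet> Jc v))\<^sup>2)
    + flat 2 (s w) * (4 * \<kappa> * (v \<bullet> v))" if "w \<bullet> w < b" for w v
  proof -
    have "levi \<psi> w v v = levi (\<lambda>w. flat 0 (s w)) w v v"
      by (rule levi_cong_open[OF op]) (use that eq in auto)
    then show ?thesis unfolding s_def levi_flat_inner .
  qed
  have conv: "flat 4 (s w) - 2 * flat 3 (s w) \<ge> 0" if "w \<bullet> w < b" for w
    using s_half[OF that] by (auto simp: flat_def field_simps eval_nat_numeral)
  have 4: "levi \<psi> w v v \<ge> flat 2 (s w) * (4 * \<kappa> * (v \<bullet> v))" if "w \<bullet> w < b" for w v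
    unfolding lev[OF that] using mult_nonneg_nonneg[OF conv[OF that], of "(2 * \<kappa> * (w \<bullet> v))\<^sup>2 + (2 * \<kappa> * (w \<bullet> Jc v))\<^sup>2"]
    by simp
  have 5: "levi \<psi> w v v \<ge> 0" if "w \<bullet> w < b" for w v
    by (rule order_trans[OF _ 4[OF that]]) (use k in \<open>intro mult_nonneg_nonneg flat_nonneg, auto\<close>)
  have 6: "\<psi> w > 0 \<and> (\<forall>v. v \<noteq> 0 \<longrightarrow> levi \<psi> w v v > 0)" if w: "a < w \<bullet> w" "w \<bullet> w < b" for w
  proof (intro conjI allI impI)
    have s: "s w > 0" using s_le[of w] w by linarith
    show "\<psi> w > 0" unfolding eq[OF w(2)] flat_pos_iff by (rule s)
    fix v :: "complex^'n" assume "v \<noteq> 0"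
    have "0 < flat 2 (s w) * (4 * \<kappa> * (v \<bullet> v))"
      by (intro mult_pos_pos) (use s k \<open>v \<noteq> 0\<close> flat_pos_iff in auto)
    then show "levi \<psi> w v v > 0" using 4[OF w(2), of v] by linarith
  qed
  show ?thesis using 1 2 3 5 6 by (intro exI[of _ \<psi>]) blast
qed

section \<open>An automorphic strictly plurisubharmonic function\<close>

lemma levi_scale:
  assumes "smooth_on F S" "w \<in> S" shows "levi F w (c *\<^sub>R u) (c *\<^sub>R u) = c * c * levi F w u u"
  using bilinear_lmul[OF bilinear_levi[OF assms], of c u "c *\<^sub>R u"]
    bilinear_rmul[OF bilinear_levi[OF assms], of u c u] by simp

text \<open>Smoothness is known for fixed vectors; joint continuity in point and vector follows by
  expanding the vector in \<open>Basis\<close>.\<close>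

lemma continuous_on_levi:
  assumes F: "smooth_on F S"
  shows "continuous_on (S \<times> UNIV) (\<lambda>p. levi F (fst p) (snd p) (snd p))"
proof -
  have eq: "levi F w u u = (\<Sum>b\<in>Basis. (u \<bullet> b) * (\<Sum>b'\<in>Basis. (u \<bullet> b') * levi F w b b'))" if w: "w \<in> S" for w u
  proof -
    have "levi F w u b = (\<Sum>b'\<in>Basis. (u \<bullet> b') * levi F w b b')" for b
      unfolding levi_sym[OF F w, of u b] by (rule linear_eq_sum_Basis[OF linear_levi[OF F w]])
    then show ?thesis using linear_eq_sum_Basis[OF linear_levi[OF F w], of u u] by simp
  qed
  have "continuous_on (S \<times> UNIV) (\<lambda>p. levi F (fst p) b b')" for b b'
    by (rule continuous_on_compose2[OF smooth_on_continuous[OF smooth_on_levi[OF F, of b b']]])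
       (auto intro: continuous_intros)
  then have "continuous_on (S \<times> UNIV) (\<lambda>p. \<Sum>b\<in>Basis. (snd p \<bullet> b) * (\<Sum>b'\<in>Basis. (snd p \<bullet> b') * levi F (fst p) b b'))"
    by (intro continuous_on_sum continuous_on_mult continuous_on_inner continuous_on_snd continuous_on_id continuous_on_const)
  then show ?thesis by (rule continuous_on_eq) (auto simp: eq)
qed

text \<open>By homogeneity unit vectors suffice, and over the compact \<open>K\<close> the ratio of
  the two Levi forms on them is bounded by some \<open>C\<close>. A factor of at least
  \<open>C + 1\<close> leaves a surplus of one copy of the positive form.\<close>

lemma levi_dominated:
  fixes f g :: "complex^'n::finite \<Rightarrow> real"
  assumes f: "smooth_on f S" and g: "smooth_on g S" and K: "compact K" "K \<subseteq> S"
    and pos: "\<And>w u. w \<in> K \<Longrightarrow> u \<noteq> 0 \<Longrightarrow> levi g w u u > 0"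
  shows "\<exists>T\<ge>1. \<forall>t\<ge>T. \<forall>w\<in>K. \<forall>u. u \<noteq> 0 \<longrightarrow> levi f w u u + t * levi g w u u > 0"
proof -
  let ?q = "\<lambda>p. levi f (fst p) (snd p) (snd p) / levi g (fst p) (snd p) (snd p)"
  have sub: "K \<times> sphere 0 1 \<subseteq> S \<times> UNIV" using K(2) by auto
  have "continuous_on (K \<times> sphere 0 1) ?q"
  proof (rule continuous_on_divide)
    show "continuous_on (K \<times> sphere 0 1) (\<lambda>p. levi f (fst p) (snd p) (snd p))"
      by (rule continuous_on_subset[OF continuous_on_levi[OF f] sub])
    show "continuous_on (K \<times> sphere 0 1) (\<lambda>p. levi g (fst p) (snd p) (snd p))"
      by (rule continuous_on_subset[OF continuous_on_levi[OF g] sub])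
    show "\<forall>p\<in>K \<times> sphere 0 1. levi g (fst p) (snd p) (snd p) \<noteq> 0"
    proof
      fix p :: "(complex^'n) \<times> (complex^'n)" assume "p \<in> K \<times> sphere 0 1"
      then have "fst p \<in> K" "snd p \<noteq> 0" by auto
      from pos[OF this] show "levi g (fst p) (snd p) (snd p) \<noteq> 0" by simp
    qed
  qed
  then have "compact (?q ` (K \<times> sphere 0 1))"
    by (rule compact_continuous_image) (intro compact_Times K compact_sphere)
  then obtain C where "\<forall>y\<in>?q ` (K \<times> sphere 0 1). norm y \<le> C"
    using compact_imp_bounded bounded_iff by blast
  then have C: "\<bar>?q p\<bar> \<le> C" if "p \<in> K \<times> sphere 0 1" for p
    using that unfolding real_norm_def ball_simps by (rule bspec)
  have "levi f w u u + t * levi g w u u > 0" if t: "t \<ge> max 1 (C + 1)" and w: "w \<in> K" and u: "u \<noteq> 0" for t w u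
  proof -
    define v where "v = (1 / norm u) *\<^sub>R u"
    have v: "v \<in> sphere 0 1" "v \<noteq> 0" using u by (auto simp: v_def)
    have wS: "w \<in> S" using w K(2) by auto
    have g0: "levi g w v v > 0" using pos w v by simp
    have "\<bar>levi f w v v / levi g w v v\<bar> \<le> C" using C[of "(w, v)"] w v by (simp del: abs_divide)
    then have "levi f w v v / levi g w v v \<ge> - C" by linarith
    then have "levi f w v v \<ge> - C * levi g w v v" using g0 by (simp add: le_divide_eq)
    moreover have "(C + 1) * levi g w v v \<le> t * levi g w v v" using t g0 by (intro mult_right_mono) auto
    ultimately have "levi f w v v + t * levi g w v v > 0" using g0 by (simp add: algebra_simps)
    then have "norm u * norm u * (levi f w v v + t * levi g w v v) > 0" using u by simp
    moreover have "u = norm u *\<^sub>R v" using u by (simp add: v_def)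
    then have "levi f w u u = norm u * norm u * levi f w v v" "levi g w u u = norm u * norm u * levi g w v v"
      using levi_scale[OF f wS, of "norm u" v] levi_scale[OF g wS, of "norm u" v] by simp_all
    ultimately show ?thesis by (simp add: algebra_simps)
  qed
  then have "\<forall>t\<ge>max 1 (C + 1). \<forall>w\<in>K. \<forall>u. u \<noteq> 0 \<longrightarrow> levi f w u u + t * levi g w u u > 0"
    by (intro allI impI ballI)
  then show ?thesis by (intro exI[of _ "max 1 (C + 1)"] conjI max.cobounded1)
qed

text \<open>The partners are distinct and lie outside \<open>B\<close>, so each possibly negative
  term is absorbed by its own partner and the remaining terms are nonnegative. When \<open>B\<close>
  is empty, \<open>i0\<close> provides strictness.\<close>

lemma sum_pos_by_pairing:
  fixes t :: "'i \<Rightarrow> real"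
  assumes F: "finite F" and B: "B \<subseteq> F" "f ` B \<subseteq> F - B" "inj_on f B"
    and nn: "\<And>i. i \<in> F - B \<Longrightarrow> t i \<ge> 0" and pair: "\<And>i. i \<in> B \<Longrightarrow> t i + t (f i) > 0"
    and i0: "i0 \<in> F" "i0 \<notin> B \<Longrightarrow> t i0 > 0"
  shows "sum t F > 0"
proof (cases "B = {}")
  case True
  then show ?thesis using i0 nn by (intro sum_pos2[OF F i0(1)]) auto
next
  case False
  have fB: "finite B" using F B(1) by (rule rev_finite_subset)
  have "sum t (f ` B) \<le> sum t (F - B)" by (rule sum_mono2) (use F B nn in auto)
  moreover have "sum t (f ` B) = (\<Sum>i\<in>B. t (f i))" using sum.reindex[OF B(3), of t] by simp
  moreover have "(\<Sum>i\<in>B. t i + t (f i)) > 0" by (rule sum_pos[OF fB False pair])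
  moreover have "sum t F = sum t (F - B) + sum t B" by (rule sum.subset_diff[OF B(1) F])
  ultimately show ?thesis by (simp add: sum.distrib)
qed

context hopf_covering
begin

section \<open>The weighted series over the deck group\<close>

lemma deck_smooth: "g \<in> deck \<Longrightarrow> smooth_on g W"
  by (rule holomorphic_map_on_imp_smooth_on[OF deck_holomorphic])

lemma deck_image: "g \<in> deck \<Longrightarrow> g ` W \<subseteq> W"
  by (rule image_subsetI, erule deckD(2))

lemma deck_derivative_nonzero:
  assumes h: "h \<in> deck" and z: "z \<in> W" and v: "v \<noteq> 0"
  shows "ddir h v z \<noteq> 0"
proof
  assume 0: "ddir h v z = 0"
  obtain k where k: "k \<in> deck" "\<And>z. k (h z) = z" using deck_inverse[OF h] by blast
  have "ddir (\<lambda>x. k (h x)) v z = ddir k (ddir h v z) (h z)"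
    by (rule ddir_compose[OF deck_smooth[OF h] deck_smooth[OF k(1)] deck_image[OF h] z])
  also have "\<dots> = 0"
    unfolding 0 by (rule linear_0[OF smooth_on_linear[OF deck_smooth[OF k(1)] deckD(2)[OF h z]]])
  finally show False using v unfolding k(2) by simp
qed

lemma levi_deck:
  assumes h: "h \<in> deck" and F: "smooth_on F W" and z: "z \<in> W"
  shows "levi (\<lambda>x. F (h x)) z v v = levi F (h z) (ddir h v z) (ddir h v z)"
  by (rule levi_compose[OF deck_holomorphic[OF h] F deck_image[OF h] z])

definition weight :: "complex^'n \<Rightarrow> real \<Rightarrow> (complex^'n \<Rightarrow> complex^'n) \<Rightarrow> real" where
  "weight x T g = T powr real_of_int (charge x g)"

lemma weight_pos: "T > 0 \<Longrightarrow> weight x T g > 0"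
  by (simp add: weight_def)

lemma weight_compose:
  "g \<in> deck \<Longrightarrow> h \<in> deck \<Longrightarrow> x \<in> W \<Longrightarrow> weight x T (g \<circ> h) = weight x T g * weight x T h"
  unfolding weight_def by (subst charge_compose) (simp_all add: powr_add)

text \<open>Summation runs over the nonvanishing terms, which turns a series over an infinite group
  into a finite sum when \<psi> has compact support in \<open>W\<close>. By
  \<open>deck_series_eq\<close> any larger finite index set gives the same value.\<close>

definition deck_series :: "complex^'n \<Rightarrow> real \<Rightarrow> (complex^'n \<Rightarrow> real) \<Rightarrow> complex^'n \<Rightarrow> real" where
  "deck_series x T \<psi> z = (\<Sum>h | h \<in> deck \<and> \<psi> (h z) \<noteq> 0. weight x T h * \<psi> (h z))"

lemma deck_series_eq:
  assumes "finite F" "F \<subseteq> deck" "\<And>h. h \<in> deck \<Longrightarrow> \<psi> (h z) \<noteq> 0 \<Longrightarrow> h \<in> F"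
  shows "deck_series x T \<psi> z = (\<Sum>h\<in>F. weight x T h * \<psi> (h z))"
  unfolding deck_series_def
proof (rule sum.mono_neutral_left[OF assms(1)])
  show "{h. h \<in> deck \<and> \<psi> (h z) \<noteq> 0} \<subseteq> F" using assms(3) by blast
  show "\<forall>h\<in>F - {h. h \<in> deck \<and> \<psi> (h z) \<noteq> 0}. weight x T h * \<psi> (h z) = 0"
  proof
    fix h assume h: "h \<in> F - {h. h \<in> deck \<and> \<psi> (h z) \<noteq> 0}"
    have "h \<in> deck" by (rule subsetD[OF assms(2)]) (use h in simp)
    then show "weight x T h * \<psi> (h z) = 0" using h by simp
  qed
qed

text \<open>Reindexing by right composition with \<open>g\<close> permutes the terms, and
  multiplicativity of the weight takes out the constant factor of \<open>g\<close>.\<close>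

lemma deck_series_deck:
  assumes g: "g \<in> deck" and x: "x \<in> W" and T: "T > 0"
  shows "deck_series x T \<psi> (g z) = inverse (weight x T g) * deck_series x T \<psi> z"
proof -
  let ?F = "\<lambda>z. {h. h \<in> deck \<and> \<psi> (h z) \<noteq> 0}"
  have img: "(\<lambda>h. h \<circ> g) ` ?F (g z) = ?F z"
  proof (intro equalityI subsetI)
    fix k assume "k \<in> (\<lambda>h. h \<circ> g) ` ?F (g z)"
    then obtain h where "h \<in> deck" "\<psi> (h (g z)) \<noteq> 0" "k = h \<circ> g" by auto
    then show "k \<in> ?F z" using deck_compose[of h g] g by simp
  next
    fix k assume k: "k \<in> ?F z"
    obtain l where l: "l \<in> deck" "\<And>z. l (g z) = z" using deck_inverse[OF g] by blast
    have "k = (k \<circ> l) \<circ> g" by (simp add: fun_eq_iff l(2))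
    moreover have "k \<circ> l \<in> ?F (g z)" using k deck_compose[of k l] l by simp
    ultimately show "k \<in> (\<lambda>h. h \<circ> g) ` ?F (g z)" by (rule image_eqI)
  qed
  have "deck_series x T \<psi> z = (\<Sum>h\<in>?F (g z). weight x T (h \<circ> g) * \<psi> ((h \<circ> g) z))"
    unfolding deck_series_def img[symmetric] by (subst sum.reindex[OF inj_on_compose_deck(2)[OF g]]) (simp add: o_def)
  also have "\<dots> = (\<Sum>h\<in>?F (g z). weight x T g * (weight x T h * \<psi> (h (g z))))"
    by (rule sum.cong[OF refl]) (simp add: weight_compose[OF _ g x])
  also have "\<dots> = weight x T g * deck_series x T \<psi> (g z)"
    unfolding deck_series_def by (rule sum_distrib_left[symmetric])
  finally show ?thesis using weight_pos[OF T, of x g] by simp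
qed

text \<open>Proper discontinuity is applied to \<open>Q\<close> together with a closed ball around
  \<open>z\<close>. The same finite index set then serves on a whole neighbourhood, so the series
  can be differentiated term by term.\<close>

lemma deck_series_locally_finite:
  assumes Q: "compact Q" "Q \<subseteq> W" and z: "z \<in> W"
  shows "\<exists>N F. open N \<and> z \<in> N \<and> N \<subseteq> W \<and> finite F \<and> F \<subseteq> deck \<and> (\<forall>y\<in>N. \<forall>h\<in>deck. h y \<in> Q \<longrightarrow> h \<in> F)"
proof -
  define r where "r = norm z / 2"
  have r: "r > 0" using z by (simp add: r_def)
  have cb: "cball z r \<subseteq> W" using z by (auto simp: r_def dist_norm)
  define F where "F = {h\<in>deck. \<exists>y\<in>cball z r \<union> Q. h y \<in> cball z r \<union> Q}"
  have "finite F" unfolding F_def by (rule deck_properly_discontinuous) (use Q cb in auto)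
  moreover have "h \<in> F" if "y \<in> ball z r" "h \<in> deck" "h y \<in> Q" for y h
    using that unfolding F_def by (auto intro!: bexI[of _ y])
  moreover have "F \<subseteq> deck" by (auto simp: F_def)
  moreover have "ball z r \<subseteq> W" using cb ball_subset_cball by blast
  ultimately show ?thesis using r by (intro exI[of _ "ball z r"] exI[of _ F]) auto
qed

text \<open>Where the cutoff destroys plurisubharmonicity of the term of \<open>h\<close>, the term of \<open>\<gamma> \<circ> h\<close> is strictly
  plurisubharmonic and outweighs it.\<close>

lemma automorphic_potential:
  "\<exists>\<Phi> c. smooth_on \<Phi> W \<and> (\<forall>z\<in>W. \<Phi> z > 0) \<and> (\<forall>z\<in>W. \<forall>v. v \<noteq> 0 \<longrightarrow> levi \<Phi> z v v > 0) \<and>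
    (\<forall>g\<in>deck. c g > 0 \<and> (\<forall>z\<in>W. \<Phi> (g z) = c g * \<Phi> z))"
proof -
  obtain m where m: "m \<ge> 1" "\<forall>j\<ge>m. \<forall>z\<in>W. \<exists>g\<in>deck. g z \<in> shell j" using cocompact by (elim exE conjE)
  then have cover: "\<exists>g\<in>deck. g z \<in> shell m" if "z \<in> W" for z using that by simp
  \<comment> \<open>The shell must contain all points of norm between \<open>m\<close> and
    \<open>m + 1\<close>, where the cutoff will act, and \<open>j\<close> must exceed
    \<open>CARD('n)\<close> for \<open>small_deck_unit_ball\<close>.\<close>
  obtain j where j: "j \<ge> m + 1 + real CARD('n)" "\<exists>\<gamma>\<in>deck. \<forall>z\<in>shell j. norm (\<gamma> z) < 1 / j"
    using exists_small_deck[of "m + 1 + real CARD('n)"] by (elim exE conjE)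
  from j(2) obtain \<gamma> where g: "\<gamma> \<in> deck" and small: "\<And>z. z \<in> shell j \<Longrightarrow> norm (\<gamma> z) < 1 / j" by auto
  have j2: "j \<ge> 2" "j > real CARD('n)" "j \<ge> m + 1" using j(1) m(1) by auto
  define x :: "complex^'n" where "x = axis undefined 1"
  have x: "x \<in> W" "norm x = 1" by (auto simp: x_def axis_eq_0_iff norm_axis_1)
  have charge: "charge x \<gamma> \<ge> 1"
    using charge_pos[OF g _ x] small_deck_unit_ball[OF g j2(1,2) small] by fastforce
  define B where "B = {w::complex^'n. m \<le> norm w \<and> norm w \<le> m + 1}"
  have "B = cball 0 (m + 1) - ball 0 m" by (auto simp: B_def)
  then have B: "compact B" using compact_diff[of "cball (0::complex^'n) (m + 1)" "ball 0 m"] by simp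
  have BW: "B \<subseteq> W" using m(1) by (auto simp: B_def)
  have Bsmall: "norm (\<gamma> w) < m" if "w \<in> B" for w
  proof -
    have "1 / j \<le> 1" using j2 by simp
    then have "1 / j \<le> norm w" using that m(1) unfolding B_def mem_Collect_eq by linarith
    then have "w \<in> shell j" using that j2(3) m(1) by (simp add: B_def shell_def)
    then have "norm (\<gamma> w) < 1 / j" by (rule small)
    then show ?thesis using \<open>1 / j \<le> 1\<close> m(1) by linarith
  qed
  \<comment> \<open>The image of \<open>B\<close> is compact and avoids 0. The inner edge of the
    bump has to be placed below this image.\<close>
  have "\<exists>\<epsilon>>0. \<forall>w\<in>B. norm (\<gamma> w) > \<epsilon>"
  proof -
    have "open (- \<gamma> ` B)" "0 \<in> - \<gamma> ` B"
      using deck_compact_image[OF g B BW] by (auto intro!: open_Compl compact_imp_closed)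
    then obtain e where e: "e > 0" "ball 0 e \<subseteq> - \<gamma> ` B" by (rule openE)
    have "norm (\<gamma> w) > e / 2" if "w \<in> B" for w
    proof (rule ccontr)
      assume "\<not> ?thesis"
      then have "\<gamma> w \<in> ball 0 e" using e(1) by simp
      then have "\<gamma> w \<in> - \<gamma> ` B" by (rule subsetD[OF e(2)])
      then show False using that by simp
    qed
    then show ?thesis using e(1) by (intro exI[of _ "e / 2"]) simp
  qed
  then obtain \<epsilon> where eps: "\<epsilon> > 0" "\<And>w. w \<in> B \<Longrightarrow> norm (\<gamma> w) > \<epsilon>" by auto
  \<comment> \<open>The inner radius lies below all norms on the image of \<open>B\<close> under
    \<gamma>, and below \<open>1 / m\<close>. So both that image and \<open>shell m\<close> fall
    into the region where \<psi> is strictly plurisubharmonic.\<close>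
  define a where "a = (min \<epsilon> (1 / (m + 1)))\<^sup>2"
  have mn: "min \<epsilon> (1 / (m + 1)) > 0" using eps(1) m(1) by simp
  have a0: "a > 0" unfolding a_def using mn by (rule zero_less_power)
  have a_le: "a < w \<bullet> w" if "norm w > min \<epsilon> (1 / (m + 1))" for w :: "complex^'n"
    using power_strict_mono[OF that less_imp_le[OF mn], of 2] unfolding a_def by (simp add: power2_norm_eq_inner)
  have am: "a < m\<^sup>2"
  proof -
    have "1 / (m + 1) < 1" using m(1) by simp
    then have "min \<epsilon> (1 / (m + 1)) < m" using m(1) by linarith
    then show ?thesis unfolding a_def using less_imp_le[OF mn] by (rule power_strict_mono) simp
  qed
  \<comment> \<open>Any value strictly between the squares of \<open>m\<close> and
    \<open>m + 1\<close> serves: \<psi> is plurisubharmonic up to norm \<open>m\<close> inclusive,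
    and the cutoff acts only inside \<open>B\<close>.\<close>
  define b where "b = (m + 1 / 2)\<^sup>2"
  have mb: "m\<^sup>2 < b" "b < (m + 1)\<^sup>2" unfolding b_def using m(1) by (auto intro!: power_strict_mono)
  obtain \<psi> :: "complex^'n \<Rightarrow> real" where psi0: "smooth_on \<psi> UNIV \<and> (\<forall>w. \<psi> w \<ge> 0) \<and>
    (\<forall>w. w \<bullet> w \<le> a \<or> w \<bullet> w \<ge> (m + 1)\<^sup>2 \<longrightarrow> \<psi> w = 0) \<and>
    (\<forall>w v. w \<bullet> w < b \<longrightarrow> levi \<psi> w v v \<ge> 0) \<and>
    (\<forall>w. a < w \<bullet> w \<and> w \<bullet> w < b \<longrightarrow> \<psi> w > 0 \<and> (\<forall>v. v \<noteq> 0 \<longrightarrow> levi \<psi> w v v > 0))"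
    using exists_plurisubharmonic_bump[OF a0 less_trans[OF am mb(1)] mb(2)] by (rule exE)
  then have psi: "smooth_on \<psi> UNIV" "\<And>w. \<psi> w \<ge> 0"
    "\<And>w. w \<bullet> w \<le> a \<or> w \<bullet> w \<ge> (m + 1)\<^sup>2 \<Longrightarrow> \<psi> w = 0"
    "\<And>w v. w \<bullet> w < b \<Longrightarrow> levi \<psi> w v v \<ge> 0"
    "\<And>w. a < w \<bullet> w \<Longrightarrow> w \<bullet> w < b \<Longrightarrow> \<psi> w > 0"
    "\<And>w v. a < w \<bullet> w \<Longrightarrow> w \<bullet> w < b \<Longrightarrow> v \<noteq> 0 \<Longrightarrow> levi \<psi> w v v > 0"
    by (simp_all, blast)
  have psiW: "smooth_on \<psi> W" by (rule smooth_on_subset[OF psi(1)]) auto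
  have psig: "smooth_on (\<lambda>w. \<psi> (\<gamma> w)) W" by (rule smooth_on_compose[OF deck_smooth[OF g] psi(1)]) auto
  have norm_b: "w \<bullet> w < b" if "norm w \<le> m" for w :: "complex^'n"
  proof -
    have "w \<bullet> w \<le> m\<^sup>2" using that by (simp add: power2_norm_eq_inner[symmetric] power_mono)
    then show ?thesis using mb by linarith
  qed
  have "levi (\<lambda>w. \<psi> (\<gamma> w)) w u u > 0" if w: "w \<in> B" and u: "u \<noteq> 0" for w u
  proof -
    have wW: "w \<in> W" using w BW by blast
    have "a < \<gamma> w \<bullet> \<gamma> w" by (rule a_le) (use eps(2)[OF w] in simp)
    then show ?thesis
      unfolding levi_deck[OF g psiW wW]
      using norm_b[of "\<gamma> w"] Bsmall[OF w] by (intro psi(6) deck_derivative_nonzero[OF g wW u]) auto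
  qed
  from levi_dominated[OF psiW psig B BW this]
  obtain T where T: "T \<ge> 1" "\<And>t w u. t \<ge> T \<Longrightarrow> w \<in> B \<Longrightarrow> u \<noteq> 0 \<Longrightarrow> levi \<psi> w u u + t * levi (\<lambda>w. \<psi> (\<gamma> w)) w u u > 0"
    by auto
  have T0: "T > 0" using T(1) by simp
  have wg: "weight x T \<gamma> \<ge> T"
    unfolding weight_def using T(1) charge powr_mono[of 1 "real_of_int (charge x \<gamma>)" T] by simp
  define \<Phi> where "\<Phi> = deck_series x T \<psi>"
  define Q where "Q = {w::complex^'n. a \<le> w \<bullet> w \<and> w \<bullet> w \<le> (m + 1)\<^sup>2}"
  have "closed Q" unfolding Q_def by (intro closed_Collect_conj closed_Collect_le continuous_intros)
  moreover have "Q \<subseteq> cball 0 (m + 1)"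
  proof
    fix w assume "w \<in> Q"
    then have "(norm w)\<^sup>2 \<le> (m + 1)\<^sup>2" by (simp add: Q_def power2_norm_eq_inner)
    then show "w \<in> cball 0 (m + 1)" using m(1) power2_le_imp_le by force
  qed
  ultimately have Q: "compact Q" by (meson bounded_cball bounded_subset compact_eq_bounded_closed)
  have QW: "Q \<subseteq> W" using a0 by (auto simp: Q_def)
  have psiQ: "w \<in> Q" if "\<psi> w \<noteq> 0" for w using psi(3)[of w] that by (force simp: Q_def)
  have loc: "\<exists>N F. open N \<and> z \<in> N \<and> N \<subseteq> W \<and> finite F \<and> F \<subseteq> deck \<and>
      (\<forall>y\<in>N. \<forall>h\<in>deck. h y \<in> Q \<longrightarrow> h \<in> F)" if "z \<in> W" for z
    by (rule deck_series_locally_finite[OF Q QW that])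
  have term_smooth: "smooth_on (\<lambda>z. \<psi> (h z)) N" if "h \<in> deck" "open N" "N \<subseteq> W" for h N
    by (rule smooth_on_subset[OF smooth_on_compose[OF deck_smooth[OF that(1)] psi(1)] that(3,2)]) simp
  have Phi_eq: "\<Phi> y = (\<Sum>h\<in>F. weight x T h * \<psi> (h y))"
    if "finite F" "F \<subseteq> deck" "\<forall>h\<in>deck. h y \<in> Q \<longrightarrow> h \<in> F" for F y
    unfolding \<Phi>_def by (rule deck_series_eq[OF that(1,2)]) (use that(3) psiQ in blast)
  have smooth: "smooth_on \<Phi> W"
  proof (rule smooth_on_locally)
    fix z assume "z \<in> W"
    from loc[OF this] obtain N F where NF: "open N" "z \<in> N" "N \<subseteq> W" "finite F" "F \<subseteq> deck"
      "\<forall>y\<in>N. \<forall>h\<in>deck. h y \<in> Q \<longrightarrow> h \<in> F" by auto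
    have "smooth_on (\<lambda>y. \<Sum>h\<in>F. weight x T h * \<psi> (h y)) N"
      by (rule smooth_on_sum[OF NF(1)], rule smooth_on_mult[OF smooth_on_const[OF NF(1)]],
          rule term_smooth[OF _ NF(1,3)]) (use NF(5) in blast)
    then have "smooth_on \<Phi> N"
      using smooth_on_cong[of N \<Phi> "\<lambda>y. \<Sum>h\<in>F. weight x T h * \<psi> (h y)"] Phi_eq[OF NF(4,5)] NF(6) by simp
    then show "\<exists>N. open N \<and> z \<in> N \<and> N \<subseteq> W \<and> smooth_on \<Phi> N" using NF by (intro exI[of _ N]) simp
  qed auto
  have main: "\<Phi> z > 0 \<and> (\<forall>v. v \<noteq> 0 \<longrightarrow> levi \<Phi> z v v > 0)" if z: "z \<in> W" for z
  proof -
    obtain N F where NF: "open N" "z \<in> N" "N \<subseteq> W" "finite F" "F \<subseteq> deck"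
      "\<forall>y\<in>N. \<forall>h\<in>deck. h y \<in> Q \<longrightarrow> h \<in> F" using loc[OF z] by auto
    \<comment> \<open>The partner of a bad index \<open>h\<close> is \<gamma> o h, which must occur
      among the summands even if its own term was not recorded in \<open>F\<close>.\<close>
    define F' where "F' = F \<union> (\<lambda>h. \<gamma> \<circ> h) ` F"
    have F': "finite F'" "F' \<subseteq> deck" using NF(4,5) deck_compose[OF g] by (auto simp: F'_def)
    have F'Q: "\<forall>h\<in>deck. h y \<in> Q \<longrightarrow> h \<in> F'" if "y \<in> N" for y using NF(6) that by (auto simp: F'_def)
    \<comment> \<open>By cocompactness some orbit point of \<open>z\<close> lies in
      \<open>shell m\<close>. Its term is positive and strictly plurisubharmonic; it yields
      positivity of \<Phi> and settles the case without bad indices.\<close>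
    obtain h0 where h0: "h0 \<in> deck" "h0 z \<in> shell m" using cover[OF z] by blast
    have h0ab: "a < h0 z \<bullet> h0 z" "h0 z \<bullet> h0 z < b"
    proof -
      have "1 / (m + 1) < 1 / m" using m(1) by (intro divide_strict_left_mono) auto
      also have "1 / m \<le> norm (h0 z)" using h0(2) by (simp add: shell_def)
      finally show "a < h0 z \<bullet> h0 z" by (intro a_le) simp
      show "h0 z \<bullet> h0 z < b" by (rule norm_b) (use h0(2) in \<open>simp add: shell_def\<close>)
    qed
    have h0F: "h0 \<in> F'" using F'Q[OF NF(2)] h0(1) h0ab mb(2) by (force simp: Q_def)
    have "\<Phi> z = (\<Sum>h\<in>F'. weight x T h * \<psi> (h z))" by (rule Phi_eq[OF F' F'Q[OF NF(2)]])
    also have "\<dots> > 0"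
      by (rule sum_pos2[OF F'(1) h0F])
         (intro mult_pos_pos mult_nonneg_nonneg psi(2,5) h0ab weight_pos[OF T0] less_imp_le[OF weight_pos[OF T0]])+
    finally have pos: "\<Phi> z > 0" .
    moreover have "levi \<Phi> z v v > 0" if v: "v \<noteq> 0" for v
    proof -
      define t where "t = (\<lambda>h. weight x T h * levi (\<lambda>z. \<psi> (h z)) z v v)"
      have "levi \<Phi> z v v = levi (\<lambda>y. \<Sum>h\<in>F'. weight x T h * \<psi> (h y)) z v v"
        by (rule levi_cong_open[OF NF(1,2)]) (rule Phi_eq[OF F' F'Q])
      also have "\<dots> = sum t F'"
        unfolding t_def by (rule levi_sum[OF NF(1) _ NF(2)], rule term_smooth[OF _ NF(1,3)]) (use F'(2) in blast)
      also have "\<dots> > 0"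
      proof (rule sum_pos_by_pairing[OF F'(1)])
        let ?B = "{h\<in>F'. h z \<in> B}"
        show "?B \<subseteq> F'" by auto
        have BF: "h \<in> F" if "h \<in> ?B" for h
        proof -
          have "h \<in> deck" using that F'(2) by auto
          moreover have "h z \<in> Q"
          proof -
            have n: "m \<le> norm (h z)" "norm (h z) \<le> m + 1" using that by (auto simp: B_def)
            have "m\<^sup>2 \<le> (norm (h z))\<^sup>2" "(norm (h z))\<^sup>2 \<le> (m + 1)\<^sup>2"
              using n m(1) by (auto intro!: power_mono)
            then show ?thesis using am by (simp add: Q_def power2_norm_eq_inner)
          qed
          ultimately show ?thesis using NF(2,6) by blast
        qed
        show "(\<lambda>h. \<gamma> \<circ> h) ` ?B \<subseteq> F' - ?B"
        proof
          fix k assume "k \<in> (\<lambda>h. \<gamma> \<circ> h) ` ?B"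
          then obtain h where h: "h \<in> ?B" "k = \<gamma> \<circ> h" by auto
          have "k \<in> F'" using BF[OF h(1)] h(2) by (auto simp: F'_def)
          moreover have "k z \<notin> B" using Bsmall[of "h z"] h by (auto simp: B_def)
          ultimately show "k \<in> F' - ?B" by simp
        qed
        show "inj_on (\<lambda>h. \<gamma> \<circ> h) ?B" by (rule inj_on_compose_deck(1)[OF g])
        show "h0 \<in> F'" by (rule h0F)
        show "t h0 > 0"
          unfolding t_def levi_deck[OF h0(1) psiW z]
          by (intro mult_pos_pos weight_pos[OF T0] psi(6) h0ab deck_derivative_nonzero[OF h0(1) z v])
        fix h
        show "t h \<ge> 0" if h: "h \<in> F' - ?B"
        proof -
          have hd: "h \<in> deck" using h F'(2) by auto
          have "levi \<psi> (h z) u u \<ge> 0" for u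
          proof (cases "norm (h z) \<le> m")
            case True
            then show ?thesis by (intro psi(4) norm_b)
          next
            case False
            then have far: "norm (h z) > m + 1" using h by (auto simp: B_def)
            \<comment> \<open>Second derivatives vanish because \<psi> is zero on a whole
              neighbourhood of \<open>h z\<close>.\<close>
            have "open {w::complex^'n. norm w > m + 1}" by (intro open_Collect_less continuous_intros)
            moreover have "\<psi> w = 0" if "w \<in> {w. norm w > m + 1}" for w
            proof (rule psi(3))
              have "(m + 1)\<^sup>2 \<le> (norm w)\<^sup>2" using that m(1) by (intro power_mono) auto
              then show "w \<bullet> w \<le> a \<or> (m + 1)\<^sup>2 \<le> w \<bullet> w" by (simp add: power2_norm_eq_inner)
            qed
            ultimately have "levi \<psi> (h z) u u = levi (\<lambda>w. 0) (h z) u u"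
              using far by (intro levi_cong_open[of "{w. norm w > m + 1}"]) auto
            then show ?thesis by (simp add: levi_def)
          qed
          then show ?thesis
            unfolding t_def levi_deck[OF hd psiW z] by (intro mult_nonneg_nonneg less_imp_le[OF weight_pos[OF T0]])
        qed
        show "t h + t (\<gamma> \<circ> h) > 0" if h: "h \<in> ?B"
        proof -
          have hd: "h \<in> deck" and hB: "h z \<in> B" using h F'(2) by auto
          \<comment> \<open>Pulled back by \<open>h\<close>, both terms are Levi forms at the same
            point \<open>h z\<close> and vector \<open>u\<close>, with common factor
            \<open>weight x T h\<close>. What remains is the inequality on \<open>B\<close> that
            determined \<open>T\<close>, with multiplier
            \<open>weight x T \<gamma> \<ge> T\<close>.\<close>
          define u where "u = ddir h v z"
          have u: "u \<noteq> 0" unfolding u_def by (rule deck_derivative_nonzero[OF hd z v])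
          have "t h = weight x T h * levi \<psi> (h z) u u"
            unfolding t_def u_def levi_deck[OF hd psiW z] ..
          moreover have "t (\<gamma> \<circ> h) = weight x T h * (weight x T \<gamma> * levi (\<lambda>w. \<psi> (\<gamma> w)) (h z) u u)"
            unfolding t_def u_def weight_compose[OF g hd x(1)] o_apply levi_deck[OF hd psig z] by simp
          moreover have "weight x T h * (levi \<psi> (h z) u u + weight x T \<gamma> * levi (\<lambda>w. \<psi> (\<gamma> w)) (h z) u u) > 0"
            by (intro mult_pos_pos weight_pos[OF T0] T(2) wg hB u)
          ultimately show ?thesis by (simp add: distrib_left)
        qed
      qed
      finally show ?thesis .
    qed
    ultimately show ?thesis by blast
  qed
  have "\<Phi> (g z) = inverse (weight x T g) * \<Phi> z" if "g \<in> deck" for g z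
    unfolding \<Phi>_def by (rule deck_series_deck[OF that x(1) T0])
  then show ?thesis using smooth main weight_pos[OF T0, of x]
    by (intro exI[of _ \<Phi>] exI[of _ "\<lambda>g. inverse (weight x T g)"]) simp
qed

end

section \<open>Descent to the quotient\<close>

locale hopf_potential = hopf_covering M A p e
  for M :: "'a::topological_space set" and A :: "('a, 'n::finite) chart set"
    and p :: "complex^'n \<Rightarrow> 'a" and e :: "'a \<Rightarrow> 'e::real_normed_vector" +
  fixes \<Phi> :: "complex^'n \<Rightarrow> real" and factor :: "(complex^'n \<Rightarrow> complex^'n) \<Rightarrow> real"
  assumes smooth_Phi: "smooth_on \<Phi> (- {0})"
    and Phi_pos: "\<And>z. z \<in> - {0} \<Longrightarrow> \<Phi> z > 0"
    and levi_Phi_pos: "\<And>z v. z \<in> - {0} \<Longrightarrow> v \<noteq> 0 \<Longrightarrow> levi \<Phi> z v v > 0"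
    and factor_pos: "\<And>g. g \<in> deck \<Longrightarrow> factor g > 0"
    and Phi_deck: "\<And>g z. g \<in> deck \<Longrightarrow> z \<in> - {0} \<Longrightarrow> \<Phi> (g z) = factor g * \<Phi> z"
begin

text \<open>A local holomorphic section of the covering, expressed in the coordinates of
  \<open>c\<close>.\<close>

definition section_on :: "('a, 'n) chart \<Rightarrow> (complex^'n \<Rightarrow> complex^'n) \<Rightarrow> (complex^'n) set \<Rightarrow> bool" where
  "section_on c \<sigma> N \<longleftrightarrow> open N \<and> N \<subseteq> chart_image c \<and> holomorphic_map_on \<sigma> N \<and>
     (\<forall>y\<in>N. \<sigma> y \<in> W \<and> p (\<sigma> y) \<in> fst c \<and> snd c (p (\<sigma> y)) = y)"

lemma section_onD:
  assumes "section_on c \<sigma> N"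
  shows "open N" "N \<subseteq> chart_image c" "holomorphic_map_on \<sigma> N"
    "y \<in> N \<Longrightarrow> \<sigma> y \<in> W" "y \<in> N \<Longrightarrow> p (\<sigma> y) \<in> fst c" "y \<in> N \<Longrightarrow> snd c (p (\<sigma> y)) = y"
  using assms by (simp_all add: section_on_def)

lemma chart_inj:
  assumes "c \<in> A" "x \<in> fst c" "y \<in> fst c" "snd c x = snd c y" shows "x = y"
proof -
  have "is_chart M c" using manifold assms(1) by (simp add: complex_manifold_def)
  then obtain \<psi> where "homeomorphism (fst c) (chart_image c) (snd c) \<psi>" by (auto simp: is_chart_def)
  then have "\<forall>x\<in>fst c. \<psi> (snd c x) = x" by (simp add: homeomorphism_def)
  from bspec[OF this assms(2)] bspec[OF this assms(3)]
  have x: "\<psi> (snd c x) = x" and y: "\<psi> (snd c y) = y" .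
  have "\<psi> (snd c x) = \<psi> (snd c y)" by (rule arg_cong[OF assms(4)])
  then show ?thesis unfolding x y .
qed

lemma section_image:
  assumes "section_on c \<sigma> N" shows "\<sigma> ` N \<subseteq> W"
  by (rule image_subsetI) (rule section_onD(4)[OF assms])

lemma chart_sub:
  assumes "c \<in> A" shows "fst c \<subseteq> M"
proof -
  have "\<Union>(fst ` A) = M" using manifold by (simp add: complex_manifold_def)
  then show ?thesis using assms by blast
qed

lemma exists_section:
  assumes c: "c \<in> A" and z: "z \<in> chart_image c"
  shows "\<exists>\<sigma> N. z \<in> N \<and> section_on c \<sigma> N"
proof -
  obtain x where x: "x \<in> fst c" "snd c x = z" using z by (auto simp: chart_image_def)
  have "x \<in> p ` W" unfolding p_image using chart_sub[OF c] x(1) by blast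
  then obtain w where w: "w \<in> W" "p w = x" by blast
  obtain V k where V: "open V" "w \<in> V" "V \<subseteq> W" "p ` V \<subseteq> fst c"
    "holomorphic_map_on k ((snd c \<circ> p) ` V)" "\<forall>v\<in>V. k (snd c (p v)) = v"
    using local_chart[OF c w(1), unfolded w(2), OF x(1)] by (elim exE conjE) (rule that)
  have "section_on c k ((snd c \<circ> p) ` V)"
    unfolding section_on_def
  proof (intro conjI ballI V(5) holomorphic_map_on_open[OF V(5)])
    show "(snd c \<circ> p) ` V \<subseteq> chart_image c" using V(4) by (auto simp: chart_image_def)
    fix y assume "y \<in> (snd c \<circ> p) ` V"
    then obtain v where v: "v \<in> V" "y = snd c (p v)" by auto
    then have "k y = v" using V(6) by simp
    then show "k y \<in> W" "p (k y) \<in> fst c" "snd c (p (k y)) = y" using v V(3,4) by auto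
  qed
  moreover have "z \<in> (snd c \<circ> p) ` V" using V(2) w x by (intro image_eqI[of _ _ w]) simp_all
  ultimately show ?thesis by (intro exI[of _ k] exI[of _ "(snd c \<circ> p) ` V"] conjI)
qed

text \<open>At \<open>z\<close> the two sections take values in one fibre, so a deck transformation
  matches them there; local injectivity of \<open>p\<close> extends the match to a
  neighbourhood.\<close>

lemma section_compare:
  assumes c: "c \<in> A" and s: "section_on c \<sigma> N" and t: "section_on c \<tau> N'" and z: "z \<in> N" "z \<in> N'"
  shows "\<exists>g\<in>deck. \<exists>U. open U \<and> z \<in> U \<and> U \<subseteq> N \<inter> N' \<and> (\<forall>y\<in>U. \<tau> y = g (\<sigma> y))"
proof -
  have pp: "p (\<sigma> y) = p (\<tau> y)" if "y \<in> N" "y \<in> N'" for y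
    using section_onD(5,6)[OF s that(1)] section_onD(5,6)[OF t that(2)] by (intro chart_inj[OF c]) simp_all
  obtain g where g: "g \<in> deck" "g (\<sigma> z) = \<tau> z"
    using deck_transitive[OF section_onD(4)[OF s z(1)] section_onD(4)[OF t z(2)] pp[OF z]] by blast
  obtain V where V: "open V" "\<tau> z \<in> V" "inj_on p V"
    using p_locally_injective[OF section_onD(4)[OF t z(2)]] by blast
  have oN: "open (N \<inter> N')" using section_onD(1)[OF s] section_onD(1)[OF t] by blast
  have ct: "continuous_on (N \<inter> N') \<tau>"
    by (rule continuous_on_subset[OF holomorphic_map_on_continuous[OF section_onD(3)[OF t]]]) blast
  have cs: "continuous_on (N \<inter> N') \<sigma>"
    by (rule continuous_on_subset[OF holomorphic_map_on_continuous[OF section_onD(3)[OF s]]]) blast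
  have cg: "continuous_on (N \<inter> N') (\<lambda>y. g (\<sigma> y))"
    by (rule continuous_on_compose2[OF deckD(1)[OF g(1)] cs]) (use section_image[OF s] in blast)
  define U where "U = ((N \<inter> N') \<inter> \<tau> -` V) \<inter> ((N \<inter> N') \<inter> (\<lambda>y. g (\<sigma> y)) -` V)"
  have "open U" unfolding U_def
    by (intro open_Int continuous_open_preimage[OF ct oN V(1)] continuous_open_preimage[OF cg oN V(1)])
  moreover have "z \<in> U" using z V(2) g(2) by (simp add: U_def)
  moreover have "U \<subseteq> N \<inter> N'" by (auto simp: U_def)
  moreover have "\<forall>y\<in>U. \<tau> y = g (\<sigma> y)"
  proof
    fix y assume "y \<in> U"
    then have y: "y \<in> N" "y \<in> N'" "\<tau> y \<in> V" "g (\<sigma> y) \<in> V" by (auto simp: U_def)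
    have "p (\<tau> y) = p (g (\<sigma> y))" using pp[OF y(1,2)] deckD(3)[OF g(1) section_onD(4)[OF s y(1)]] by simp
    then show "\<tau> y = g (\<sigma> y)" by (rule inj_onD[OF V(3) _ y(3,4)])
  qed
  ultimately show ?thesis by (intro bexI[OF _ g(1)] exI[of _ U] conjI)
qed

lemma smooth_section:
  assumes "section_on c \<sigma> N" shows "smooth_on (\<lambda>y. \<Phi> (\<sigma> y)) N"
  by (rule smooth_on_compose[OF holomorphic_map_on_imp_smooth_on[OF section_onD(3)[OF assms]] smooth_Phi
        section_image[OF assms]])

lemma section_pos:
  assumes "section_on c \<sigma> N" "y \<in> N" shows "\<Phi> (\<sigma> y) > 0"
  by (rule Phi_pos) (rule section_onD(4)[OF assms])

text \<open>Another section replaces \<Phi> o \<sigma> by a constant multiple near \<open>z\<close>,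
  and the constant cancels in both quotients.\<close>

lemma section_ratio:
  assumes c: "c \<in> A" and s: "section_on c \<sigma> N" and t: "section_on c \<tau> N'" and z: "z \<in> N" "z \<in> N'"
  shows "levi (\<lambda>y. \<Phi> (\<tau> y)) z v w / \<Phi> (\<tau> z) = levi (\<lambda>y. \<Phi> (\<sigma> y)) z v w / \<Phi> (\<sigma> z)"
    "ddir (\<lambda>y. \<Phi> (\<tau> y)) v z / \<Phi> (\<tau> z) = ddir (\<lambda>y. \<Phi> (\<sigma> y)) v z / \<Phi> (\<sigma> z)"
proof -
  obtain g U where g: "g \<in> deck" and U: "open U" "z \<in> U" "U \<subseteq> N \<inter> N'" "\<forall>y\<in>U. \<tau> y = g (\<sigma> y)"
    using section_compare[OF c s t z] by (elim bexE exE conjE) (rule that)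
  have eq: "\<Phi> (\<tau> y) = factor g * \<Phi> (\<sigma> y)" if "y \<in> U" for y
    using U(3,4) that Phi_deck[OF g section_onD(4)[OF s, of y]] by auto
  note f = less_imp_neq[OF factor_pos[OF g], symmetric]
  note F = smooth_section[OF s]
  have "levi (\<lambda>y. \<Phi> (\<tau> y)) z v w = levi (\<lambda>y. factor g * \<Phi> (\<sigma> y)) z v w"
    by (rule levi_cong_open[OF U(1,2)]) (rule eq)
  also have "\<dots> = factor g * levi (\<lambda>y. \<Phi> (\<sigma> y)) z v w" by (rule levi_mult[OF F z(1)])
  finally show "levi (\<lambda>y. \<Phi> (\<tau> y)) z v w / \<Phi> (\<tau> z) = levi (\<lambda>y. \<Phi> (\<sigma> y)) z v w / \<Phi> (\<sigma> z)"
    using f by (simp add: eq[OF U(2)])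
  have "ddir (\<lambda>y. \<Phi> (\<tau> y)) v z = ddir (\<lambda>y. factor g * \<Phi> (\<sigma> y)) v z"
    by (rule ddir_cong_open[OF U(1,2)]) (rule eq)
  also have "\<dots> = factor g * ddir (\<lambda>y. \<Phi> (\<sigma> y)) v z"
    by (rule ddir_eq, rule has_derivative_mult_right, rule smooth_on_has_derivative[OF F z(1)])
  finally show "ddir (\<lambda>y. \<Phi> (\<tau> y)) v z / \<Phi> (\<tau> z) = ddir (\<lambda>y. \<Phi> (\<sigma> y)) v z / \<Phi> (\<sigma> z)"
    using f by (simp add: eq[OF U(2)])
qed

text \<open>The choice may vary wildly with \<open>z\<close>. This is harmless: in the fields
  defined from it the section chosen at \<open>z\<close> stays fixed during differentiation, and the
  result is independent of the choice.\<close>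

definition chosen_section :: "('a, 'n) chart \<Rightarrow> complex^'n \<Rightarrow> complex^'n \<Rightarrow> complex^'n" where
  "chosen_section c z = (SOME \<sigma>. \<exists>N. z \<in> N \<and> section_on c \<sigma> N)"

definition lck_metric :: "('a, 'n) field2" where
  "lck_metric c z v w =
     levi (\<lambda>y. \<Phi> (chosen_section c z y)) z v w / \<Phi> (chosen_section c z z)"

definition lee_form :: "('a, 'n) field1" where
  "lee_form c z v = - (ddir (\<lambda>y. \<Phi> (chosen_section c z y)) v z / \<Phi> (chosen_section c z z))"

lemma lck_metric_eq:
  assumes c: "c \<in> A" and s: "section_on c \<sigma> N" and y: "y \<in> N"
  shows "lck_metric c y v w = levi (\<lambda>y. \<Phi> (\<sigma> y)) y v w / \<Phi> (\<sigma> y)"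
    "lee_form c y v = - (ddir (\<lambda>y. \<Phi> (\<sigma> y)) v y / \<Phi> (\<sigma> y))"
proof -
  have "\<exists>\<sigma> N. y \<in> N \<and> section_on c \<sigma> N" using s y by (intro exI[of _ \<sigma>] exI[of _ N] conjI)
  from someI_ex[OF this] have "\<exists>N. y \<in> N \<and> section_on c (chosen_section c y) N"
    unfolding chosen_section_def .
  then obtain N' where N': "y \<in> N'" "section_on c (chosen_section c y) N'" by (elim exE conjE) (rule that)
  show "lck_metric c y v w = levi (\<lambda>y. \<Phi> (\<sigma> y)) y v w / \<Phi> (\<sigma> y)"
    unfolding lck_metric_def by (rule section_ratio(1)[OF c s N'(2) y N'(1)])
  show "lee_form c y v = - (ddir (\<lambda>y. \<Phi> (\<sigma> y)) v y / \<Phi> (\<sigma> y))"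
    unfolding lee_form_def section_ratio(2)[OF c s N'(2) y N'(1)] ..
qed

text \<open>A section in the coordinates of \<open>d\<close>, precomposed with the transition map,
  is a section in the coordinates of \<open>c\<close>. Both charts can thus compute the fields from
  one and the same section.\<close>

lemma section_transition:
  assumes c: "c \<in> A" and d: "d \<in> A" and x: "x \<in> fst c \<inter> fst d"
    and t: "section_on d \<tau> N'" and z: "snd d x \<in> N'"
  shows "\<exists>U. snd c x \<in> U \<and> holomorphic_map_on (transition c d) U \<and> transition c d ` U \<subseteq> N' \<and>
    section_on c (\<lambda>y. \<tau> (transition c d y)) U \<and> transition c d (snd c x) = snd d x"
proof -
  let ?S = "snd c ` (fst c \<inter> fst d)"
  have hol: "holomorphic_map_on (transition c d) ?S"
    using manifold c d by (simp add: complex_manifold_def)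
  have tr: "transition c d (snd c y) = snd d y" if "y \<in> fst c" for y
  proof -
    have "inv_into (fst c) (snd c) (snd c y) = y"
      by (rule inv_into_f_f[OF inj_onI that]) (rule chart_inj[OF c])
    then show ?thesis by (simp add: transition_def)
  qed
  define U where "U = ?S \<inter> transition c d -` N'"
  have oU: "open U" unfolding U_def
    by (rule continuous_open_preimage[OF holomorphic_map_on_continuous[OF hol] holomorphic_map_on_open[OF hol] section_onD(1)[OF t]])
  have hU: "holomorphic_map_on (transition c d) U"
    by (rule holomorphic_map_on_subset[OF hol _ oU]) (simp add: U_def)
  have UN: "transition c d ` U \<subseteq> N'" by (auto simp: U_def)
  have "section_on c (\<lambda>y. \<tau> (transition c d y)) U"
    unfolding section_on_def
  proof (intro conjI ballI oU)
    show "U \<subseteq> chart_image c" by (auto simp: U_def chart_image_def)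
    show "holomorphic_map_on (\<lambda>y. \<tau> (transition c d y)) U"
      by (rule holomorphic_map_on_compose[OF hU section_onD(3)[OF t] UN])
    fix y assume y: "y \<in> U"
    then obtain x' where x': "x' \<in> fst c" "x' \<in> fst d" "y = snd c x'" by (auto simp: U_def)
    have ty: "transition c d y = snd d x'" using tr x' by simp
    have yN: "transition c d y \<in> N'" using y by (simp add: U_def)
    show "\<tau> (transition c d y) \<in> W" by (rule section_onD(4)[OF t yN])
    have "p (\<tau> (transition c d y)) = x'"
      by (rule chart_inj[OF d section_onD(5)[OF t yN] x'(2)]) (use section_onD(6)[OF t yN] ty in simp)
    then show "p (\<tau> (transition c d y)) \<in> fst c" "snd c (p (\<tau> (transition c d y))) = y" using x' by simp_all
  qed
  moreover have "snd c x \<in> U" using x z tr[of x] by (simp add: U_def)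
  moreover have "transition c d (snd c x) = snd d x" using x tr by simp
  ultimately show ?thesis using hU UN by (intro exI[of _ U] conjI)
qed

lemma pullback:
  assumes c: "c \<in> A" and d: "d \<in> A" and x: "x \<in> fst c \<inter> fst d"
  defines "D \<equiv> frechet_derivative (transition c d) (at (snd c x))"
  shows "lck_metric c (snd c x) v w = lck_metric d (snd d x) (D v) (D w)"
    "lee_form c (snd c x) v = lee_form d (snd d x) (D v)"
proof -
  have "snd d x \<in> chart_image d" using x by (simp add: chart_image_def)
  then obtain \<tau> N' where t: "snd d x \<in> N'" "section_on d \<tau> N'" using exists_section[OF d] by blast
  obtain U where U: "snd c x \<in> U" "holomorphic_map_on (transition c d) U" "transition c d ` U \<subseteq> N'"
    "section_on c (\<lambda>y. \<tau> (transition c d y)) U" "transition c d (snd c x) = snd d x"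
    using section_transition[OF c d x t(2,1)] by (elim exE conjE) (rule that)
  note F = smooth_section[OF t(2)]
  show "lck_metric c (snd c x) v w = lck_metric d (snd d x) (D v) (D w)"
    unfolding lck_metric_eq(1)[OF c U(4,1)] lck_metric_eq(1)[OF d t(2,1)] D_def
      levi_compose[OF U(2) F U(3,1)] U(5) ..
  show "lee_form c (snd c x) v = lee_form d (snd d x) (D v)"
    unfolding lck_metric_eq(2)[OF c U(4,1)] lck_metric_eq(2)[OF d t(2,1)] D_def
      ddir_compose[OF holomorphic_map_on_imp_smooth_on[OF U(2)] F U(3,1)] U(5) ..
qed

text \<open>The coordinate expression of \<open>p\<close> is a left inverse of \<sigma>, so the
  derivative of \<sigma> is injective and strict positivity of the Levi form of \<Phi> is
  inherited.\<close>

lemma levi_section_pos: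
  assumes c: "c \<in> A" and s: "section_on c \<sigma> N" and z: "z \<in> N" and v: "v \<noteq> 0"
  shows "levi (\<lambda>y. \<Phi> (\<sigma> y)) z v v > 0"
proof -
  have sW: "\<sigma> ` N \<subseteq> W" by (rule section_image[OF s])
  have sz: "\<sigma> z \<in> W" by (rule section_onD(4)[OF s z])
  obtain V k where V: "open V" "\<sigma> z \<in> V" "holomorphic_map_on (snd c \<circ> p) V"
    using local_chart[OF c sz section_onD(5)[OF s z]] by (elim exE conjE) (rule that)
  have oN: "open N" by (rule section_onD(1)[OF s])
  have hs: "holomorphic_map_on \<sigma> N" by (rule section_onD(3)[OF s])
  define U where "U = N \<inter> \<sigma> -` V"
  have oU: "open U" unfolding U_def
    by (rule continuous_open_preimage[OF holomorphic_map_on_continuous[OF hs] oN V(1)])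
  have zU: "z \<in> U" using z V(2) by (simp add: U_def)
  have sU: "smooth_on \<sigma> U"
    by (rule smooth_on_subset[OF holomorphic_map_on_imp_smooth_on[OF hs] _ oU]) (simp add: U_def)
  have "ddir \<sigma> v z \<noteq> 0"
  proof
    assume 0: "ddir \<sigma> v z = 0"
    have "v = ddir (\<lambda>y. y) v z" by simp
    also have "\<dots> = ddir (\<lambda>y. (snd c \<circ> p) (\<sigma> y)) v z"
      by (rule ddir_cong_open[OF oU zU]) (use section_onD(6)[OF s] in \<open>simp add: U_def\<close>)
    also have "\<dots> = ddir (snd c \<circ> p) (ddir \<sigma> v z) (\<sigma> z)"
      by (rule ddir_compose[OF sU holomorphic_map_on_imp_smooth_on[OF V(3)] _ zU]) (auto simp: U_def)
    also have "\<dots> = 0"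
      unfolding 0 by (rule linear_0[OF smooth_on_linear[OF holomorphic_map_on_imp_smooth_on[OF V(3)] V(2)]])
    finally show False using v by simp
  qed
  then show ?thesis
    unfolding levi_compose[OF hs smooth_Phi sW z] by (rule levi_Phi_pos[OF sz])
qed

section \<open>Smoothness and the structure equations in a chart\<close>

lemma chart_image_open:
  assumes "c \<in> A" shows "open (chart_image c)"
proof -
  have "is_chart M c" using manifold assms by (simp add: complex_manifold_def)
  then show ?thesis by (simp add: is_chart_def)
qed

lemma smooth_field:
  assumes c: "c \<in> A"
  shows "smooth_on (\<lambda>z. lck_metric c z v w) (chart_image c)" "smooth_on (\<lambda>z. lee_form c z v) (chart_image c)"
proof -
  have loc: "\<exists>N \<sigma>. z \<in> N \<and> section_on c \<sigma> N" if "z \<in> chart_image c" for z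
    using exists_section[OF c that] by blast
  show "smooth_on (\<lambda>z. lck_metric c z v w) (chart_image c)"
  proof (rule smooth_on_locally[OF chart_image_open[OF c]])
    fix z assume "z \<in> chart_image c"
    then obtain N \<sigma> where N: "z \<in> N" "section_on c \<sigma> N" using loc by blast
    have "smooth_on (\<lambda>y. levi (\<lambda>y. \<Phi> (\<sigma> y)) y v w / \<Phi> (\<sigma> y)) N"
      by (rule smooth_on_divide[OF smooth_on_levi[OF smooth_section[OF N(2)]] smooth_section[OF N(2)]])
         (use section_pos[OF N(2)] in force)
    then have "smooth_on (\<lambda>z. lck_metric c z v w) N"
      by (rule smooth_on_cong[THEN iffD2, rotated]) (rule lck_metric_eq(1)[OF c N(2)])
    then show "\<exists>T. open T \<and> z \<in> T \<and> T \<subseteq> chart_image c \<and> smooth_on (\<lambda>z. lck_metric c z v w) T"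
      using N section_onD(1,2)[OF N(2)] by (intro exI[of _ N] conjI)
  qed
  show "smooth_on (\<lambda>z. lee_form c z v) (chart_image c)"
  proof (rule smooth_on_locally[OF chart_image_open[OF c]])
    fix z assume "z \<in> chart_image c"
    then obtain N \<sigma> where N: "z \<in> N" "section_on c \<sigma> N" using loc by blast
    have "smooth_on (\<lambda>y. - (ddir (\<lambda>y. \<Phi> (\<sigma> y)) v y / \<Phi> (\<sigma> y))) N"
      by (rule smooth_on_minus[OF smooth_on_divide[OF smooth_on_ddir[OF smooth_section[OF N(2)]] smooth_section[OF N(2)]]])
         (use section_pos[OF N(2)] in force)
    then have "smooth_on (\<lambda>z. lee_form c z v) N"
      by (rule smooth_on_cong[THEN iffD2, rotated]) (rule lck_metric_eq(2)[OF c N(2)])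
    then show "\<exists>T. open T \<and> z \<in> T \<and> T \<subseteq> chart_image c \<and> smooth_on (\<lambda>z. lee_form c z v) T"
      using N section_onD(1,2)[OF N(2)] by (intro exI[of _ N] conjI)
  qed
qed

text \<open>All claims are local. For one section around \<open>z\<close> and F = \<Phi> o \<sigma>,
  the metric is the Levi form of F divided by F and the Lee form is - d log F on a whole
  neighbourhood, so the potential computations apply.\<close>

lemma lck_pointwise:
  assumes c: "c \<in> A" and z: "z \<in> chart_image c"
  shows "linear (lee_form c z)" "bilinear (lck_metric c z)" "lck_metric c z v w = lck_metric c z w v"
    "v \<noteq> 0 \<Longrightarrow> lck_metric c z v v > 0" "lck_metric c z (Jc v) (Jc w) = lck_metric c z v w"
    "ext_deriv1 (lee_form c) z u v = 0"
    "ext_deriv2 (fundamental_form lck_metric c) z u v w =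
      wedge12 (lee_form c z) (fundamental_form lck_metric c z) u v w"
proof -
  obtain \<sigma> N where N: "z \<in> N" "section_on c \<sigma> N" using exists_section[OF c z] by blast
  define F where "F = (\<lambda>y. \<Phi> (\<sigma> y))"
  have F: "smooth_on F N" unfolding F_def by (rule smooth_section[OF N(2)])
  have pos: "F y > 0" if "y \<in> N" for y unfolding F_def by (rule section_pos[OF N(2) that])
  have h: "lck_metric c y v w = levi F y v w / F y" if "y \<in> N" for y v w
    unfolding F_def by (rule lck_metric_eq(1)[OF c N(2) that])
  have th: "lee_form c y v = - (ddir F v y / F y)" if "y \<in> N" for y v
    unfolding F_def by (rule lck_metric_eq(2)[OF c N(2) that])
  have "linear (\<lambda>v. (- 1 / F z) *\<^sub>R ddir F v z)"
    by (rule linear_compose_scale_right[OF smooth_on_linear[OF F N(1)]])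
  moreover have "lee_form c z = (\<lambda>v. (- 1 / F z) *\<^sub>R ddir F v z)" by (rule ext) (simp add: th[OF N(1)])
  ultimately show "linear (lee_form c z)" by simp
  have bl: "bilinear (levi F z)" by (rule bilinear_levi[OF F N(1)])
  have "bilinear (\<lambda>v w. (1 / F z) *\<^sub>R levi F z v w)"
    unfolding bilinear_def
    by (intro conjI allI linear_compose_scale_right) (use bl in \<open>simp_all add: bilinear_def\<close>)
  moreover have "lck_metric c z = (\<lambda>v w. (1 / F z) *\<^sub>R levi F z v w)" by (intro ext) (simp add: h[OF N(1)])
  ultimately show "bilinear (lck_metric c z)" by simp
  show "lck_metric c z v w = lck_metric c z w v" unfolding h[OF N(1)] levi_sym[OF F N(1), of v w] ..
  show "v \<noteq> 0 \<Longrightarrow> lck_metric c z v v > 0"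
    unfolding h[OF N(1)] F_def
    by (rule divide_pos_pos[OF levi_section_pos[OF c N(2,1)] section_pos[OF N(2,1)]])
  show "lck_metric c z (Jc v) (Jc w) = lck_metric c z v w" unfolding h[OF N(1)] levi_Jc[OF F N(1)] ..
  have nz: "F y \<noteq> 0" if "y \<in> N" for y using pos[OF that] by simp
  show "ext_deriv1 (lee_form c) z u v = 0" by (rule ext_deriv1_dlog[OF F N(1) nz th])
  show "ext_deriv2 (fundamental_form lck_metric c) z u v w =
      wedge12 (lee_form c z) (fundamental_form lck_metric c z) u v w"
    by (rule ext_deriv2_levi[OF F N(1) nz th[OF N(1)]]) (simp_all only: fundamental_form_def h)
qed

lemma lck_structure_potential: "lck_structure A lck_metric lee_form"
  unfolding lck_structure_def hermitian_metric_def closed_one_form_def smooth_bilinear_field_def smooth_one_form_def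
  by (intro conjI ballI allI impI lck_pointwise smooth_field pullback)

end

theorem mainTheorem1:
  fixes M :: "'a::topological_space set"
    and A :: "('a, 'n::finite) chart set"
  assumes "CARD('n) \<ge> 2"
    and "hopf_manifold M A"
  shows "\<exists>h \<theta>. lck_structure A h \<theta>"
proof -
  have M: "complex_manifold M A" "compact M" using assms(2) by (auto simp: hopf_manifold_def)
  obtain p where p: "holomorphic_universal_covering (- {0}) p M A"
    using assms(2) unfolding hopf_manifold_def by (elim conjE exE) (rule that)
  obtain e :: "'a \<Rightarrow> (nat \<Rightarrow>\<^sub>C (real \<times> (complex^'n)))" where e: "continuous_on M e" "inj_on e M"
    using compact_manifold_embedding[OF M] by (elim exE conjE) (rule that)
  interpret hopf_covering M A p e
    by unfold_locales (fact M p assms(1) e)+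
  obtain \<Phi> c where Phi: "smooth_on \<Phi> W" "\<forall>z\<in>W. \<Phi> z > 0" "\<forall>z\<in>W. \<forall>v. v \<noteq> 0 \<longrightarrow> levi \<Phi> z v v > 0"
    "\<forall>g\<in>deck. c g > 0 \<and> (\<forall>z\<in>W. \<Phi> (g z) = c g * \<Phi> z)"
    using automorphic_potential by (elim exE conjE) (rule that)
  interpret hopf_potential M A p e \<Phi> c
  proof unfold_locales
    show "smooth_on \<Phi> (- {0})" by (rule Phi(1))
  qed (use Phi(2-4) in blast)+
  show ?thesis using lck_structure_potential by (intro exI)
qed

end
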